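(* Let $N>2$ be an integer, let $2^*=\frac{2N}{N-2}$ and let $1\le p<2^*$. For every bounded open set $\Omega\subset\mathbb{R}^N$ containing the origin, the inequality $$\int_{\Omega}|\nabla u|^{2}\,dx-\frac{(N-2)^{2}}{4}\int_{\Omega}\frac{u^{2}}{|x|^{2}}\,dx\;\geq\; C(p,|\Omega|)\,\|u\|^2_{p,1}\qquad\text{for all } u\in H_0^1(\Omega)$$ holds with $$C(p,|\Omega|)=\frac{2\left(\frac{N}{p}-\frac{N}{2}+1\right)^{3}}{N\,|\Omega|^{\frac{2}{N}\left(\frac{N}{p}-\frac{N}{2}+1\right)}}\;\omega_N^{2/N}.$$ Moreover this value is optimal among constants depending only on $N$, $p$ and $|\Omega|$: for every $m>0$, $C(p,m)$ is the largest constant for which the inequality holds for every bounded open set $\Omega\subset\mathbb{R}^N$ containing the origin with $|\Omega|=m$ and every $u\in H_0^1(\Omega)$.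
   Context: $|\Omega|$ is the Lebesgue measure of $\Omega$ and $\omega_N$ is the measure of the unit ball of $\mathbb{R}^N$. $\Omega^\#$ is the open ball of $\mathbb{R}^N$ centered at the origin with $|\Omega^\#|=|\Omega|$. For a measurable function $u$ on $\Omega$, $u^\#$ denotes its spherical decreasing rearrangement: the spherically symmetric function on $\Omega^\#$, decreasing along the radius, with the same distribution function as $|u|$. For $0<r,s<\infty$, $$\|u\|_{r,s}=\omega_N^{1/r-1/s}\left(\int_{\Omega^\#}\left[u^\#(x)|x|^{N/r}\right]^s\frac{dx}{|x|^N}\right)^{1/s};$$ in particular $\|u\|_{p,1}=\omega_N^{1/p-1}\int_{\Omega^\#}u^\#(x)\,|x|^{N/p-N}\,dx$. *)

theory Defs
  imports "HOL-Analysis.Analysis"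
begin

section \<open>Test functions and the Sobolev space H01\<close>

text \<open>\<open>Ck k f\<close>: all iterated directional derivatives of \<open>f\<close> of order at most \<open>k\<close> exist as
  Frechet derivatives and are continuous.\<close>

primrec Ck :: "nat \<Rightarrow> ('a::euclidean_space \<Rightarrow> real) \<Rightarrow> bool" where
  "Ck 0 f \<longleftrightarrow> continuous_on UNIV f"
| "Ck (Suc k) f \<longleftrightarrow> (\<forall>x. f differentiable (at x)) \<and>
      (\<forall>v. Ck k (\<lambda>x. frechet_derivative f (at x) v))"

definition test_functions :: "'a::euclidean_space set \<Rightarrow> ('a \<Rightarrow> real) set" where
  "test_functions \<Omega> =
     {\<phi>. (\<forall>k. Ck k \<phi>) \<and> compact (closure {x. \<phi> x \<noteq> 0}) \<and> closure {x. \<phi> x \<noteq> 0} \<subseteq> \<Omega>}"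

definition gradient :: "('a::euclidean_space \<Rightarrow> real) \<Rightarrow> 'a \<Rightarrow> 'a" where
  "gradient \<phi> x = (\<Sum>b\<in>Basis. frechet_derivative \<phi> (at x) b *\<^sub>R b)"

definition locally_integrable_on :: "('a::euclidean_space \<Rightarrow> 'b::euclidean_space) \<Rightarrow> 'a set \<Rightarrow> bool" where
  "locally_integrable_on f \<Omega> \<longleftrightarrow> (\<forall>K. compact K \<and> K \<subseteq> \<Omega> \<longrightarrow> integrable (lebesgue_on K) f)"

definition weak_gradient :: "'a::euclidean_space set \<Rightarrow> ('a \<Rightarrow> real) \<Rightarrow> ('a \<Rightarrow> 'a) \<Rightarrow> bool" where
  "weak_gradient \<Omega> u g \<longleftrightarrow>
     locally_integrable_on u \<Omega> \<and> locally_integrable_on g \<Omega> \<and>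
     (\<forall>\<phi>\<in>test_functions \<Omega>. \<forall>b\<in>Basis.
        (\<integral>x. u x * (gradient \<phi> x \<bullet> b) \<partial>lebesgue_on \<Omega>) = - (\<integral>x. (g x \<bullet> b) * \<phi> x \<partial>lebesgue_on \<Omega>))"

definition square_integrable_on :: "('a::euclidean_space \<Rightarrow> 'b::euclidean_space) \<Rightarrow> 'a set \<Rightarrow> bool" where
  "square_integrable_on f \<Omega> \<longleftrightarrow>
     f \<in> borel_measurable (lebesgue_on \<Omega>) \<and> integrable (lebesgue_on \<Omega>) (\<lambda>x. (norm (f x))\<^sup>2)"

text \<open>\<open>H1_gradient \<Omega> u g\<close>: \<open>u\<close> belongs to the Sobolev space H1 on \<open>\<Omega>\<close> and \<open>g\<close> is its weak gradient
  (which is unique up to null sets).\<close>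

definition H1_gradient :: "'a::euclidean_space set \<Rightarrow> ('a \<Rightarrow> real) \<Rightarrow> ('a \<Rightarrow> 'a) \<Rightarrow> bool" where
  "H1_gradient \<Omega> u g \<longleftrightarrow>
     square_integrable_on u \<Omega> \<and> square_integrable_on g \<Omega> \<and> weak_gradient \<Omega> u g"

text \<open>\<open>H01_gradient \<Omega> u g\<close>: \<open>u\<close> belongs to the closure of the test functions in H1 on \<open>\<Omega>\<close>,
  and \<open>g\<close> is its weak gradient. The expression tending to zero is the square of the H1 norm of
  \<open>u - \<phi> k\<close>.\<close>

definition H01_gradient :: "'a::euclidean_space set \<Rightarrow> ('a \<Rightarrow> real) \<Rightarrow> ('a \<Rightarrow> 'a) \<Rightarrow> bool" where
  "H01_gradient \<Omega> u g \<longleftrightarrow> H1_gradient \<Omega> u g \<and>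
     (\<exists>\<phi>. (\<forall>k::nat. \<phi> k \<in> test_functions \<Omega>) \<and>
        (\<lambda>k. (\<integral>x. (u x - \<phi> k x)\<^sup>2 \<partial>lebesgue_on \<Omega>)
            + (\<integral>x. (norm (g x - gradient (\<phi> k) x))\<^sup>2 \<partial>lebesgue_on \<Omega>)) \<longlonglongrightarrow> 0)"


section \<open>Spherical decreasing rearrangement and Lorentz norms\<close>

definition sharp_set :: "'a::euclidean_space set \<Rightarrow> 'a set" where
  "sharp_set \<Omega> =
     ball 0 ((measure lebesgue \<Omega> / unit_ball_vol (real DIM('a))) powr (1 / real DIM('a)))"

lemma powr_inverse_power:
  fixes q :: real
  assumes "q \<ge> 0" "n > 0"
  shows "(q powr (1 / real n)) ^ n = q"
  using assms by (cases "q = 0") (simp_all add: powr_realpow[symmetric] powr_powr)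

lemma measure_sharp_set:
  fixes \<Omega> :: "'a::euclidean_space set"
  shows "measure lebesgue (sharp_set \<Omega>) = measure lebesgue \<Omega>"
proof -
  define q where "q = measure lebesgue \<Omega> / unit_ball_vol (real DIM('a))"
  have q: "q \<ge> 0" by (simp add: q_def)
  have "measure lebesgue (sharp_set \<Omega>)
      = unit_ball_vol (real DIM('a)) * (q powr (1 / real DIM('a))) ^ DIM('a)"
    unfolding sharp_set_def q_def[symmetric] by (simp add: content_ball)
  also have "(q powr (1 / real DIM('a))) ^ DIM('a) = q"
    using q by (simp add: powr_inverse_power)
  finally show ?thesis
    using less_imp_neq[OF unit_ball_vol_pos[of "real DIM('a)"]] by (simp add: q_def)
qed

text \<open>The values lie in \<^typ>\<open>ennreal\<close> because a rearrangement may be infinite at the origin. For points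
  of equal norm the monotonicity condition applies in both directions, so it includes spherical
  symmetry.\<close>

definition is_rearrangement ::
  "'a::euclidean_space set \<Rightarrow> ('a \<Rightarrow> real) \<Rightarrow> ('a \<Rightarrow> ennreal) \<Rightarrow> bool" where
  "is_rearrangement \<Omega> u v \<longleftrightarrow>
     (\<forall>x\<in>sharp_set \<Omega>. \<forall>y\<in>sharp_set \<Omega>. norm x \<le> norm y \<longrightarrow> v y \<le> v x) \<and>
     (\<forall>t\<ge>0. emeasure lebesgue {x \<in> sharp_set \<Omega>. v x > ennreal t}
           = emeasure lebesgue {x \<in> \<Omega>. \<bar>u x\<bar> > t})"

text \<open>Two rearrangements of the same function differ on a null set only, so integrals of the chosen
  one do not depend on the choice.\<close>

definition rearrangement :: "'a::euclidean_space set \<Rightarrow> ('a \<Rightarrow> real) \<Rightarrow> 'a \<Rightarrow> ennreal" where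
  "rearrangement \<Omega> u = (SOME v. is_rearrangement \<Omega> u v)"

lemma is_rearrangement_rearrangement:
  fixes \<Omega> :: "'a::euclidean_space set"
  assumes \<Omega>: "\<Omega> \<in> lmeasurable" and u: "u \<in> borel_measurable (lebesgue_on \<Omega>)"
  shows "is_rearrangement \<Omega> u (rearrangement \<Omega> u)"
proof -
  let ?N = "DIM('a)"
  let ?w = "unit_ball_vol (real ?N)"
  have w: "?w > 0" by simp
  define A where "A t = {x \<in> \<Omega>. \<bar>u x\<bar> > t}" for t :: real
  define \<mu> where "\<mu> t = measure lebesgue (A t)" for t
  define v where "v x = Inf {ennreal t | t. 0 \<le> t \<and> \<mu> t \<le> measure lebesgue (ball (0::'a) (norm x))}" for x :: 'a
  have \<Omega>s: "\<Omega> \<in> sets lebesgue" using \<Omega> by (simp add: fmeasurableD)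
  have As: "A t \<in> sets lebesgue" for t
  proof -
    have "(\<lambda>x. \<bar>u x\<bar>) \<in> borel_measurable (lebesgue_on \<Omega>)" using u by measurable
    then have "{x \<in> space (lebesgue_on \<Omega>). t < \<bar>u x\<bar>} \<in> sets (lebesgue_on \<Omega>)"
      by (rule borel_measurable_less[OF borel_measurable_const])
    then show ?thesis
      using \<Omega>s by (simp add: A_def space_restrict_space sets_restrict_space_iff)
  qed
  have A\<Omega>: "A t \<subseteq> \<Omega>" for t by (auto simp: A_def)
  have Af: "A t \<in> lmeasurable" for t using fmeasurableI2[OF \<Omega> A\<Omega> As] .
  have \<mu>_anti: "\<mu> t \<le> \<mu> s" if "s \<le> t" for s t
    unfolding \<mu>_def by (rule measure_mono_fmeasurable) (use that As Af in \<open>auto simp: A_def\<close>)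
  have \<mu>_le: "\<mu> t \<le> measure lebesgue \<Omega>" for t
    unfolding \<mu>_def by (rule measure_mono_fmeasurable[OF A\<Omega> As \<Omega>])
  have right_cont: "\<exists>t'>t. c < \<mu> t'" if "c < \<mu> t" for c t
  proof -
    have "(\<Union>n. A (t + 1 / Suc n)) = A t"
    proof (intro equalityI subsetI)
      fix x assume "x \<in> A t"
      then have x: "x \<in> \<Omega>" "\<bar>u x\<bar> - t > 0" by (auto simp: A_def)
      obtain n where "inverse (real (Suc n)) < \<bar>u x\<bar> - t" using reals_Archimedean[OF x(2)] by blast
      then have "x \<in> A (t + 1 / Suc n)" using x by (simp add: A_def inverse_eq_divide)
      then show "x \<in> (\<Union>n. A (t + 1 / Suc n))" by blast
    next
      fix x assume "x \<in> (\<Union>n. A (t + 1 / Suc n))"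
      then obtain n where "x \<in> \<Omega>" "\<bar>u x\<bar> > t + 1 / Suc n" by (auto simp: A_def)
      moreover have "1 / real (Suc n) > 0" by simp
      ultimately show "x \<in> A t" unfolding A_def by (smt (verit) mem_Collect_eq)
    qed
    moreover have "(\<lambda>n. measure lebesgue (A (t + 1 / Suc n))) \<longlonglongrightarrow> measure lebesgue (\<Union>n. A (t + 1 / Suc n))"
    proof (rule Lim_measure_incseq)
      show "range (\<lambda>n. A (t + 1 / real (Suc n))) \<subseteq> sets lebesgue" using As by blast
      show "incseq (\<lambda>n. A (t + 1 / real (Suc n)))"
        unfolding incseq_def
      proof (intro allI impI subsetI)
        fix m n :: nat and x assume "m \<le> n" and x: "x \<in> A (t + 1 / real (Suc m))"
        then have "1 / real (Suc n) \<le> 1 / real (Suc m)" by (simp add: frac_le)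
        with x show "x \<in> A (t + 1 / real (Suc n))" by (simp add: A_def)
      qed
      show "emeasure lebesgue (\<Union>n. A (t + 1 / real (Suc n))) \<noteq> \<infinity>"
        unfolding calculation infinity_ennreal_def using Af[of t] by (rule fmeasurableD2)
    qed
    ultimately have "(\<lambda>n. \<mu> (t + 1 / Suc n)) \<longlonglongrightarrow> \<mu> t" by (simp add: \<mu>_def)
    from order_tendstoD(1)[OF this that] obtain n where "c < \<mu> (t + 1 / Suc n)"
      by (auto simp: eventually_sequentially)
    then show ?thesis by (intro exI[of _ "t + 1 / Suc n"]) simp
  qed
  have key: "v x > ennreal t \<longleftrightarrow> \<mu> t > measure lebesgue (ball (0::'a) (norm x))" if t: "t \<ge> 0" for x t
  proof
    assume vt: "v x > ennreal t"
    have vle: "v x \<le> ennreal t" if "\<mu> t \<le> measure lebesgue (ball (0::'a) (norm x))"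
      unfolding v_def using that t by (intro Inf_lower CollectI exI[of _ t] conjI refl)
    show "\<mu> t > measure lebesgue (ball (0::'a) (norm x))"
    proof (rule ccontr)
      assume "\<not> \<mu> t > measure lebesgue (ball (0::'a) (norm x))"
      then have "v x \<le> ennreal t" by (intro vle) (simp only: not_less)
      with vt show False by (simp only: leD)
    qed
  next
    assume "\<mu> t > measure lebesgue (ball (0::'a) (norm x))"
    from right_cont[OF this] obtain t' where t': "t' > t" "measure lebesgue (ball (0::'a) (norm x)) < \<mu> t'"
      by (elim exE conjE)
    have "ennreal t' \<le> v x"
      unfolding v_def
    proof (rule Inf_greatest)
      fix y assume "y \<in> {ennreal s | s. 0 \<le> s \<and> \<mu> s \<le> measure lebesgue (ball (0::'a) (norm x))}"
      then obtain s where s: "y = ennreal s" "\<mu> s \<le> measure lebesgue (ball (0::'a) (norm x))"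
        by (elim CollectE exE conjE)
      then have "\<not> s \<le> t'" using \<mu>_anti[of s t'] t' by linarith
      then show "ennreal t' \<le> y" using s(1) by (simp add: ennreal_leI)
    qed
    moreover have "ennreal t < ennreal t'" using t t' by (simp add: ennreal_less_iff)
    ultimately show "v x > ennreal t" by (simp only: less_le_trans)
  qed
  have "is_rearrangement \<Omega> u v"
    unfolding is_rearrangement_def
  proof (intro conjI ballI allI impI)
    fix x y :: 'a assume "norm x \<le> norm y"
    then have "measure lebesgue (ball 0 (norm x) :: 'a set) \<le> measure lebesgue (ball 0 (norm y) :: 'a set)"
      by (intro measure_mono_fmeasurable) (auto intro: subset_ball)
    then show "v y \<le> v x" unfolding v_def by (intro Inf_superset_mono) (auto intro: order_trans)
  next
    fix t :: real assume t: "t \<ge> 0"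
    define \<rho> where "\<rho> = (\<mu> t / ?w) powr (1 / real ?N)"
    have \<mu>0: "\<mu> t \<ge> 0" by (simp add: \<mu>_def)
    have \<rho>0: "\<rho> \<ge> 0" by (simp add: \<rho>_def)
    have "\<rho> ^ ?N = \<mu> t / ?w"
      unfolding \<rho>_def by (rule powr_inverse_power) (use \<mu>0 w in simp_all)
    note \<rho> = \<rho>0 this
    have \<rho>R: "ball 0 \<rho> \<subseteq> sharp_set \<Omega>"
      unfolding sharp_set_def \<rho>_def
      by (intro subset_ball powr_mono2 divide_right_mono \<mu>_le divide_nonneg_nonneg \<mu>0) (use w in auto)
    have "{x \<in> sharp_set \<Omega>. v x > ennreal t} = ball (0::'a) \<rho>"
    proof -
      have "v x > ennreal t \<longleftrightarrow> norm x < \<rho>" for x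
      proof -
        have "v x > ennreal t \<longleftrightarrow> ?w * norm x ^ ?N < \<mu> t" using key[OF t] by (simp add: content_ball)
        also have "\<dots> \<longleftrightarrow> norm x ^ ?N < \<rho> ^ ?N" using w \<rho>(2) by (simp add: field_simps)
        also have "\<dots> \<longleftrightarrow> norm x < \<rho>"
          using \<rho>(1) by (meson DIM_positive norm_ge_zero power_less_imp_less_base power_strict_mono)
        finally show ?thesis .
      qed
      then show ?thesis using \<rho>R by auto
    qed
    moreover have "emeasure lebesgue (ball 0 \<rho> :: 'a set) = ennreal (\<mu> t)"
      using \<rho> less_imp_neq[OF w] by (simp add: emeasure_ball)
    moreover have "emeasure lebesgue (A t) = ennreal (\<mu> t)"
      unfolding \<mu>_def by (rule emeasure_eq_measure2) (use Af fmeasurableD2 in auto)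
    ultimately show "emeasure lebesgue {x \<in> sharp_set \<Omega>. v x > ennreal t}
        = emeasure lebesgue {x \<in> \<Omega>. \<bar>u x\<bar> > t}" by (simp add: A_def)
  qed
  then show ?thesis unfolding rearrangement_def by (rule someI[of "is_rearrangement \<Omega> u"])
qed

text \<open>Real power on \<^typ>\<open>ennreal\<close>, meant for positive exponents.\<close>

definition ennreal_powr :: "ennreal \<Rightarrow> real \<Rightarrow> ennreal" where
  "ennreal_powr a s = (if a = \<infinity> then \<infinity> else ennreal (enn2real a powr s))"

definition lorentz_norm ::
  "'a::euclidean_space set \<Rightarrow> real \<Rightarrow> real \<Rightarrow> ('a \<Rightarrow> real) \<Rightarrow> ennreal" where
  "lorentz_norm \<Omega> r s u =
     ennreal (unit_ball_vol (real DIM('a)) powr (1 / r - 1 / s)) *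
     ennreal_powr
       (\<integral>\<^sup>+x. ennreal_powr (rearrangement \<Omega> u x * ennreal (norm x powr (real DIM('a) / r))) s
              / ennreal (norm x ^ DIM('a)) \<partial>lebesgue_on (sharp_set \<Omega>))
       (1 / s)"


section \<open>The improved Hardy inequality\<close>

text \<open>All integrals are taken in the extended reals. Since the weak gradient is square integrable,
  the difference on the left is well defined, and the inequality with a positive constant fails if
  the Hardy term or the Lorentz norm is infinite.\<close>

definition hardy_lorentz_ineq ::
  "real \<Rightarrow> real \<Rightarrow> 'a::euclidean_space set \<Rightarrow> ('a \<Rightarrow> real) \<Rightarrow> ('a \<Rightarrow> 'a) \<Rightarrow> bool" where
  "hardy_lorentz_ineq p c \<Omega> u g \<longleftrightarrow>
     enn2ereal (\<integral>\<^sup>+x. ennreal ((norm (g x))\<^sup>2) \<partial>lebesgue_on \<Omega>)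
     - ereal ((real DIM('a) - 2)\<^sup>2 / 4)
         * enn2ereal (\<integral>\<^sup>+x. ennreal ((u x)\<^sup>2 / (norm x)\<^sup>2) \<partial>lebesgue_on \<Omega>)
     \<ge> ereal c * (enn2ereal (lorentz_norm \<Omega> p 1 u))\<^sup>2"

definition hardy_lorentz_const :: "nat \<Rightarrow> real \<Rightarrow> real \<Rightarrow> real" where
  "hardy_lorentz_const N p m =
     2 * (real N / p - real N / 2 + 1) ^ 3
       / (real N * m powr (2 / real N * (real N / p - real N / 2 + 1)))
       * unit_ball_vol (real N) powr (2 / real N)"

end

theory Submission
  imports Defs
begin

text \<open>
  Write \<open>w\<close> for the volume of the unit ball, \<open>b = (N - 2) / 2\<close> and \<open>\<gamma> = N / p - b\<close>, which is positive
  exactly when \<open>p\<close> is subcritical.  For a test function \<open>\<phi>\<close> with modulus \<open>f\<close> let \<open>R t\<close> be the radius of the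
  ball that has the volume of \<open>{f > t}\<close>.

  The Brunn-Minkowski inequality bounds the volume of an \<open>e\<close>-neighbourhood of \<open>{f > t}\<close> from below.
  Integrated over \<open>t\<close> and exchanged by Fubini this is a one-sided coarea formula
  (\<open>coarea_inequality\<close>): for every Borel weight \<open>h \<ge> 0\<close>, the integral of \<open>h (f x) * norm (gradient \<phi> x)\<close>
  is at least the integral of \<open>h t * (N * w * R t ^ (N - 1))\<close> over \<open>t \<ge> 0\<close>.  It takes over the role of
  the Polya-Szego inequality and needs neither symmetrized functions of Sobolev class nor a coarea
  formula.  Combined with \<open>2 * h * norm (gradient \<phi>) \<le> (norm (gradient \<phi>))\<^sup>2 + h\<^sup>2\<close> it bounds the Dirichlet
  integral from below by quantities that depend on the distribution function of \<open>f\<close> only.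

  The weight is \<open>h t = b * t / R t + l * R t powr (N / p - N + 1)\<close>.  Its first term alone gives the
  Hardy inequality.  The contributions linear in \<open>l\<close> add up to a multiple of the integral of \<open>R t powr (N / p)\<close>, which
  is the Lorentz norm up to a factor (\<open>lorentz_norm_eq\<close>), and the integral of the square of the
  second term is at most that of \<open>l\<^sup>2 * norm x powr (2 * \<gamma> - N)\<close> over the ball with the volume of
  \<open>\<Omega>\<close>.  The result is a concave quadratic
  polynomial in \<open>l\<close>; its maximum is the stated right-hand side (\<open>improved_hardy_profile\<close>,
  \<open>improved_hardy_test_function\<close>).  Fatou's lemma extends the inequality to the Sobolev space
  (\<open>improved_hardy_H01\<close>).

  All steps are equalities for a radial decreasing \<open>f\<close> with \<open>- f' = b * f / r + l * r powr (\<gamma> - N / 2)\<close>.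
  On the ball of radius \<open>R\<close> the solutions are the multiples of \<open>r powr (- b) * (R powr \<gamma> - r powr \<gamma>)\<close>,
  whose Dirichlet integral diverges at the origin.  Replacing it by
  \<open>r powr (- b) * (R powr (\<gamma> - k) * r powr k - r powr \<gamma>)\<close> makes the integral finite, and for this
  function the constant cannot exceed the stated one by more than the factor \<open>(k + \<gamma>) / \<gamma>\<close>
  (\<open>near_optimal_bound\<close>); letting \<open>k\<close> tend to zero proves optimality.  Smooth compactly supported
  approximations are chosen so that their gradients stay below the gradient of the limit.  No
  convergence of Dirichlet integrals is then needed, and the other two terms are handled by Fatou.
\<close>

section \<open>The Brunn-Minkowski inequality for open sets\<close>

text \<open>Unions of such families are the sets for which Brunn-Minkowski is proved by induction on the number
  of boxes; cutting one by a hyperplane that separates two boxes lowers that number on both sides.\<close>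

definition box_family :: "'a::euclidean_space set set \<Rightarrow> bool" where
  "box_family F \<longleftrightarrow> finite F \<and> pairwise disjnt F \<and> (\<forall>S\<in>F. S \<noteq> {} \<and> (\<exists>a b. S = box a b))"

lemma box_Int_lower_halfspace:
  fixes a b :: "'a::euclidean_space"
  assumes "i \<in> Basis"
  shows "\<exists>b'. box a b \<inter> {x. x \<bullet> i < c} = box a b'"
proof (rule exI)
  show "box a b \<inter> {x. x \<bullet> i < c} = box a (b + (min (b \<bullet> i) c - b \<bullet> i) *\<^sub>R i)"
    using assms by (auto simp: mem_box inner_simps inner_Basis split: if_splits)
qed

lemma box_Int_upper_halfspace:
  fixes a b :: "'a::euclidean_space"
  assumes "i \<in> Basis"
  shows "\<exists>a'. box a b \<inter> {x. x \<bullet> i > c} = box a' b"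
proof (rule exI)
  show "box a b \<inter> {x. x \<bullet> i > c} = box (a + (max (a \<bullet> i) c - a \<bullet> i) *\<^sub>R i) b"
    using assms by (auto simp: mem_box inner_simps inner_Basis split: if_splits)
qed

lemma box_family_Int:
  assumes F: "box_family F" and H: "\<And>a b. \<exists>a' b'. box a b \<inter> H = box a' b'"
  shows "box_family ((\<lambda>S. S \<inter> H) ` F - {{}})" "\<Union>((\<lambda>S. S \<inter> H) ` F - {{}}) = \<Union>F \<inter> H"
    "card ((\<lambda>S. S \<inter> H) ` F - {{}}) \<le> card F"
    "S \<in> F \<Longrightarrow> S \<inter> H = {} \<Longrightarrow> card ((\<lambda>S. S \<inter> H) ` F - {{}}) < card F"
proof -
  have fin: "finite F" using F by (simp add: box_family_def)
  have "\<exists>a b. S \<inter> H = box a b" if "S \<in> F" for S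
    using F H that unfolding box_family_def by metis
  moreover have "pairwise disjnt ((\<lambda>S. S \<inter> H) ` F - {{}})"
    using F unfolding box_family_def pairwise_def disjnt_def by fastforce
  ultimately show "box_family ((\<lambda>S. S \<inter> H) ` F - {{}})"
    using fin unfolding box_family_def by auto
  show "\<Union>((\<lambda>S. S \<inter> H) ` F - {{}}) = \<Union>F \<inter> H" by auto
  show "card ((\<lambda>S. S \<inter> H) ` F - {{}}) \<le> card F"
    by (meson Diff_subset card_image_le card_mono fin finite_imageI le_trans)
  assume S: "S \<in> F" "S \<inter> H = {}"
  have "(\<lambda>S. S \<inter> H) ` F - {{}} \<subseteq> (\<lambda>S. S \<inter> H) ` (F - {S})" using S by auto
  then have "card ((\<lambda>S. S \<inter> H) ` F - {{}}) \<le> card (F - {S})"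
    by (meson card_image_le card_mono fin finite_Diff finite_imageI le_trans)
  also have "\<dots> < card F" using S(1) fin by (meson card_Diff1_less)
  finally show "card ((\<lambda>S. S \<inter> H) ` F - {{}}) < card F" .
qed

lemma box_family_open: "box_family F \<Longrightarrow> open (\<Union>F)"
  unfolding box_family_def by (metis open_Union open_box)

lemma box_family_bounded: "box_family F \<Longrightarrow> bounded (\<Union>F)"
  unfolding box_family_def by (metis bounded_Union bounded_box)

lemma bounded_set_plus:
  fixes A B :: "'a::real_normed_vector set"
  shows "bounded A \<Longrightarrow> bounded B \<Longrightarrow> bounded (A + B)"
  using bounded_sums[of A B] by (simp add: set_plus_def Setcompr_eq_image) (auto simp: bounded_iff, blast)

lemma open_set_plus:
  fixes A B :: "'a::real_normed_vector set"
  assumes "open A" shows "open (A + B)"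
proof -
  have "A + B = (\<Union>y\<in>B. (+) y ` A)" by (auto simp: set_plus_def image_iff) (metis add.commute)+
  then show ?thesis using assms by (auto intro!: open_translation)
qed

lemma measure_open_pos:
  fixes A :: "'a::euclidean_space set"
  assumes "open A" "A \<noteq> {}" "bounded A"
  shows "measure lebesgue A > 0"
  using assms open_not_negligible[of A] lmeasurable_open[of A]
  by (metis negligible_iff_measure zero_less_measure_iff)

lemma measure_split_hyperplane:
  fixes A :: "'a::euclidean_space set"
  assumes A: "A \<in> lmeasurable" and i: "i \<in> Basis"
  shows "measure lebesgue A = measure lebesgue (A \<inter> {x. x \<bullet> i < c}) + measure lebesgue (A \<inter> {x. x \<bullet> i > c})"
proof -
  have N: "negligible {x::'a. x \<bullet> i = c}"
    using negligible_standard_hyperplane[OF i] by (simp add: inner_commute)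
  have s: "{x::'a. x \<bullet> i < c} \<in> sets lebesgue" "{x::'a. x \<bullet> i > c} \<in> sets lebesgue"
    by (simp_all add: open_halfspace_component_lt open_halfspace_component_gt)
  have m: "A \<inter> {x. x \<bullet> i < c} \<in> lmeasurable" "A \<inter> {x. x \<bullet> i > c} \<in> lmeasurable"
    using A s by (auto intro!: fmeasurable_Int_fmeasurable)
  have e: "(A \<inter> {x. x \<bullet> i < c}) \<inter> (A \<inter> {x. x \<bullet> i > c}) = {}" by auto
  have "measure lebesgue A = measure lebesgue (A \<inter> {x. x \<bullet> i < c} \<union> A \<inter> {x. x \<bullet> i > c})"
    by (rule measure_negligible_symdiff[symmetric])
       (use A m in \<open>auto intro: negligible_subset[OF N]\<close>)
  also have "\<dots> = measure lebesgue (A \<inter> {x. x \<bullet> i < c}) + measure lebesgue (A \<inter> {x. x \<bullet> i > c})"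
    using m by (subst measure_Un3) (simp_all add: e)
  finally show ?thesis .
qed

text \<open>The part of a bounded set below a hyperplane has a volume that is Lipschitz in the position of
  the hyperplane, because the part between two parallel hyperplanes lies in a box whose thickness is their
  distance.  Hence every intermediate volume is attained.\<close>

lemma halfspace_measure_ivt:
  fixes A :: "'a::euclidean_space set"
  assumes A: "A \<in> lmeasurable" "bounded A" and i: "i \<in> Basis" and t: "0 \<le> t" "t \<le> measure lebesgue A"
  shows "\<exists>d. measure lebesgue (A \<inter> {x. x \<bullet> i < d}) = t"
proof -
  obtain M where M: "M > 0" "\<And>x. x \<in> A \<Longrightarrow> norm x < M"
    using A(2) by (metis bounded_pos_less)
  have Mi: "\<bar>x \<bullet> j\<bar> < M" if "x \<in> A" "j \<in> Basis" for x j
    using Basis_le_norm[OF that(2), of x] M(2)[OF that(1)] by linarith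
  let ?m = "\<lambda>d. measure lebesgue (A \<inter> {x. x \<bullet> i < d})"
  have s: "{x::'a. x \<bullet> i < d} \<in> sets lebesgue" for d by (simp add: open_halfspace_component_lt)
  have m: "A \<inter> {x. x \<bullet> i < d} \<in> lmeasurable" for d
    using A s by (auto intro!: fmeasurable_Int_fmeasurable)
  have lip: "?m e - ?m d \<le> (2 * M) ^ (DIM('a) - 1) * (e - d)" if "d \<le> e" for d e
  proof -
    let ?C = "cbox ((- M) *\<^sub>R One + (d + M) *\<^sub>R i) (M *\<^sub>R One + (e - M) *\<^sub>R i)"
    have sub: "A \<inter> {x. x \<bullet> i < e} - (A \<inter> {x. x \<bullet> i < d}) \<subseteq> ?C"
    proof
      fix x assume x: "x \<in> A \<inter> {x. x \<bullet> i < e} - (A \<inter> {x. x \<bullet> i < d})"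
      then have x': "x \<in> A" "x \<bullet> i \<le> e" "d \<le> x \<bullet> i" by auto
      show "x \<in> ?C"
        unfolding mem_box
      proof
        fix j :: 'a assume j: "j \<in> Basis"
        show "((- M) *\<^sub>R One + (d + M) *\<^sub>R i) \<bullet> j \<le> x \<bullet> j \<and> x \<bullet> j \<le> (M *\<^sub>R One + (e - M) *\<^sub>R i) \<bullet> j"
          using i j x' Mi[OF x'(1) j] by (cases "i = j") (simp_all add: inner_simps inner_Basis abs_less_iff less_imp_le)
      qed
    qed
    have "?m e - ?m d = measure lebesgue (A \<inter> {x. x \<bullet> i < e} - (A \<inter> {x. x \<bullet> i < d}))"
      using that m by (subst measurable_measure_Diff) (auto simp: fmeasurableD)
    also have "\<dots> \<le> measure lebesgue ?C"
      by (rule measure_mono_fmeasurable[OF sub]) (use m in \<open>auto\<close>)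
    also have "\<dots> = (\<Prod>j\<in>Basis. if j = i then e - d else 2 * M)"
    proof -
      have "\<forall>j\<in>Basis. ((- M) *\<^sub>R One + (d + M) *\<^sub>R i) \<bullet> j \<le> (M *\<^sub>R One + (e - M) *\<^sub>R i) \<bullet> j"
        using that M(1) i by (auto simp: inner_simps inner_Basis)
      then have "measure lebesgue ?C = (\<Prod>j\<in>Basis. (M *\<^sub>R One + (e - M) *\<^sub>R i) \<bullet> j - ((- M) *\<^sub>R One + (d + M) *\<^sub>R i) \<bullet> j)"
        by (auto simp: content_cbox inner_diff_left intro!: prod.cong)
      also have "\<dots> = (\<Prod>j\<in>Basis. if j = i then e - d else 2 * M)"
        using i by (intro prod.cong) (auto simp: inner_simps inner_Basis)
      finally show ?thesis .
    qed
    also have "\<dots> = (2 * M) ^ (DIM('a) - 1) * (e - d)"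
    proof -
      have "(\<Prod>j\<in>Basis. if j = i then e - d else 2 * M) = (e - d) * (\<Prod>j\<in>Basis - {i}. if j = i then e - d else 2 * M)"
        using i by (subst prod.remove[of _ i]) auto
      also have "(\<Prod>j\<in>Basis - {i}. if j = i then e - d else 2 * M) = (\<Prod>j\<in>Basis - {i}. 2 * M)"
        by (rule prod.cong) auto
      finally show ?thesis using i by (simp add: card_Diff_singleton)
    qed
    finally show ?thesis .
  qed
  have mono: "?m d \<le> ?m e" if "d \<le> e" for d e
    by (rule measure_mono_fmeasurable) (use m that in auto)
  define K where "K = (2 * M) ^ (DIM('a) - 1)"
  have K: "K > 0" using M by (simp add: K_def)
  have "\<bar>?m d - ?m e\<bar> \<le> K * \<bar>d - e\<bar>" for d e
    using lip[of d e] lip[of e d] mono[of d e] mono[of e d] unfolding K_def by (cases "d \<le> e") auto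
  then have "continuous_on {-M..M} ?m"
    using K by (intro lipschitz_on_continuous_on[of K] lipschitz_onI) (auto simp: dist_real_def)
  moreover have "?m (-M) = 0"
  proof -
    have "A \<inter> {x. x \<bullet> i < - M} = {}" using Mi i by force
    then show ?thesis by simp
  qed
  moreover have "?m M = measure lebesgue A"
  proof -
    have "A \<inter> {x. x \<bullet> i < M} = A" using Mi i by force
    then show ?thesis by simp
  qed
  ultimately show ?thesis using t IVT'[of ?m "-M" t M] M(1) by auto
qed
lemma box_family_separate:
  fixes S T :: "'a::euclidean_space set"
  assumes "box_family F" "S \<in> F" "T \<in> F" "S \<noteq> T"
  shows "\<exists>i\<in>Basis. \<exists>c. (S \<subseteq> {x. x \<bullet> i < c} \<and> T \<subseteq> {x. x \<bullet> i > c}) \<or> (T \<subseteq> {x. x \<bullet> i < c} \<and> S \<subseteq> {x. x \<bullet> i > c})"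
proof -
  obtain a b c d where S: "S = box a b" "S \<noteq> {}" and T: "T = box c d" "T \<noteq> {}"
    using assms unfolding box_family_def by metis
  have "box a b \<inter> box c d = {}"
    using assms S T by (auto simp: box_family_def pairwise_def disjnt_def)
  then obtain i where i: "i \<in> Basis" "b \<bullet> i \<le> c \<bullet> i \<or> d \<bullet> i \<le> a \<bullet> i"
    using S(2) T(2) unfolding disjoint_interval S(1) T(1) box_ne_empty by (meson not_less)
  have "\<exists>e. (S \<subseteq> {x. x \<bullet> i < e} \<and> T \<subseteq> {x. x \<bullet> i > e}) \<or> (T \<subseteq> {x. x \<bullet> i < e} \<and> S \<subseteq> {x. x \<bullet> i > e})"
    using i(2)
  proof
    assume "b \<bullet> i \<le> c \<bullet> i"
    then show ?thesis using i(1) by (intro exI[of _ "b \<bullet> i"] disjI1) (auto simp: S(1) T(1) mem_box dest!: bspec[OF _ i(1)])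
  next
    assume "d \<bullet> i \<le> a \<bullet> i"
    then show ?thesis using i(1) by (intro exI[of _ "d \<bullet> i"] disjI2) (auto simp: S(1) T(1) mem_box dest!: bspec[OF _ i(1)])
  qed
  then show ?thesis using i(1) by blast
qed

text \<open>The inequality of the means for the quotients \<open>x i / (x i + y i)\<close> and for the quotients
  \<open>y i / (x i + y i)\<close>; the two arithmetic means add up to one.\<close>

lemma root_prod_add_le:
  fixes x y :: "'i \<Rightarrow> real"
  assumes I: "finite I" "I \<noteq> {}" and pos: "\<And>i. i \<in> I \<Longrightarrow> x i > 0" "\<And>i. i \<in> I \<Longrightarrow> y i > 0"
  shows "(root (card I) (prod x I) + root (card I) (prod y I)) ^ card I \<le> (\<Prod>i\<in>I. x i + y i)"
proof -
  let ?n = "card I"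
  have n: "?n > 0" using I by (simp add: card_gt_0_iff)
  have s: "x i + y i > 0" if "i \<in> I" for i using pos[OF that] by linarith
  define P where "P = (\<Prod>i\<in>I. x i + y i)"
  have P: "P > 0" unfolding P_def using s by (rule prod_pos)
  have le: "root ?n (prod z I) \<le> root ?n P * (\<Sum>i\<in>I. z i / (x i + y i) / ?n)"
    if "\<And>i. i \<in> I \<Longrightarrow> z i > 0" for z
  proof -
    have "prod z I = P * (\<Prod>i\<in>I. z i / (x i + y i))"
      using s P by (auto simp: P_def prod_dividef)
    then have "root ?n (prod z I) = root ?n P * root ?n (\<Prod>i\<in>I. z i / (x i + y i))"
      by (simp add: real_root_mult)
    also have "root ?n (\<Prod>i\<in>I. z i / (x i + y i)) \<le> (\<Sum>i\<in>I. z i / (x i + y i) / ?n)"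
      using arith_geom_mean[OF I, of "\<lambda>i. z i / (x i + y i)"] that s n
      by (subst root_powr_inverse[OF n]) (auto intro!: prod_nonneg divide_nonneg_nonneg simp: less_imp_le)
    finally show ?thesis using P n by (simp add: mult_left_mono)
  qed
  have "root ?n (prod x I) + root ?n (prod y I)
      \<le> root ?n P * ((\<Sum>i\<in>I. x i / (x i + y i) / ?n) + (\<Sum>i\<in>I. y i / (x i + y i) / ?n))"
    using le[of x] le[of y] pos by (simp add: distrib_left)
  also have "(\<Sum>i\<in>I. x i / (x i + y i) / ?n) + (\<Sum>i\<in>I. y i / (x i + y i) / ?n) = (\<Sum>i\<in>I. 1 / ?n)"
    unfolding sum.distrib[symmetric]
  proof (rule sum.cong)
    fix i assume "i \<in> I"
    then have "x i + y i \<noteq> 0" using s by force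
    then show "x i / (x i + y i) / ?n + y i / (x i + y i) / ?n = 1 / ?n" by (simp add: add_divide_distrib[symmetric])
  qed simp
  finally have "root ?n (prod x I) + root ?n (prod y I) \<le> root ?n P" using n by simp
  moreover have "0 \<le> root ?n (prod x I) + root ?n (prod y I)"
    using pos by (intro add_nonneg_nonneg real_root_ge_zero prod_nonneg) (auto intro: less_imp_le)
  ultimately have "(root ?n (prod x I) + root ?n (prod y I)) ^ ?n \<le> root ?n P ^ ?n" by (rule power_mono)
  then show ?thesis using n P by (simp add: P_def)
qed

lemma brunn_minkowski_boxes:
  fixes a b c d :: "'a::euclidean_space"
  assumes "box a b \<noteq> {}" "box c d \<noteq> {}"
  shows "(root DIM('a) (measure lebesgue (box a b)) + root DIM('a) (measure lebesgue (box c d))) ^ DIM('a)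
         \<le> measure lebesgue (box a b + box c d)"
proof -
  have ab: "a \<bullet> i < b \<bullet> i" and cd: "c \<bullet> i < d \<bullet> i" if "i \<in> Basis" for i
    using assms that by (auto simp: box_ne_empty)
  have "box (a + c) (b + d) \<subseteq> box a b + box c d"
  proof
    fix z assume z: "z \<in> box (a + c) (b + d)"
    define t where "t i = (z \<bullet> i - a \<bullet> i - c \<bullet> i) / (b \<bullet> i - a \<bullet> i + (d \<bullet> i - c \<bullet> i))" for i
    define u where "u = (\<Sum>i\<in>Basis. (a \<bullet> i + t i * (b \<bullet> i - a \<bullet> i)) *\<^sub>R i)"
    have ui: "u \<bullet> i = a \<bullet> i + t i * (b \<bullet> i - a \<bullet> i)" if "i \<in> Basis" for i
      using that by (simp add: u_def)
    have t: "0 < t i" "t i < 1" "z \<bullet> i - a \<bullet> i - c \<bullet> i = t i * (b \<bullet> i - a \<bullet> i) + t i * (d \<bullet> i - c \<bullet> i)" if "i \<in> Basis" for i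
    proof -
      have q: "b \<bullet> i - a \<bullet> i + (d \<bullet> i - c \<bullet> i) > 0" using ab[OF that] cd[OF that] by linarith
      have z': "a \<bullet> i + c \<bullet> i < z \<bullet> i" "z \<bullet> i < b \<bullet> i + d \<bullet> i"
        using z that by (auto simp: mem_box inner_simps)
      show "0 < t i" "t i < 1" using q z' by (auto simp: t_def)
      have "z \<bullet> i - a \<bullet> i - c \<bullet> i = t i * (b \<bullet> i - a \<bullet> i + (d \<bullet> i - c \<bullet> i))"
        using q by (simp add: t_def)
      then show "z \<bullet> i - a \<bullet> i - c \<bullet> i = t i * (b \<bullet> i - a \<bullet> i) + t i * (d \<bullet> i - c \<bullet> i)"
        by (simp add: distrib_left)
    qed
    have p: "0 < t i * (b \<bullet> i - a \<bullet> i)" "t i * (b \<bullet> i - a \<bullet> i) < b \<bullet> i - a \<bullet> i"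
        "0 < t i * (d \<bullet> i - c \<bullet> i)" "t i * (d \<bullet> i - c \<bullet> i) < d \<bullet> i - c \<bullet> i" if "i \<in> Basis" for i
      using t[OF that] ab[OF that] cd[OF that] by simp_all
    have "u \<in> box a b" unfolding mem_box
    proof
      fix i :: 'a assume i: "i \<in> Basis"
      show "a \<bullet> i < u \<bullet> i \<and> u \<bullet> i < b \<bullet> i" using p[OF i] by (simp add: ui i)
    qed
    moreover have "z - u \<in> box c d" unfolding mem_box
    proof
      fix i :: 'a assume i: "i \<in> Basis"
      show "c \<bullet> i < (z - u) \<bullet> i \<and> (z - u) \<bullet> i < d \<bullet> i"
        using p[OF i] t(3)[OF i] by (simp add: ui i inner_simps)
    qed
    ultimately show "z \<in> box a b + box c d"
      using set_plus_intro[of u "box a b" "z - u" "box c d"] by simp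
  qed
  then have "measure lebesgue (box (a + c) (b + d)) \<le> measure lebesgue (box a b + box c d)"
    by (intro measure_mono_fmeasurable lmeasurable_open open_set_plus bounded_set_plus) auto
  moreover have "measure lebesgue (box (a + c) (b + d)) = (\<Prod>i\<in>Basis. (b - a) \<bullet> i + (d - c) \<bullet> i)"
  proof -
    have "\<forall>i\<in>Basis. (a + c) \<bullet> i \<le> (b + d) \<bullet> i"
      unfolding inner_add_left by (intro ballI add_mono less_imp_le ab cd)
    then show ?thesis by (auto simp: inner_simps intro!: prod.cong)
  qed
  moreover have "measure lebesgue (box a b) = (\<Prod>i\<in>Basis. (b - a) \<bullet> i)" "measure lebesgue (box c d) = (\<Prod>i\<in>Basis. (d - c) \<bullet> i)"
    using ab cd by (simp_all add: less_imp_le)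
  moreover have "(root (card (Basis::'a set)) (\<Prod>i\<in>Basis. (b - a) \<bullet> i) + root (card (Basis::'a set)) (\<Prod>i\<in>Basis. (d - c) \<bullet> i)) ^ card (Basis::'a set)
      \<le> (\<Prod>i\<in>Basis. (b - a) \<bullet> i + (d - c) \<bullet> i)"
    by (rule root_prod_add_le) (use ab cd in \<open>auto simp: inner_simps\<close>)
  ultimately show ?thesis by simp
qed
lemma root_split_sum:
  assumes n: "n > 0" and t: "0 \<le> t" "t \<le> 1" and ab: "0 \<le> a" "0 \<le> b"
  shows "(root n (t * a) + root n (t * b)) ^ n + (root n ((1 - t) * a) + root n ((1 - t) * b)) ^ n
       = (root n a + root n b) ^ n"
proof -
  have "(root n (s * a) + root n (s * b)) ^ n = s * (root n a + root n b) ^ n" if "0 \<le> s" for s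
    using that n by (simp add: real_root_mult distrib_left[symmetric] power_mult_distrib)
  from this[of t] this[of "1 - t"] t show ?thesis by (simp add: algebra_simps)
qed

text \<open>The induction step of Hadwiger and Ohmann.  A hyperplane that separates two boxes of \<open>F\<close> cuts \<open>\<Union>F\<close> in
  some ratio; a parallel hyperplane is placed so that it cuts \<open>\<Union>G\<close> in the same ratio.  The sums of the two
  lower and of the two upper parts lie on different sides of a third hyperplane, so their volumes
  add, and since the ratios agree the two lower bounds from the induction hypothesis add
  up to the desired one (\<open>root_split_sum\<close>).\<close>

lemma brunn_minkowski_box_families_step:
  fixes F G :: "'a::euclidean_space set set"
  assumes F: "box_family F" and G: "box_family G" and "F \<noteq> {}" "G \<noteq> {}" and card: "card F \<ge> 2"
    and IH: "\<And>F' G' :: 'a set set. box_family F' \<Longrightarrow> box_family G' \<Longrightarrow> F' \<noteq> {} \<Longrightarrow> G' \<noteq> {} \<Longrightarrow>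
        card F' + card G' < card F + card G \<Longrightarrow>
        (root DIM('a) (measure lebesgue (\<Union>F')) + root DIM('a) (measure lebesgue (\<Union>G'))) ^ DIM('a)
          \<le> measure lebesgue (\<Union>F' + \<Union>G')"
  shows "(root DIM('a) (measure lebesgue (\<Union>F)) + root DIM('a) (measure lebesgue (\<Union>G))) ^ DIM('a)
          \<le> measure lebesgue (\<Union>F + \<Union>G)"
proof -
  have fin: "finite F" using F by (simp add: box_family_def)
  obtain S T where ST: "S \<in> F" "T \<in> F" "S \<noteq> T"
    using card fin by (metis card_2_iff' card_le_Suc0_iff_eq not_less_eq_eq numeral_2_eq_2)
  have "\<exists>S\<in>F. \<exists>T\<in>F. \<exists>i\<in>Basis. \<exists>c. S \<subseteq> {x. x \<bullet> i < c} \<and> T \<subseteq> {x. x \<bullet> i > c}"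
    using box_family_separate[OF F ST] ST(1,2) by blast
  then obtain S T i c where S: "S \<in> F" "S \<subseteq> {x. x \<bullet> i < c}" and T: "T \<in> F" "T \<subseteq> {x. x \<bullet> i > c}" and i: "i \<in> Basis"
    by blast
  let ?L = "\<lambda>c. {x::'a. x \<bullet> i < c}" and ?U = "\<lambda>c. {x::'a. x \<bullet> i > c}"
  let ?A = "\<Union>F" and ?B = "\<Union>G"
  let ?m = "measure lebesgue :: 'a set \<Rightarrow> real"
  have ne: "S \<noteq> {}" "T \<noteq> {}" using F S T by (auto simp: box_family_def)
  have boxL: "\<exists>a' b'. box a b \<inter> ?L e = box a' b'" for a b e using box_Int_lower_halfspace[OF i] by metis
  have boxU: "\<exists>a' b'. box a b \<inter> ?U e = box a' b'" for a b e using box_Int_upper_halfspace[OF i] by metis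
  define FL where "FL = (\<lambda>S. S \<inter> ?L c) ` F - {{}}"
  define FU where "FU = (\<lambda>S. S \<inter> ?U c) ` F - {{}}"
  have TL: "T \<inter> ?L c = {}" using T(2) by force
  have SU: "S \<inter> ?U c = {}" using S(2) by force
  note FL = box_family_Int[OF F boxL[where e=c], folded FL_def]
  note FU = box_family_Int[OF F boxU[where e=c], folded FU_def]
  have cFL: "card FL < card F" by (rule FL(4)[OF T(1) TL])
  have cFU: "card FU < card F" by (rule FU(4)[OF S(1) SU])
  have lmA: "?A \<in> lmeasurable" and lmB: "?B \<in> lmeasurable"
    using F G by (auto intro!: lmeasurable_open box_family_open box_family_bounded)
  have neL: "FL \<noteq> {}" and neU: "FU \<noteq> {}"
    using S T ne unfolding FL_def FU_def by blast+
  have neA: "\<Union>H \<noteq> {}" if "box_family H" "H \<noteq> {}" for H :: "'a set set"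
    using that unfolding box_family_def by blast
  have pos: "?m (\<Union>H) > 0" if "box_family H" "H \<noteq> {}" for H
    using that neA by (intro measure_open_pos box_family_open box_family_bounded)
  define \<theta> where "\<theta> = ?m (\<Union>FL) / ?m ?A"
  have Apos: "?m ?A > 0" and Bpos: "?m ?B > 0" using pos F G assms(3,4) by auto
  have splitA: "?m ?A = ?m (\<Union>FL) + ?m (\<Union>FU)"
    using measure_split_hyperplane[OF lmA i, of c] by (simp add: FL(2) FU(2))
  have \<theta>: "0 < \<theta>" "\<theta> < 1"
    using Apos splitA pos[OF FL(1) neL] pos[OF FU(1) neU] by (auto simp: \<theta>_def)
  have mFL: "?m (\<Union>FL) = \<theta> * ?m ?A" using Apos by (simp add: \<theta>_def)
  have mFU: "?m (\<Union>FU) = (1 - \<theta>) * ?m ?A" using splitA mFL by (simp add: algebra_simps)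
  obtain d where d: "?m (?B \<inter> ?L d) = \<theta> * ?m ?B"
    using halfspace_measure_ivt[OF lmB box_family_bounded[OF G] i, of "\<theta> * ?m ?B"] \<theta> Bpos by auto
  define GL where "GL = (\<lambda>S. S \<inter> ?L d) ` G - {{}}"
  define GU where "GU = (\<lambda>S. S \<inter> ?U d) ` G - {{}}"
  note GL = box_family_Int[OF G boxL[where e=d], folded GL_def]
  note GU = box_family_Int[OF G boxU[where e=d], folded GU_def]
  have mGL: "?m (\<Union>GL) = \<theta> * ?m ?B" using d by (simp add: GL(2))
  have mGU: "?m (\<Union>GU) = (1 - \<theta>) * ?m ?B"
    using measure_split_hyperplane[OF lmB i, of d] mGL by (simp add: GL(2) GU(2) algebra_simps)
  have neGL: "GL \<noteq> {}"
  proof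
    assume "GL = {}"
    then have "\<theta> * ?m ?B = 0" using mGL by simp
    then show False using \<theta> Bpos by simp
  qed
  have neGU: "GU \<noteq> {}"
  proof
    assume "GU = {}"
    then have "(1 - \<theta>) * ?m ?B = 0" using mGU by simp
    then show False using \<theta> Bpos by simp
  qed
  let ?r = "root DIM('a)"
  have b: "bounded (\<Union>FL + \<Union>GL)" "bounded (\<Union>FU + \<Union>GU)" "bounded (?A + ?B)"
    by (intro bounded_set_plus box_family_bounded FL(1) FU(1) GL(1) GU(1) F G)+
  have o: "open (\<Union>FL + \<Union>GL)" "open (\<Union>FU + \<Union>GU)" "open (?A + ?B)"
    by (intro open_set_plus box_family_open FL(1) FU(1) F)+
  have disj: "(\<Union>FL + \<Union>GL) \<inter> (\<Union>FU + \<Union>GU) = {}"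
  proof -
    have "z \<bullet> i < c + d" if "z \<in> \<Union>FL + \<Union>GL" for z
      using that unfolding FL(2) GL(2) by (auto simp: set_plus_def inner_add_left)
    moreover have "z \<bullet> i > c + d" if "z \<in> \<Union>FU + \<Union>GU" for z
      using that unfolding FU(2) GU(2) by (auto simp: set_plus_def inner_add_left)
    ultimately show ?thesis by (meson disjoint_iff less_asym)
  qed
  have "(?r (?m ?A) + ?r (?m ?B)) ^ DIM('a)
      = (?r (?m (\<Union>FL)) + ?r (?m (\<Union>GL))) ^ DIM('a) + (?r (?m (\<Union>FU)) + ?r (?m (\<Union>GU))) ^ DIM('a)"
    unfolding mFL mFU mGL mGU
    by (rule root_split_sum[symmetric]) (use \<theta> in auto)
  also have "\<dots> \<le> ?m (\<Union>FL + \<Union>GL) + ?m (\<Union>FU + \<Union>GU)"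
    using cFL cFU GL(3) GU(3)
    by (intro add_mono IH FL(1) FU(1) GL(1) GU(1) neL neU neGL neGU) linarith+
  also have "\<dots> = ?m ((\<Union>FL + \<Union>GL) \<union> (\<Union>FU + \<Union>GU))"
    using lmeasurable_open[OF b(1) o(1)] lmeasurable_open[OF b(2) o(2)]
    by (subst measure_Un3) (simp_all add: disj)
  also have "\<dots> \<le> ?m (?A + ?B)"
  proof (rule measure_mono_fmeasurable)
    show "(\<Union>FL + \<Union>GL) \<union> (\<Union>FU + \<Union>GU) \<subseteq> ?A + ?B"
      unfolding FL(2) FU(2) GL(2) GU(2) by (intro Un_least set_plus_mono2) auto
    show "(\<Union>FL + \<Union>GL) \<union> (\<Union>FU + \<Union>GU) \<in> sets lebesgue" using o by (intro sets.Un) auto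
    show "?A + ?B \<in> lmeasurable" by (rule lmeasurable_open[OF b(3) o(3)])
  qed
  finally show ?thesis .
qed

lemma brunn_minkowski_box_families:
  fixes F G :: "'a::euclidean_space set set"
  assumes "box_family F" "box_family G" "F \<noteq> {}" "G \<noteq> {}"
  shows "(root DIM('a) (measure lebesgue (\<Union>F)) + root DIM('a) (measure lebesgue (\<Union>G))) ^ DIM('a)
          \<le> measure lebesgue (\<Union>F + \<Union>G)"
  using assms
proof (induction "card F + card G" arbitrary: F G rule: less_induct)
  case less
  have fin: "finite F" "finite G" using less.prems by (auto simp: box_family_def)
  have c: "card F \<ge> 1" "card G \<ge> 1" using fin less.prems by (auto simp: Suc_le_eq card_gt_0_iff)
  consider "card F \<ge> 2" | "card G \<ge> 2" | "card F = 1" "card G = 1" using c by linarith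
  then show ?case
  proof cases
    case 1
    show ?thesis
      by (rule brunn_minkowski_box_families_step[OF less.prems 1]) (rule less.hyps)
  next
    case 2
    have "(root DIM('a) (measure lebesgue (\<Union>G)) + root DIM('a) (measure lebesgue (\<Union>F))) ^ DIM('a)
          \<le> measure lebesgue (\<Union>G + \<Union>F)"
      by (rule brunn_minkowski_box_families_step[OF less.prems(2,1,4,3) 2]) (rule less.hyps, simp_all)
    then show ?thesis by (simp add: add.commute)
  next
    case 3
    then obtain S T where "F = {S}" "G = {T}" by (metis card_1_singletonE)
    moreover from this obtain a b c d where "S = box a b" "T = box c d" "S \<noteq> {}" "T \<noteq> {}"
      using less.prems unfolding box_family_def by auto
    ultimately show ?thesis using brunn_minkowski_boxes by simp
  qed
qed

text \<open>A countable family of nonoverlapping cubes covers \<open>A\<close>; the gauge \<open>g\<close> below forces each of these cubes into \<open>A\<close>.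
  Their interiors are disjoint open boxes that fill \<open>A\<close> up to a null set.\<close>

lemma box_family_exhaustion:
  fixes A :: "'a::euclidean_space set"
  assumes A: "open A" "bounded A" "A \<noteq> {}"
  obtains F where "\<And>n. box_family (F n)" "\<And>n. F n \<noteq> {}" "\<And>n. \<Union>(F n) \<subseteq> A"
    "(\<lambda>n. measure lebesgue (\<Union>(F n))) \<longlonglongrightarrow> measure lebesgue A"
proof -
  obtain M where M: "A \<subseteq> cbox (- M) M"
    using bounded_subset_cbox_symmetric[OF A(2)] by blast
  obtain a where a: "A \<subseteq> cbox (- a) a" "box (- a) a \<noteq> {}"
  proof
    show "A \<subseteq> cbox (- M) M" by (rule M)
    have "A \<subseteq> interior (cbox (- M) M)" using A(1) M by (rule interior_maximal[rotated])
    then show "box (- M) M \<noteq> {}" using A(3) by (auto simp: interior_cbox)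
  qed
  define g where "g x = (if x \<in> A then A else UNIV)" for x
  have "gauge g" using A(1) by (auto simp: gauge_def g_def)
  from covering_lemma[OF a this] obtain \<D> where \<D>: "countable \<D>"
    "\<And>K. K \<in> \<D> \<Longrightarrow> interior K \<noteq> {} \<and> (\<exists>c d. K = cbox c d)"
    "pairwise (\<lambda>A B. interior A \<inter> interior B = {}) \<D>"
    "\<And>K. K \<in> \<D> \<Longrightarrow> \<exists>x \<in> A \<inter> K. K \<subseteq> g x"
    "A \<subseteq> \<Union>\<D>" by metis
  have sub: "K \<subseteq> A" if "K \<in> \<D>" for K using \<D>(4)[OF that] by (auto simp: g_def)
  have ne: "\<D> \<noteq> {}" using A(3) \<D>(5) by auto
  define k where "k = from_nat_into \<D>"
  have k: "k n \<in> \<D>" for n using ne by (simp add: k_def from_nat_into)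
  have rk: "range k = \<D>" unfolding k_def by (rule range_from_nat_into[OF ne \<D>(1)])
  define F where "F n = (\<lambda>j. interior (k j)) ` {..n}" for n
  have bf: "box_family (F n)" for n
    unfolding box_family_def
  proof (intro conjI ballI)
    show "finite (F n)" by (simp add: F_def)
    show "pairwise disjnt (F n)"
      unfolding pairwise_def disjnt_def F_def
    proof (intro ballI impI)
      fix S T assume "S \<in> (\<lambda>j. interior (k j)) ` {..n}" "T \<in> (\<lambda>j. interior (k j)) ` {..n}" "S \<noteq> T"
      then obtain j l where "S = interior (k j)" "T = interior (k l)" by blast
      with \<open>S \<noteq> T\<close> have "k j \<noteq> k l" "S = interior (k j)" "T = interior (k l)" by auto
      then show "S \<inter> T = {}" using \<D>(3) k unfolding pairwise_def by simp
    qed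
    fix S assume "S \<in> F n"
    then obtain j where S: "S = interior (k j)" by (auto simp: F_def)
    show "S \<noteq> {}" using \<D>(2)[OF k[of j]] by (simp add: S)
    show "\<exists>a b. S = box a b" using \<D>(2)[OF k[of j]] unfolding S by (metis interior_cbox)
  qed
  have subF: "\<Union>(F n) \<subseteq> A" for n
    using sub[OF k] interior_subset unfolding F_def by blast
  have "(\<lambda>n. measure lebesgue (\<Union>(F n))) \<longlonglongrightarrow> measure lebesgue (\<Union>n. \<Union>(F n))"
  proof (rule Lim_measure_incseq)
    show "range (\<lambda>n. \<Union>(F n)) \<subseteq> sets lebesgue"
      using box_family_open[OF bf] by auto
    show "incseq (\<lambda>n. \<Union>(F n))"
      unfolding incseq_def F_def by (intro allI impI Union_mono image_mono) auto
    have "(\<Union>n. \<Union>(F n)) \<in> lmeasurable"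
      using subF box_family_open[OF bf]
      by (intro lmeasurable_open bounded_subset[OF A(2)]) auto
    then show "emeasure lebesgue (\<Union>n. \<Union>(F n)) \<noteq> \<infinity>"
      unfolding infinity_ennreal_def by (rule fmeasurableD2)
  qed
  also have "measure lebesgue (\<Union>n. \<Union>(F n)) = measure lebesgue A"
  proof (rule measure_negligible_symdiff)
    show "A \<in> lmeasurable" using A(2,1) by (rule lmeasurable_open)
    have "negligible (\<Union>K\<in>\<D>. K - interior K)"
    proof (rule negligible_countable_Union)
      show "countable ((\<lambda>K. K - interior K) ` \<D>)" using \<D>(1) by simp
      fix S assume "S \<in> (\<lambda>K. K - interior K) ` \<D>"
      then obtain c d where "S = cbox c d - box c d" using \<D>(2) by (metis (no_types, lifting) imageE interior_cbox)
      then show "negligible S" using negligible_frontier_interval[of c d] by simp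
    qed
    moreover have "(\<Union>n. \<Union>(F n)) - A \<union> (A - (\<Union>n. \<Union>(F n))) \<subseteq> (\<Union>K\<in>\<D>. K - interior K)"
    proof -
      have eq: "(\<Union>n. \<Union>(F n)) = (\<Union>K\<in>\<D>. interior K)" unfolding rk[symmetric] F_def by auto
      have "x \<in> (\<Union>K\<in>\<D>. K - interior K)" if x: "x \<in> A" "x \<notin> (\<Union>K\<in>\<D>. interior K)" for x
      proof -
        obtain K where "K \<in> \<D>" "x \<in> K" using \<D>(5) x(1) by auto
        then show ?thesis using x(2) by auto
      qed
      moreover have "(\<Union>n. \<Union>(F n)) \<subseteq> A" using subF by (rule UN_least)
      ultimately show ?thesis unfolding eq by auto
    qed
    ultimately show "negligible (A - (\<Union>n. \<Union>(F n)) \<union> ((\<Union>n. \<Union>(F n)) - A))"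
      by (metis negligible_subset Un_commute)
  qed
  finally show ?thesis using that[of F] bf subF by (auto simp: F_def)
qed

lemma brunn_minkowski_open:
  fixes A B :: "'a::euclidean_space set"
  assumes "open A" "bounded A" "A \<noteq> {}" "open B" "bounded B" "B \<noteq> {}"
  shows "(root DIM('a) (measure lebesgue A) + root DIM('a) (measure lebesgue B)) ^ DIM('a)
          \<le> measure lebesgue (A + B)"
proof -
  obtain F where F: "\<And>n. box_family (F n)" "\<And>n. F n \<noteq> {}" "\<And>n. \<Union>(F n) \<subseteq> A"
    "(\<lambda>n. measure lebesgue (\<Union>(F n))) \<longlonglongrightarrow> measure lebesgue A"
    using box_family_exhaustion[OF assms(1-3)] by blast
  obtain G where G: "\<And>n. box_family (G n)" "\<And>n. G n \<noteq> {}" "\<And>n. \<Union>(G n) \<subseteq> B"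
    "(\<lambda>n. measure lebesgue (\<Union>(G n))) \<longlonglongrightarrow> measure lebesgue B"
    using box_family_exhaustion[OF assms(4-6)] by blast
  have AB: "A + B \<in> lmeasurable"
    using assms by (intro lmeasurable_open open_set_plus bounded_set_plus)
  have "(\<lambda>n. (root DIM('a) (measure lebesgue (\<Union>(F n))) + root DIM('a) (measure lebesgue (\<Union>(G n)))) ^ DIM('a))
      \<longlonglongrightarrow> (root DIM('a) (measure lebesgue A) + root DIM('a) (measure lebesgue B)) ^ DIM('a)"
    by (intro tendsto_intros F(4) G(4))
  moreover have "(root DIM('a) (measure lebesgue (\<Union>(F n))) + root DIM('a) (measure lebesgue (\<Union>(G n)))) ^ DIM('a)
      \<le> measure lebesgue (A + B)" for n
  proof -
    have "measure lebesgue (\<Union>(F n) + \<Union>(G n)) \<le> measure lebesgue (A + B)"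
      using F(1,3)[of n] G(3)[of n]
      by (intro measure_mono_fmeasurable set_plus_mono2 AB lmeasurable_open[THEN fmeasurableD]
          bounded_set_plus open_set_plus box_family_open box_family_bounded F(1) G(1))
    then show ?thesis using brunn_minkowski_box_families[OF F(1) G(1) F(2) G(2), of n n] by linarith
  qed
  ultimately show ?thesis by (meson LIMSEQ_le_const2)
qed

text \<open>With a ball as the second summand, Brunn-Minkowski is the isoperimetric inequality, expressed by
  the growth of neighbourhoods.\<close>

lemma measure_neighbourhood_ge:
  fixes A :: "'a::euclidean_space set"
  assumes A: "open A" "bounded A" "measure lebesgue A = unit_ball_vol (real DIM('a)) * r ^ DIM('a)"
    and r: "r > 0" and e: "e > 0"
  shows "unit_ball_vol (real DIM('a)) * (r + e) ^ DIM('a) \<le> measure lebesgue (A + ball 0 e)"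
proof -
  let ?N = "DIM('a)" and ?w = "unit_ball_vol (real DIM('a))"
  have w: "?w > 0" by simp
  have "measure lebesgue A > 0" using w r by (simp add: A(3))
  then have "A \<noteq> {}" by auto
  moreover have "measure lebesgue (ball 0 e :: 'a set) = ?w * e ^ ?N"
    using e by (simp add: content_ball)
  ultimately have "(root ?N (?w * r ^ ?N) + root ?N (?w * e ^ ?N)) ^ ?N \<le> measure lebesgue (A + ball 0 e)"
    using brunn_minkowski_open[of A "ball 0 e"] A e by simp
  moreover have "root ?N (?w * s ^ ?N) = root ?N ?w * s" if "s > 0" for s
    using that by (simp add: real_root_mult real_root_power_cancel)
  ultimately have "(root ?N ?w * (r + e)) ^ ?N \<le> measure lebesgue (A + ball 0 e)"
    using r e by (simp add: distrib_left)
  then show ?thesis using w by (simp add: power_mult_distrib)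
qed

section \<open>Radial integrals, layer cakes and equidistribution\<close>

lemma nn_integral_power_Icc:
  assumes "n > 0" "c \<ge> 0"
  shows "(\<integral>\<^sup>+r. ennreal (real n * r ^ (n - 1)) * indicator {0..c} r \<partial>lborel) = ennreal (c ^ n)"
proof -
  have "(\<integral>\<^sup>+r. ennreal (real n * r ^ (n - 1)) * indicator {0..c} r \<partial>lborel) = ennreal (c ^ n - 0 ^ n)"
    by (rule nn_integral_FTC_Icc) (use assms in \<open>auto intro!: derivative_eq_intros\<close>)
  then show ?thesis using assms by simp
qed

text \<open>Polar coordinates for radial functions: the image of Lebesgue measure under the norm is
  determined by the volumes of the balls around the origin.\<close>

lemma distr_norm_lborel:
  "distr lborel borel (norm :: 'a::euclidean_space \<Rightarrow> real)
     = density lborel (\<lambda>r. ennreal (real DIM('a) * unit_ball_vol (real DIM('a)) * r ^ (DIM('a) - 1)) * indicator {0..} r)"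
proof (rule measure_eqI_generator_eq[where E = "range atMost" and \<Omega> = UNIV and A = "\<lambda>i. {..real i}"])
  let ?w = "unit_ball_vol (real DIM('a))"
  fix X assume "X \<in> range (atMost :: real \<Rightarrow> _)"
  then obtain c where X: "X = {..c}" by auto
  have "emeasure (distr lborel borel (norm :: 'a \<Rightarrow> real)) X = emeasure lborel (cball (0::'a) c)"
    by (subst emeasure_distr) (auto simp: X cball_def intro!: arg_cong[of _ _ "emeasure lborel"])
  also have "\<dots> = ennreal (if c \<ge> 0 then ?w * c ^ DIM('a) else 0)"
    using emeasure_cball[of c "0::'a"] by (cases "c \<ge> 0") (auto simp: not_le)
  also have "\<dots> = (\<integral>\<^sup>+r. ennreal ?w * (ennreal (real DIM('a) * r ^ (DIM('a) - 1)) * indicator {0..c} r) \<partial>lborel)"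
    using nn_integral_power_Icc[of "DIM('a)" c]
    by (cases "c \<ge> 0") (simp_all add: nn_integral_cmult ennreal_mult)
  also have "\<dots> = (\<integral>\<^sup>+r. ennreal (real DIM('a) * ?w * r ^ (DIM('a) - 1)) * indicator {0..} r * indicator X r \<partial>lborel)"
    by (rule nn_integral_cong) (auto simp: X ennreal_mult[symmetric] mult_ac split: split_indicator)
  also have "\<dots> = emeasure (density lborel (\<lambda>r. ennreal (real DIM('a) * ?w * r ^ (DIM('a) - 1)) * indicator {0..} r)) X"
    by (subst emeasure_density) (auto simp: X)
  finally show "emeasure (distr lborel borel (norm :: 'a \<Rightarrow> real)) X
     = emeasure (density lborel (\<lambda>r. ennreal (real DIM('a) * ?w * r ^ (DIM('a) - 1)) * indicator {0..} r)) X" .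
next
  show "Int_stable (range atMost :: real set set)" by (auto simp: Int_stable_def)
  show "sets (distr lborel borel (norm :: 'a \<Rightarrow> real)) = sigma_sets UNIV (range atMost)"
    by (simp add: borel_eq_atMost)
  show "sets (density lborel (\<lambda>r. ennreal (real DIM('a) * unit_ball_vol (real DIM('a)) * r ^ (DIM('a) - 1)) * indicator {0..} r))
      = sigma_sets UNIV (range atMost)"
    by (simp add: borel_eq_atMost)
  show "(\<Union>i. {..real i}) = UNIV" using real_arch_simple by auto
  fix i
  have "emeasure (distr lborel borel (norm :: 'a \<Rightarrow> real)) {..real i} = emeasure lborel (cball (0::'a) i)"
    by (subst emeasure_distr) (auto simp: cball_def intro!: arg_cong[of _ _ "emeasure lborel"])
  then show "emeasure (distr lborel borel (norm :: 'a \<Rightarrow> real)) {..real i} \<noteq> \<infinity>" by (simp add: emeasure_cball)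
qed auto

lemma nn_integral_radial:
  assumes [measurable]: "g \<in> borel_measurable borel"
  shows "(\<integral>\<^sup>+x. g (norm (x::'a::euclidean_space)) \<partial>lborel)
     = (\<integral>\<^sup>+r. ennreal (real DIM('a) * unit_ball_vol (real DIM('a)) * r ^ (DIM('a) - 1)) * indicator {0..} r * g r \<partial>lborel)"
proof -
  have "(\<integral>\<^sup>+x. g (norm (x::'a)) \<partial>lborel) = (\<integral>\<^sup>+r. g r \<partial>distr lborel borel (norm :: 'a \<Rightarrow> real))"
    by (simp add: nn_integral_distr)
  then show ?thesis by (simp add: distr_norm_lborel nn_integral_density)
qed

lemma nn_integral_powr_interval:
  assumes "a > 0" "c \<ge> 0"
  shows "(\<integral>\<^sup>+r. ennreal (r powr (a - 1)) * indicator {0..c} r \<partial>lborel) = ennreal (c powr a / a)"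
proof -
  have "((\<lambda>r. if r \<in> {0..c} then r powr (a - 1) else 0) has_integral (c powr a / a)) UNIV"
    using has_integral_powr_from_0[of "a - 1" c] assms by (simp only: has_integral_restrict_UNIV) simp
  then have "(\<integral>\<^sup>+r. ennreal (if r \<in> {0..c} then r powr (a - 1) else 0) \<partial>lborel) = ennreal (c powr a / a)"
    by (intro nn_integral_has_integral_lborel) auto
  moreover have "(\<integral>\<^sup>+r. ennreal (r powr (a - 1)) * indicator {0..c} r \<partial>lborel)
      = (\<integral>\<^sup>+r. ennreal (if r \<in> {0..c} then r powr (a - 1) else 0) \<partial>lborel)"
    by (rule nn_integral_cong) (auto split: split_indicator)
  ultimately show ?thesis by simp
qed

lemma nn_integral_ball_powr:
  assumes "a > 0" "c \<ge> 0"
  shows "(\<integral>\<^sup>+x. ennreal (norm (x::'a::euclidean_space) powr (a - real DIM('a))) * indicator (ball 0 c) x \<partial>lborel)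
     = ennreal (real DIM('a) * unit_ball_vol (real DIM('a)) / a * c powr a)"
proof -
  let ?N = "real DIM('a)"
  let ?K = "?N * unit_ball_vol ?N"
  have K: "?K \<ge> 0" by simp
  have "(\<integral>\<^sup>+x. ennreal (norm (x::'a) powr (a - ?N)) * indicator (ball 0 c) x \<partial>lborel)
      = (\<integral>\<^sup>+x. ennreal (norm (x::'a) powr (a - ?N)) * indicator {..<c} (norm x) \<partial>lborel)"
    by (rule nn_integral_cong) (auto split: split_indicator)
  also have "\<dots> = (\<integral>\<^sup>+r. ennreal (?K * r ^ (DIM('a) - 1)) * indicator {0..} r * (ennreal (r powr (a - ?N)) * indicator {..<c} r) \<partial>lborel)"
    by (rule nn_integral_radial) measurable
  also have "\<dots> = (\<integral>\<^sup>+r. ennreal ?K * (ennreal (r powr (a - 1)) * indicator {0..c} r) \<partial>lborel)"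
  proof (rule nn_integral_cong_AE)
    have "AE r in lborel. r \<noteq> 0 \<and> r \<noteq> c" by (intro AE_conjI AE_lborel_singleton)
    then show "AE r in lborel. ennreal (?K * r ^ (DIM('a) - 1)) * indicator {0..} r * (ennreal (r powr (a - ?N)) * indicator {..<c} r)
        = ennreal ?K * (ennreal (r powr (a - 1)) * indicator {0..c} r)"
    proof eventually_elim
      fix r :: real assume r: "r \<noteq> 0 \<and> r \<noteq> c"
      show "ennreal (?K * r ^ (DIM('a) - 1)) * indicator {0..} r * (ennreal (r powr (a - ?N)) * indicator {..<c} r)
        = ennreal ?K * (ennreal (r powr (a - 1)) * indicator {0..c} r)"
      proof (cases "0 < r \<and> r < c")
        case True
        have "r ^ (DIM('a) - 1) * r powr (a - ?N) = r powr (a - 1)"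
          using True by (simp add: powr_realpow[symmetric] powr_add[symmetric] of_nat_diff)
        then show ?thesis using True K by (simp add: ennreal_mult[symmetric] mult.assoc)
      next
        case False
        then show ?thesis using r by (auto split: split_indicator)
      qed
    qed
  qed
  also have "\<dots> = ennreal ?K * ennreal (c powr a / a)"
    using nn_integral_powr_interval[OF assms] by (simp add: nn_integral_cmult)
  also have "\<dots> = ennreal (?K / a * c powr a)" using K assms by (simp add: ennreal_mult[symmetric])
  finally show ?thesis .
qed

text \<open>Among the sets of given volume, the centred ball maximizes the integral of a decreasing power of the norm:
  the parts of \<open>A\<close> outside the ball and of the ball outside \<open>A\<close> have equal volume, and the
  integrand is larger on the latter.\<close>

lemma nn_integral_powr_le_ball:
  fixes A :: "'a::euclidean_space set"
  assumes A: "A \<in> sets borel" "emeasure lborel A = ennreal (unit_ball_vol (real DIM('a)) * c ^ DIM('a))"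
    and c: "c \<ge> 0" and a: "0 < a" "a \<le> real DIM('a)"
  shows "(\<integral>\<^sup>+x. ennreal (norm x powr (a - real DIM('a))) * indicator A x \<partial>lborel)
     \<le> ennreal (real DIM('a) * unit_ball_vol (real DIM('a)) / a * c powr a)"
proof (cases "c = 0")
  case True
  then have "emeasure lborel A = 0" using A by simp
  then have "AE x in lborel. x \<notin> A" using A(1) by (intro AE_not_in) (auto simp: null_sets_def)
  then have "(\<integral>\<^sup>+x. ennreal (norm x powr (a - real DIM('a))) * indicator A x \<partial>lborel) = (\<integral>\<^sup>+(x::'a). 0 \<partial>lborel)"
    by (intro nn_integral_cong_AE) (auto elim: eventually_mono)
  then show ?thesis by simp
next
  case False
  then have c0: "c > 0" using c by simp
  let ?N = "real DIM('a)" and ?B = "ball (0::'a) c"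
  let ?f = "\<lambda>x::'a. ennreal (norm x powr (a - ?N))"
  let ?k = "ennreal (c powr (a - ?N))"
  note [measurable] = A(1)
  have [measurable]: "?B \<in> sets borel" by simp
  have B: "emeasure lborel ?B = emeasure lborel A" using A c by (simp add: emeasure_ball)
  have fin: "emeasure lborel (A \<inter> ?B) \<noteq> \<infinity>"
    using emeasure_mono[of "A \<inter> ?B" ?B lborel] A B by (auto simp: top_unique)
  have "emeasure lborel (A - ?B) + emeasure lborel (A \<inter> ?B) = emeasure lborel A"
    by (subst plus_emeasure) (auto intro!: arg_cong[of _ _ "emeasure lborel"])
  moreover have "emeasure lborel (?B - A) + emeasure lborel (A \<inter> ?B) = emeasure lborel ?B"
    by (subst plus_emeasure) (auto intro!: arg_cong[of _ _ "emeasure lborel"])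
  ultimately have D: "emeasure lborel (A - ?B) = emeasure lborel (?B - A)"
    using B fin by (metis ennreal_add_left_cancel add.commute infinity_ennreal_def)
  have "(\<integral>\<^sup>+x. ?f x * indicator A x \<partial>lborel) = (\<integral>\<^sup>+x. ?f x * indicator (A \<inter> ?B) x + ?f x * indicator (A - ?B) x \<partial>lborel)"
    by (rule nn_integral_cong) (auto split: split_indicator)
  also have "\<dots> = (\<integral>\<^sup>+x. ?f x * indicator (A \<inter> ?B) x \<partial>lborel) + (\<integral>\<^sup>+x. ?f x * indicator (A - ?B) x \<partial>lborel)"
    by (rule nn_integral_add) measurable
  also have "(\<integral>\<^sup>+x. ?f x * indicator (A - ?B) x \<partial>lborel) \<le> (\<integral>\<^sup>+x. ?k * indicator (A - ?B) x \<partial>lborel)"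
    by (rule nn_integral_mono) (use c0 a in \<open>auto intro!: ennreal_leI powr_mono2' split: split_indicator\<close>)
  also have "\<dots> = (\<integral>\<^sup>+x. ?k * indicator (?B - A) x \<partial>lborel)"
    using D by (simp add: nn_integral_cmult)
  also have "\<dots> \<le> (\<integral>\<^sup>+x. ?f x * indicator (?B - A) x \<partial>lborel)"
  proof (rule nn_integral_mono_AE)
    have "AE x in lborel. x \<noteq> (0::'a)" by (rule AE_lborel_singleton)
    then show "AE x in lborel. ?k * indicator (?B - A) x \<le> ?f x * indicator (?B - A) x"
      by eventually_elim (use a in \<open>auto intro!: ennreal_leI powr_mono2' split: split_indicator\<close>)
  qed
  also have "(\<integral>\<^sup>+x. ?f x * indicator (A \<inter> ?B) x \<partial>lborel) + (\<integral>\<^sup>+x. ?f x * indicator (?B - A) x \<partial>lborel)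
      = (\<integral>\<^sup>+x. ?f x * indicator (A \<inter> ?B) x + ?f x * indicator (?B - A) x \<partial>lborel)"
    by (rule nn_integral_add[symmetric]) measurable
  also have "\<dots> = (\<integral>\<^sup>+x. ?f x * indicator ?B x \<partial>lborel)"
    by (rule nn_integral_cong) (auto split: split_indicator)
  also have "\<dots> = ennreal (?N * unit_ball_vol ?N / a * c powr a)"
    by (rule nn_integral_ball_powr[OF a(1) c])
  finally show ?thesis by (simp add: add_left_mono)
qed

text \<open>Fubini on the region below the graph of \<open>F\<close>.  Extended values of \<open>F\<close> are allowed because
  rearrangements may be infinite at the origin; the cases \<open>\<psi> t = 1\<close> and \<open>\<psi> t = 2 * t\<close>
  produce \<open>F x\<close> and its square.\<close>

lemma layer_cake:
  fixes F :: "'a::euclidean_space \<Rightarrow> ennreal" and \<psi> :: "real \<Rightarrow> ennreal"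
  assumes [measurable]: "F \<in> borel_measurable borel" "\<rho> \<in> borel_measurable borel" "\<psi> \<in> borel_measurable borel"
  shows "(\<integral>\<^sup>+x. \<rho> x * (\<integral>\<^sup>+t. \<psi> t * indicator {t. 0 \<le> t \<and> ennreal t < F x} t \<partial>lborel) \<partial>lborel)
       = (\<integral>\<^sup>+t. \<psi> t * indicator {0..} t * (\<integral>\<^sup>+x. \<rho> x * indicator {x. ennreal t < F x} x \<partial>lborel) \<partial>lborel)"
proof -
  have [measurable]: "Measurable.pred (borel \<Otimes>\<^sub>M borel) (\<lambda>(x, t). 0 \<le> t \<and> ennreal t < F x)" by measurable
  have "(\<integral>\<^sup>+x. \<rho> x * (\<integral>\<^sup>+t. \<psi> t * indicator {t. 0 \<le> t \<and> ennreal t < F x} t \<partial>lborel) \<partial>lborel)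
      = (\<integral>\<^sup>+x. (\<integral>\<^sup>+t. \<rho> x * \<psi> t * indicator {(x, t). 0 \<le> t \<and> ennreal t < F x} (x, t) \<partial>lborel) \<partial>lborel)"
  proof (rule nn_integral_cong)
    fix x
    have [measurable]: "{t. 0 \<le> t \<and> ennreal t < F x} \<in> sets borel" by measurable
    show "\<rho> x * (\<integral>\<^sup>+t. \<psi> t * indicator {t. 0 \<le> t \<and> ennreal t < F x} t \<partial>lborel)
        = (\<integral>\<^sup>+t. \<rho> x * \<psi> t * indicator {(x, t). 0 \<le> t \<and> ennreal t < F x} (x, t) \<partial>lborel)"
      by (subst nn_integral_cmult[symmetric]) (auto intro!: nn_integral_cong simp: mult.assoc indicator_def)
  qed
  also have "\<dots> = (\<integral>\<^sup>+t. (\<integral>\<^sup>+x. \<rho> x * \<psi> t * indicator {(x, t). 0 \<le> t \<and> ennreal t < F x} (x, t) \<partial>lborel) \<partial>lborel)"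
    by (rule lborel_pair.Fubini'[symmetric]) (simp add: case_prod_beta', measurable)
  also have "\<dots> = (\<integral>\<^sup>+t. \<psi> t * indicator {0..} t * (\<integral>\<^sup>+x. \<rho> x * indicator {x. ennreal t < F x} x \<partial>lborel) \<partial>lborel)"
    by (intro nn_integral_cong, subst nn_integral_cmult[symmetric])
       (auto intro!: nn_integral_cong simp: mult_ac indicator_def)
  finally show ?thesis .
qed

lemma nn_integral_indicator_below:
  "(\<integral>\<^sup>+t. indicator {t. 0 \<le> t \<and> ennreal t < c} t \<partial>lborel) = c"
proof (cases c)
  case (real r)
  then have "{t. 0 \<le> t \<and> ennreal t < c} = {0..<r}" by (auto simp: ennreal_less_iff)
  then show ?thesis using real by simp
next
  case top
  then have "{t. 0 \<le> t \<and> ennreal t < c} = {0..}" by auto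
  moreover have "emeasure lborel {0::real..} = top"
  proof (rule ccontr)
    assume "emeasure lborel {0::real..} \<noteq> top"
    then obtain n where n: "emeasure lborel {0::real..} < of_nat n"
      using ennreal_Ex_less_of_nat by (auto simp: less_top)
    have "ennreal (real n) = emeasure lborel {0..real n}" by simp
    also have "\<dots> \<le> emeasure lborel {0::real..}" by (rule emeasure_mono) auto
    finally show False using n by (simp add: ennreal_of_nat_eq_real_of_nat leD)
  qed
  ultimately show ?thesis using top by simp
qed

lemma nn_integral_double_below:
  assumes "c \<ge> 0"
  shows "(\<integral>\<^sup>+t. ennreal (2 * t) * indicator {t. 0 \<le> t \<and> ennreal t < ennreal c} t \<partial>lborel) = ennreal (c\<^sup>2)"
proof -
  have "(\<integral>\<^sup>+t. ennreal (2 * t) * indicator {t. 0 \<le> t \<and> ennreal t < ennreal c} t \<partial>lborel)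
      = (\<integral>\<^sup>+t. ennreal (real 2 * t ^ (2 - 1)) * indicator {0..c} t \<partial>lborel)"
  proof (rule nn_integral_cong_AE)
    have "AE t in lborel. t \<noteq> c" by (rule AE_lborel_singleton)
    then show "AE t in lborel. ennreal (2 * t) * indicator {t. 0 \<le> t \<and> ennreal t < ennreal c} t
        = ennreal (real 2 * t ^ (2 - 1)) * indicator {0..c} t"
      by eventually_elim (auto simp: ennreal_less_iff split: split_indicator)
  qed
  then show ?thesis using nn_integral_power_Icc[of 2 c] assms by simp
qed

lemma nn_integral_equidistributed:
  fixes f v :: "'a::euclidean_space \<Rightarrow> real"
  assumes [measurable]: "f \<in> borel_measurable borel" "v \<in> borel_measurable borel" "h \<in> borel_measurable borel"
    and eq: "\<And>t. t \<ge> 0 \<Longrightarrow> emeasure lborel {x. f x > t} = emeasure lborel {x. v x > t}"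
    and fin: "emeasure lborel {x. f x > 0} < \<infinity>"
  shows "(\<integral>\<^sup>+x. h (f x) * indicator {x. f x > 0} x \<partial>lborel) = (\<integral>\<^sup>+x. h (v x) * indicator {x. v x > 0} x \<partial>lborel)"
proof -
  define \<mu> where "\<mu> g = distr (density lborel (indicator {x. g x > 0})) borel g" for g :: "'a \<Rightarrow> real"
  have tail: "emeasure (\<mu> g) {t<..} = emeasure lborel {x. g x > max t 0}" if [measurable]: "g \<in> borel_measurable borel" for g t
  proof -
    have "emeasure (\<mu> g) {t<..} = emeasure (density lborel (indicator {x. g x > 0})) {x. g x > t}"
      unfolding \<mu>_def by (subst emeasure_distr) (auto simp: vimage_def)
    also have "\<dots> = (\<integral>\<^sup>+x. indicator {x. g x > 0} x * indicator {x. g x > t} x \<partial>lborel)"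
      by (subst emeasure_density) auto
    also have "\<dots> = (\<integral>\<^sup>+x. indicator {x. g x > max t 0} x \<partial>lborel)"
      by (rule nn_integral_cong) (auto split: split_indicator)
    finally show ?thesis by simp
  qed
  have "\<mu> f = \<mu> v"
  proof (rule measure_eqI_lessThan)
    fix t
    have "emeasure (\<mu> f) {t<..} \<le> emeasure lborel {x. f x > 0}"
      by (subst tail) (auto intro!: emeasure_mono)
    then show "emeasure (\<mu> f) {t<..} < \<infinity>" using fin by (rule le_less_trans)
    show "emeasure (\<mu> f) {t<..} = emeasure (\<mu> v) {t<..}"
      unfolding tail[OF assms(1)] tail[OF assms(2)] by (rule eq) simp
  qed (simp_all add: \<mu>_def)
  moreover have "(\<integral>\<^sup>+x. h (g x) * indicator {x. g x > 0} x \<partial>lborel) = (\<integral>\<^sup>+t. h t \<partial>\<mu> g)"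
    if [measurable]: "g \<in> borel_measurable borel" for g
    unfolding \<mu>_def by (simp add: nn_integral_distr nn_integral_density mult.commute)
  ultimately show ?thesis by simp
qed

section \<open>A one-sided coarea formula\<close>

lemma power_add_ge_linear:
  fixes r e :: real
  assumes "r > 0" "e \<ge> 0" "n > 0"
  shows "real n * r ^ (n - 1) * e \<le> (r + e) ^ n - r ^ n"
proof -
  have "1 + real n * (e / r) \<le> (1 + e / r) ^ n"
    using divide_nonneg_pos[of e r] assms by (intro Bernoulli_inequality) linarith
  then have "r ^ n * (1 + real n * (e / r)) \<le> r ^ n * (1 + e / r) ^ n"
    using assms by (intro mult_left_mono) auto
  also have "\<dots> = (r * (1 + e / r)) ^ n" by (simp only: power_mult_distrib)
  also have "r * (1 + e / r) = r + e" using assms by (simp add: field_simps)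
  finally have "r ^ n + r ^ n * (real n * (e / r)) \<le> (r + e) ^ n" by (simp add: distrib_left)
  moreover have "r ^ n * (real n * (e / r)) = real n * r ^ (n - 1) * e"
    using assms by (cases n) (auto simp: field_simps)
  ultimately show ?thesis by linarith
qed

lemma surface_le_neighbourhood:
  fixes U :: "'a::euclidean_space set"
  assumes U: "open U" "bounded U" "measure lebesgue U = unit_ball_vol (real DIM('a)) * r ^ DIM('a)"
    and r: "r \<ge> 0" and e: "e > 0" and N: "DIM('a) \<ge> 2"
  shows "ennreal (real DIM('a) * unit_ball_vol (real DIM('a)) * r ^ (DIM('a) - 1) * e)
     \<le> emeasure lborel ((U + ball 0 e) - U)"
proof (cases "r = 0")
  case True
  then show ?thesis using N by (simp add: zero_power)
next
  case False
  let ?w = "unit_ball_vol (real DIM('a))"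
  have r0: "r > 0" using r False by simp
  have sub: "U \<subseteq> U + ball 0 e" using e by (force intro: set_plus_intro[of _ U 0, simplified])
  have o: "open (U + ball 0 e)" "bounded (U + ball 0 e)"
    using U by (auto intro!: open_set_plus bounded_set_plus)
  have lm: "U + ball 0 e \<in> lmeasurable" "U \<in> lmeasurable" using o U by (auto intro: lmeasurable_open)
  have "real DIM('a) * ?w * r ^ (DIM('a) - 1) * e = ?w * (real DIM('a) * r ^ (DIM('a) - 1) * e)" by simp
  also have "\<dots> \<le> ?w * ((r + e) ^ DIM('a) - r ^ DIM('a))"
    using e r0 by (intro mult_left_mono power_add_ge_linear) auto
  also have "\<dots> \<le> measure lebesgue (U + ball 0 e) - measure lebesgue U"
    using measure_neighbourhood_ge[OF U r0 e] U(3) by (simp add: right_diff_distrib)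
  also have "\<dots> = measure lebesgue ((U + ball 0 e) - U)"
    using lm sub by (simp add: measurable_measure_Diff fmeasurableD)
  finally have "ennreal (real DIM('a) * ?w * r ^ (DIM('a) - 1) * e) \<le> ennreal (measure lebesgue ((U + ball 0 e) - U))"
    by (rule ennreal_leI)
  also have "\<dots> = emeasure lebesgue ((U + ball 0 e) - U)"
    using lm by (intro emeasure_eq_measure2[symmetric] fmeasurable_Diff) (auto simp: fmeasurableD)
  also have "\<dots> = emeasure lborel ((U + ball 0 e) - U)"
  proof -
    have "(U + ball 0 e) - U \<in> sets borel" using o U by auto
    then show ?thesis by simp
  qed
  finally show ?thesis .
qed

text \<open>Consider the pairs \<open>(x, t)\<close> such that \<open>f x \<le> t\<close> but some point closer to \<open>x\<close> than \<open>\<epsilon>\<close> has a value above \<open>t\<close>.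
  For fixed \<open>t\<close> they form the \<open>\<epsilon>\<close>-collar of \<open>{f > t}\<close>, whose volume is at least
  \<open>\<epsilon>\<close> times the surface area of the ball of radius \<open>R t\<close>.  For fixed \<open>x\<close> they form an interval that starts at \<open>f x\<close>
  and has length at most about \<open>\<epsilon> * G x\<close>, on which \<open>h\<close> is nearly constant.  Comparing the two iterated integrals
  and dividing by \<open>\<epsilon>\<close> gives the claim up to an arbitrarily small error.\<close>

lemma coarea_lipschitz:
  fixes f G :: "'a::euclidean_space \<Rightarrow> real" and h R :: "real \<Rightarrow> real"
  assumes N: "DIM('a) \<ge> 2"
    and f: "continuous_on UNIV f" "\<And>x. f x \<ge> 0" "\<And>x. norm x \<ge> M \<Longrightarrow> f x = 0"
    and G: "continuous_on UNIV G" "\<And>x. G x \<ge> 0" "\<And>x. G x \<le> L"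
    and slope: "\<And>\<delta>. \<delta> > 0 \<Longrightarrow> \<exists>\<epsilon>>0. \<forall>x y. dist y x < \<epsilon> \<longrightarrow> \<bar>f y - f x\<bar> \<le> (G x + \<delta>) * dist y x"
    and R: "\<And>t. t \<ge> 0 \<Longrightarrow> measure lebesgue {x. f x > t} = unit_ball_vol (real DIM('a)) * R t ^ DIM('a)"
      "\<And>t. R t \<ge> 0" "R \<in> borel_measurable borel"
    and h: "\<And>t. 0 \<le> h t" "\<And>t. h t \<le> 1" "\<And>s t. \<bar>h s - h t\<bar> \<le> K * \<bar>s - t\<bar>" "K > 0"
  shows "(\<integral>\<^sup>+t. ennreal (h t) * (ennreal (real DIM('a) * unit_ball_vol (real DIM('a)) * R t ^ (DIM('a) - 1)) * indicator {0..} t) \<partial>lborel)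
     \<le> (\<integral>\<^sup>+x. ennreal (h (f x)) * ennreal (G x) \<partial>lborel)"
    (is "?lhs \<le> ?rhs")
proof (rule ennreal_le_epsilon)
  fix \<eta> :: real assume "\<eta> > 0"
  let ?w = "unit_ball_vol (real DIM('a))"
  have L0: "L \<ge> 0" using G(2,3)[of 0] by linarith
  have [measurable]: "f \<in> borel_measurable borel" "G \<in> borel_measurable borel"
    using f(1) G(1) by (auto intro: borel_measurable_continuous_onI)
  have "K-lipschitz_on UNIV h" using h(3,4) by (intro lipschitz_onI) (auto simp: dist_real_def)
  then have [measurable]: "h \<in> borel_measurable borel"
    by (intro borel_measurable_continuous_onI lipschitz_on_continuous_on)
  note R(3)[measurable]
  \<comment> \<open>The error per unit of \<open>\<delta>\<close>: the sections over \<open>x\<close> are empty outside the ball of radius \<open>M + 1\<close>.\<close>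
  define C where "C = measure lborel (ball (0::'a) (M + 1)) * (2 + L)"
  have C: "C \<ge> 0" using L0 by (simp add: C_def)
  define \<delta> where "\<delta> = min 1 (\<eta> / (C + 1))"
  have \<delta>: "\<delta> > 0" "\<delta> \<le> 1" "\<delta> * C \<le> \<eta>"
  proof -
    show "\<delta> > 0" "\<delta> \<le> 1" using \<open>\<eta> > 0\<close> C by (auto simp: \<delta>_def)
    have "\<delta> * C \<le> \<eta> / (C + 1) * C" using C by (intro mult_right_mono) (auto simp: \<delta>_def)
    also have "\<dots> \<le> \<eta>" using C \<open>\<eta> > 0\<close> by (simp add: field_simps)
    finally show "\<delta> * C \<le> \<eta>" .
  qed
  obtain \<epsilon>0 where \<epsilon>0: "\<epsilon>0 > 0" "\<And>x y. dist y x < \<epsilon>0 \<Longrightarrow> \<bar>f y - f x\<bar> \<le> (G x + \<delta>) * dist y x"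
    using slope[OF \<delta>(1)] by blast
  \<comment> \<open>The last bound keeps the variation of \<open>h\<close> along a section over \<open>x\<close> below \<open>\<delta>\<close>.\<close>
  define \<epsilon> where "\<epsilon> = min (min 1 \<epsilon>0) (\<delta> / (K * (L + 1)))"
  have \<epsilon>: "\<epsilon> > 0" "\<epsilon> \<le> 1" "\<epsilon> \<le> \<epsilon>0" using \<epsilon>0(1) \<delta> h(4) L0 by (auto simp: \<epsilon>_def)
  have K\<epsilon>: "K * ((G x + \<delta>) * \<epsilon>) \<le> \<delta>" for x
  proof -
    have "K * ((G x + \<delta>) * \<epsilon>) \<le> K * ((L + 1) * \<epsilon>)"
      using G(3)[of x] \<delta> h(4) \<epsilon>(1) by (intro mult_left_mono mult_right_mono add_mono) auto
    also have "\<dots> = \<epsilon> * (K * (L + 1))" by simp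
    also have "\<dots> \<le> \<delta> / (K * (L + 1)) * (K * (L + 1))"
      using h(4) L0 by (intro mult_right_mono) (auto simp: \<epsilon>_def)
    also have "\<dots> = \<delta>" using h(4) L0 by simp
    finally show ?thesis .
  qed
  define E where "E = {(x, t). f x \<le> t} \<inter> (\<Union>y. ball y \<epsilon> \<times> {..<f y})"
  have Emem: "(x, t) \<in> E \<longleftrightarrow> f x \<le> t \<and> (\<exists>y. dist y x < \<epsilon> \<and> t < f y)" for x t
    by (auto simp: E_def)
  have [measurable]: "E \<in> sets (borel \<Otimes>\<^sub>M borel)"
  proof -
    have "open (\<Union>y. ball y \<epsilon> \<times> {..<f y})" by (intro open_UN ballI open_Times) auto
    then have "(\<Union>y. ball y \<epsilon> \<times> {..<f y}) \<in> sets (borel \<Otimes>\<^sub>M borel)"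
      unfolding borel_prod by (rule borel_open)
    moreover have "{(x, t). f x \<le> t} \<in> sets (borel \<Otimes>\<^sub>M borel)"
    proof -
      have "{z \<in> space (borel \<Otimes>\<^sub>M borel). f (fst z) \<le> snd z} \<in> sets (borel \<Otimes>\<^sub>M borel)" by measurable
      then show ?thesis by (simp add: space_pair_measure case_prod_beta')
    qed
    ultimately show ?thesis unfolding E_def by (rule sets.Int[rotated])
  qed
  have section_t: "ennreal (real DIM('a) * ?w * R t ^ (DIM('a) - 1) * \<epsilon>) \<le> (\<integral>\<^sup>+x. indicator E (x, t) \<partial>lborel)"
    if "t \<ge> 0" for t
  proof -
    let ?U = "{x. f x > t}"
    have U: "open ?U" using f(1) by (intro open_Collect_less) auto
    have bU: "bounded ?U"
      by (rule bounded_subset[OF bounded_ball[of 0 M]]) (use f(3) that in \<open>auto simp: not_le[symmetric]\<close>)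
    have "{x. (x, t) \<in> E} = (?U + ball 0 \<epsilon>) - ?U"
    proof -
      have "(\<exists>y. dist y x < \<epsilon> \<and> t < f y) \<longleftrightarrow> x \<in> ?U + ball 0 \<epsilon>" for x
      proof
        assume "\<exists>y. dist y x < \<epsilon> \<and> t < f y"
        then obtain y where "dist y x < \<epsilon>" "t < f y" by blast
        then have "y \<in> ?U" "x - y \<in> ball 0 \<epsilon>" by (auto simp: dist_norm norm_minus_commute)
        from set_plus_intro[OF this] show "x \<in> ?U + ball 0 \<epsilon>" by simp
      next
        assume "x \<in> ?U + ball 0 \<epsilon>"
        then obtain y z where "x = y + z" "t < f y" "norm z < \<epsilon>" by (auto simp: set_plus_def)
        then show "\<exists>y. dist y x < \<epsilon> \<and> t < f y" by (intro exI[of _ y]) (simp add: dist_norm)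
      qed
      then show ?thesis unfolding Emem by auto
    qed
    then have eq: "indicator E (x, t) = (indicator ((?U + ball 0 \<epsilon>) - ?U) x :: ennreal)" for x
      by (auto simp: indicator_def)
    have [measurable]: "(?U + ball 0 \<epsilon>) - ?U \<in> sets borel"
      using U open_set_plus[OF U, of "ball 0 \<epsilon>"] by auto
    show ?thesis
      unfolding eq using surface_le_neighbourhood[OF U bU R(1)[OF that] R(2) \<epsilon>(1) N] by simp
  qed
  have section_x: "(\<integral>\<^sup>+t. ennreal (h t) * indicator {0..} t * indicator E (x, t) \<partial>lborel)
      \<le> ennreal ((h (f x) + \<delta>) * ((G x + \<delta>) * \<epsilon>)) * indicator (ball 0 (M + 1)) x" for x
  proof -
    have pos: "h (f x) + \<delta> \<ge> 0" "(G x + \<delta>) * \<epsilon> \<ge> 0" using h(1)[of "f x"] G(2)[of x] \<delta> \<epsilon> by auto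
    have le: "ennreal (h t) * indicator {0..} t * indicator E (x, t)
        \<le> ennreal (h (f x) + \<delta>) * indicator (ball 0 (M + 1)) x * indicator {f x..f x + (G x + \<delta>) * \<epsilon>} t" for t
    proof (cases "t \<ge> 0 \<and> (x, t) \<in> E")
      case True
      then obtain y where y: "f x \<le> t" "dist y x < \<epsilon>" "t < f y" by (auto simp: Emem)
      have "f y - f x \<le> (G x + \<delta>) * dist y x" using \<epsilon>0(2)[of y x] y \<epsilon> by auto
      also have "\<dots> \<le> (G x + \<delta>) * \<epsilon>" using y G(2)[of x] \<delta> by (intro mult_left_mono) auto
      finally have t: "t - f x \<le> (G x + \<delta>) * \<epsilon>" using y by linarith
      have "h t - h (f x) \<le> K * \<bar>t - f x\<bar>" using h(3)[of t "f x"] by linarith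
      also have "\<dots> \<le> K * ((G x + \<delta>) * \<epsilon>)" using t y h(4) by (intro mult_left_mono) auto
      also have "\<dots> \<le> \<delta>" by (rule K\<epsilon>)
      finally have ht: "h t \<le> h (f x) + \<delta>" by linarith
      have "norm y < M" using f(3)[of y] y True by (force simp: not_le[symmetric])
      then have "x \<in> ball 0 (M + 1)" using y \<epsilon>(2) norm_triangle_ineq2[of x y] by (auto simp: dist_norm norm_minus_commute)
      then show ?thesis using True t y ht by (simp add: ennreal_leI)
    next
      case False
      then show ?thesis by (auto simp: indicator_def)
    qed
    have "(\<integral>\<^sup>+t. ennreal (h t) * indicator {0..} t * indicator E (x, t) \<partial>lborel)
      \<le> (\<integral>\<^sup>+t. ennreal (h (f x) + \<delta>) * indicator (ball 0 (M + 1)) x * indicator {f x..f x + (G x + \<delta>) * \<epsilon>} t \<partial>lborel)"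
      by (rule nn_integral_mono) (rule le)
    also have "\<dots> = ennreal (h (f x) + \<delta>) * indicator (ball 0 (M + 1)) x * ennreal ((G x + \<delta>) * \<epsilon>)"
      using pos by (subst nn_integral_cmult_indicator) auto
    finally show ?thesis unfolding ennreal_mult[OF pos] by (simp only: mult_ac)
  qed
  have "ennreal \<epsilon> * ?lhs = (\<integral>\<^sup>+t. ennreal (h t) * indicator {0..} t * ennreal (real DIM('a) * ?w * R t ^ (DIM('a) - 1) * \<epsilon>) \<partial>lborel)"
    using \<epsilon>(1) R(2) by (subst nn_integral_cmult[symmetric]) (auto intro!: nn_integral_cong simp: ennreal_mult mult_ac)
  also have "\<dots> \<le> (\<integral>\<^sup>+t. ennreal (h t) * indicator {0..} t * (\<integral>\<^sup>+x. indicator E (x, t) \<partial>lborel) \<partial>lborel)"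
    by (rule nn_integral_mono) (use section_t in \<open>auto intro!: mult_left_mono split: split_indicator\<close>)
  also have "\<dots> = (\<integral>\<^sup>+t. (\<integral>\<^sup>+x. ennreal (h t) * indicator {0..} t * indicator E (x, t) \<partial>lborel) \<partial>lborel)"
    by (intro nn_integral_cong, subst nn_integral_cmult) auto
  also have "\<dots> = (\<integral>\<^sup>+x. (\<integral>\<^sup>+t. ennreal (h t) * indicator {0..} t * indicator E (x, t) \<partial>lborel) \<partial>lborel)"
    by (rule lborel_pair.Fubini') (simp add: case_prod_beta')
  also have "\<dots> \<le> (\<integral>\<^sup>+x. ennreal ((h (f x) + \<delta>) * ((G x + \<delta>) * \<epsilon>)) * indicator (ball 0 (M + 1)) x \<partial>lborel)"
    by (rule nn_integral_mono) (rule section_x)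
  also have "\<dots> \<le> (\<integral>\<^sup>+x. ennreal \<epsilon> * (ennreal (h (f x)) * ennreal (G x) + ennreal (\<delta> * (2 + L)) * indicator (ball 0 (M + 1)) x) \<partial>lborel)"
  proof (rule nn_integral_mono)
    fix x :: 'a
    have "(h (f x) + \<delta>) * (G x + \<delta>) = h (f x) * G x + \<delta> * (h (f x) + G x + \<delta>)" by (simp add: algebra_simps)
    also have "\<dots> \<le> h (f x) * G x + \<delta> * (1 + L + 1)"
      using h(2)[of "f x"] G(3)[of x] \<delta> by (intro add_left_mono mult_left_mono add_mono) auto
    finally have "\<epsilon> * ((h (f x) + \<delta>) * (G x + \<delta>)) \<le> \<epsilon> * (h (f x) * G x + \<delta> * (2 + L))"
      using \<epsilon>(1) by (intro mult_left_mono) auto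
    then have "ennreal ((h (f x) + \<delta>) * ((G x + \<delta>) * \<epsilon>)) \<le> ennreal (\<epsilon> * (h (f x) * G x + \<delta> * (2 + L)))"
      by (intro ennreal_leI) (simp add: mult_ac)
    also have "\<dots> = ennreal \<epsilon> * (ennreal (h (f x)) * ennreal (G x) + ennreal (\<delta> * (2 + L)))"
      using \<epsilon>(1) \<delta> h(1) G(2) L0 by (simp add: ennreal_mult)
    finally show "ennreal ((h (f x) + \<delta>) * ((G x + \<delta>) * \<epsilon>)) * indicator (ball 0 (M + 1)) x
      \<le> ennreal \<epsilon> * (ennreal (h (f x)) * ennreal (G x) + ennreal (\<delta> * (2 + L)) * indicator (ball 0 (M + 1)) x)"
      by (auto split: split_indicator)
  qed
  also have "\<dots> = ennreal \<epsilon> * (?rhs + ennreal (\<delta> * C))"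
  proof -
    have [measurable]: "ball (0::'a) (M + 1) \<in> sets borel" by simp
    have "emeasure lborel (ball (0::'a) (M + 1)) = ennreal (measure lborel (ball (0::'a) (M + 1)))"
      using emeasure_lborel_ball_finite[of "0::'a" "M + 1"] by (intro emeasure_eq_ennreal_measure) auto
    then have "(\<integral>\<^sup>+x. ennreal (\<delta> * (2 + L)) * indicator (ball (0::'a) (M + 1)) x \<partial>lborel) = ennreal (\<delta> * C)"
      using \<delta>(1) L0 by (subst nn_integral_cmult_indicator) (auto simp: C_def ennreal_mult[symmetric] mult_ac)
    moreover have "(\<lambda>x. ennreal (h (f x)) * ennreal (G x)) \<in> borel_measurable lborel"
      "(\<lambda>x. ennreal (\<delta> * (2 + L)) * indicator (ball (0::'a) (M + 1)) x) \<in> borel_measurable lborel"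
      by measurable
    ultimately show ?thesis
      by (subst nn_integral_cmult) (auto simp only: nn_integral_add intro!: borel_measurable_add)
  qed
  also have "\<dots> \<le> ennreal \<epsilon> * (?rhs + ennreal \<eta>)"
    using \<delta>(3) by (intro mult_left_mono add_left_mono ennreal_leI) auto
  finally show "?lhs \<le> ?rhs + ennreal \<eta>"
    using \<epsilon>(1) by (simp add: ennreal_mult_le_mult_iff)
qed

text \<open>The indicator of an open set is an increasing limit of Lipschitz functions, which gives
  \<open>emeasure \<mu> U \<le> emeasure \<nu> U\<close> for open \<open>U\<close>; outer regularity of the finite measure \<open>\<nu>\<close> extends this to
  Borel sets.\<close>

lemma nn_integral_mono_of_lipschitz:
  fixes \<mu> \<nu> :: "real measure" and h :: "real \<Rightarrow> ennreal"
  assumes sets: "sets \<mu> = sets borel" "sets \<nu> = sets borel" and fin: "emeasure \<nu> UNIV \<noteq> \<infinity>"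
    and lip: "\<And>g K. \<lbrakk>\<And>t. 0 \<le> g t; \<And>t. g t \<le> 1; \<And>s t. \<bar>g s - g t\<bar> \<le> K * \<bar>s - t\<bar>; K > (0::real)\<rbrakk>
        \<Longrightarrow> (\<integral>\<^sup>+t. ennreal (g t) \<partial>\<mu>) \<le> (\<integral>\<^sup>+t. ennreal (g t) \<partial>\<nu>)"
  shows "(\<integral>\<^sup>+t. h t \<partial>\<mu>) \<le> (\<integral>\<^sup>+t. h t \<partial>\<nu>)"
proof -
  have sp: "space \<mu> = UNIV" "space \<nu> = UNIV" using sets by (auto dest: sets_eq_imp_space_eq)
  have open_le: "emeasure \<mu> U \<le> emeasure \<nu> U" if U: "open U" for U
  proof (cases "U = UNIV")
    case True
    have "(\<integral>\<^sup>+t. ennreal 1 \<partial>\<mu>) \<le> (\<integral>\<^sup>+t. ennreal 1 \<partial>\<nu>)" by (rule lip[of _ 1]) auto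
    then show ?thesis using True sp by simp
  next
    case False
    then have ne: "- U \<noteq> {}" by auto
    define g where "g n t = min 1 (real n * infdist t (- U))" for n :: nat and t
    have g0: "0 \<le> g n t" "g n t \<le> 1" for n t by (auto simp: g_def infdist_nonneg)
    have gl: "\<bar>g n s - g n t\<bar> \<le> (real n + 1) * \<bar>s - t\<bar>" for n s t
    proof -
      have "\<bar>g n s - g n t\<bar> \<le> \<bar>real n * infdist s (- U) - real n * infdist t (- U)\<bar>"
        unfolding g_def by linarith
      also have "\<dots> = real n * \<bar>infdist s (- U) - infdist t (- U)\<bar>"
        by (simp add: right_diff_distrib[symmetric] abs_mult)
      also have "\<dots> \<le> real n * \<bar>s - t\<bar>"
        using infdist_triangle_abs[of s "- U" t] by (intro mult_left_mono) (auto simp: dist_real_def)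
      also have "\<dots> \<le> (real n + 1) * \<bar>s - t\<bar>" by (simp add: distrib_right)
      finally show ?thesis .
    qed
    have [measurable]: "(\<lambda>t. infdist t (- U)) \<in> borel_measurable borel"
      by (intro borel_measurable_continuous_onI continuous_intros)
    have gm: "(\<lambda>t. ennreal (g n t)) \<in> borel_measurable \<mu>" for n
      unfolding g_def measurable_cong_sets[OF sets(1) refl] by measurable
    have inc: "incseq (\<lambda>n t. ennreal (g n t))"
      unfolding incseq_def le_fun_def g_def
      by (intro allI impI ennreal_leI min.mono mult_right_mono) (auto simp: infdist_nonneg)
    have sup: "(SUP n. ennreal (g n t)) = indicator U t" for t
    proof (cases "t \<in> U")
      case False
      then have "g n t = 0" for n by (simp add: g_def)
      then show ?thesis using False by simp
    next
      case True
      have "infdist t (- U) \<noteq> 0"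
        using in_closed_iff_infdist_zero[of "- U" t] U ne True by (auto simp: closed_Compl)
      then have "infdist t (- U) > 0" using infdist_nonneg[of t "- U"] by linarith
      then obtain n where "1 < real n * infdist t (- U)" using reals_Archimedean3 by blast
      then have "g n t = 1" by (simp add: g_def)
      then have "1 \<le> (SUP n. ennreal (g n t))" by (intro SUP_upper2[of n]) auto
      moreover have "(SUP n. ennreal (g n t)) \<le> 1" using g0(2) by (intro SUP_least) (simp add: ennreal_le_1)
      ultimately have "(SUP n. ennreal (g n t)) = 1" by (intro antisym)
      then show ?thesis using True by simp
    qed
    have "emeasure \<mu> U = (\<integral>\<^sup>+t. indicator U t \<partial>\<mu>)" using U sets by simp
    also have "\<dots> = (\<integral>\<^sup>+t. (SUP n. ennreal (g n t)) \<partial>\<mu>)" by (simp add: sup)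
    also have "\<dots> = (SUP n. (\<integral>\<^sup>+t. ennreal (g n t) \<partial>\<mu>))"
      by (rule nn_integral_monotone_convergence_SUP[OF inc gm])
    also have "\<dots> \<le> (\<integral>\<^sup>+t. indicator U t \<partial>\<nu>)"
    proof (rule SUP_least)
      fix n
      have "(\<integral>\<^sup>+t. ennreal (g n t) \<partial>\<mu>) \<le> (\<integral>\<^sup>+t. ennreal (g n t) \<partial>\<nu>)"
        by (rule lip[of "g n" "real n + 1"]) (auto simp: g0 gl)
      also have "\<dots> \<le> (\<integral>\<^sup>+t. indicator U t \<partial>\<nu>)"
        unfolding sup[symmetric] by (intro nn_integral_mono SUP_upper) simp
      finally show "(\<integral>\<^sup>+t. ennreal (g n t) \<partial>\<mu>) \<le> (\<integral>\<^sup>+t. indicator U t \<partial>\<nu>)" .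
    qed
    also have "\<dots> = emeasure \<nu> U" using U sets by simp
    finally show ?thesis .
  qed
  have "emeasure \<mu> B \<le> emeasure \<nu> B" if B: "B \<in> sets borel" for B
  proof -
    have "emeasure \<mu> B \<le> emeasure \<nu> U" if "B \<subseteq> U" "open U" for U
      using emeasure_mono[of B U \<mu>] open_le[of U] that sets by (auto intro: order_trans)
    then have "emeasure \<mu> B \<le> (INF U \<in> {U. B \<subseteq> U \<and> open U}. emeasure \<nu> U)"
      by (intro INF_greatest) auto
    also have "\<dots> = emeasure \<nu> B"
      by (rule outer_regular[symmetric]) (use sets B fin sp in auto)
    finally show ?thesis .
  qed
  then have "\<mu> \<le> \<nu>" using sets by (subst le_measure) auto
  then show ?thesis using sets by (intro nn_integral_mono_measure) auto
qed

text \<open>The weight used later contains the distribution function and may be discontinuous, hence the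
  passage from Lipschitz to Borel weights.\<close>

lemma coarea_inequality:
  fixes f G :: "'a::euclidean_space \<Rightarrow> real" and R :: "real \<Rightarrow> real" and h :: "real \<Rightarrow> ennreal"
  assumes N: "DIM('a) \<ge> 2"
    and f: "continuous_on UNIV f" "\<And>x. f x \<ge> 0" "\<And>x. norm x \<ge> M \<Longrightarrow> f x = 0"
    and G: "continuous_on UNIV G" "\<And>x. G x \<ge> 0" "\<And>x. G x \<le> L" "\<And>x. norm x \<ge> M \<Longrightarrow> G x = 0"
    and slope: "\<And>\<delta>. \<delta> > 0 \<Longrightarrow> \<exists>\<epsilon>>0. \<forall>x y. dist y x < \<epsilon> \<longrightarrow> \<bar>f y - f x\<bar> \<le> (G x + \<delta>) * dist y x"
    and R: "\<And>t. t \<ge> 0 \<Longrightarrow> measure lebesgue {x. f x > t} = unit_ball_vol (real DIM('a)) * R t ^ DIM('a)"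
      "\<And>t. R t \<ge> 0" "R \<in> borel_measurable borel"
    and h: "h \<in> borel_measurable borel"
  shows "(\<integral>\<^sup>+t. h t * (ennreal (real DIM('a) * unit_ball_vol (real DIM('a)) * R t ^ (DIM('a) - 1)) * indicator {0..} t) \<partial>lborel)
     \<le> (\<integral>\<^sup>+x. h (f x) * ennreal (G x) \<partial>lborel)"
proof -
  have [measurable]: "f \<in> borel_measurable borel" "G \<in> borel_measurable borel"
    using f(1) G(1) by (auto intro: borel_measurable_continuous_onI)
  note R(3)[measurable] h[measurable]
  define s where "s t = ennreal (real DIM('a) * unit_ball_vol (real DIM('a)) * R t ^ (DIM('a) - 1)) * indicator {0..} t" for t
  have [measurable]: "s \<in> borel_measurable borel" unfolding s_def by measurable
  define \<mu> where "\<mu> = density lborel s"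
  define \<nu> where "\<nu> = distr (density lborel (\<lambda>x. ennreal (G x))) borel f"
  have \<mu>: "(\<integral>\<^sup>+t. g t \<partial>\<mu>) = (\<integral>\<^sup>+t. g t * s t \<partial>lborel)" if [measurable]: "g \<in> borel_measurable borel" for g
    unfolding \<mu>_def by (simp add: nn_integral_density mult.commute)
  have \<nu>: "(\<integral>\<^sup>+t. g t \<partial>\<nu>) = (\<integral>\<^sup>+x. g (f x) * ennreal (G x) \<partial>lborel)" if [measurable]: "g \<in> borel_measurable borel" for g
    unfolding \<nu>_def by (simp add: nn_integral_distr nn_integral_density mult.commute)
  have "(\<integral>\<^sup>+t. h t \<partial>\<mu>) \<le> (\<integral>\<^sup>+t. h t \<partial>\<nu>)"
  proof (rule nn_integral_mono_of_lipschitz)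
    show "sets \<mu> = sets borel" "sets \<nu> = sets borel" by (simp_all add: \<mu>_def \<nu>_def)
    have "emeasure \<nu> UNIV = (\<integral>\<^sup>+t. 1 \<partial>\<nu>)" by (simp add: \<nu>_def)
    also have "\<dots> = (\<integral>\<^sup>+x. ennreal (G x) \<partial>lborel)" by (subst \<nu>) auto
    also have "\<dots> \<le> (\<integral>\<^sup>+x. ennreal L * indicator (ball (0::'a) M) x \<partial>lborel)"
      by (rule nn_integral_mono) (use G(3,4) in \<open>auto simp: indicator_def ennreal_leI not_less\<close>)
    also have "\<dots> = ennreal L * emeasure lborel (ball (0::'a) M)"
      by (rule nn_integral_cmult_indicator) simp
    also have "\<dots> < \<infinity>"
      using emeasure_lborel_ball_finite[of "0::'a" M] by (simp add: ennreal_mult_less_top)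
    finally show "emeasure \<nu> UNIV \<noteq> \<infinity>" by simp
    fix g K assume g: "\<And>t. 0 \<le> g t" "\<And>t. g t \<le> 1" "\<And>s t. \<bar>g s - g t\<bar> \<le> K * \<bar>s - t\<bar>" "K > (0::real)"
    have "K-lipschitz_on UNIV g" using g(3,4) by (intro lipschitz_onI) (auto simp: dist_real_def)
    then have [measurable]: "g \<in> borel_measurable borel"
      by (intro borel_measurable_continuous_onI lipschitz_on_continuous_on)
    show "(\<integral>\<^sup>+t. ennreal (g t) \<partial>\<mu>) \<le> (\<integral>\<^sup>+t. ennreal (g t) \<partial>\<nu>)"
      using coarea_lipschitz[OF N f G(1-3) slope R g] by (simp add: \<mu> \<nu> s_def)
  qed
  then show ?thesis by (simp add: \<mu> \<nu> s_def)
qed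

section \<open>The variational inequality for a distribution function\<close>

text \<open>\<open>R t\<close> is the radius of the ball with the volume of the superlevel set \<open>{f > t}\<close>.\<close>

locale radial_profile =
  fixes f :: "'a::euclidean_space \<Rightarrow> real" and R :: "real \<Rightarrow> real"
  assumes f_meas[measurable]: "f \<in> borel_measurable borel"
    and level: "t \<ge> 0 \<Longrightarrow> emeasure lborel {x. f x > t} = ennreal (unit_ball_vol (real DIM('a)) * R t ^ DIM('a))"
    and R_nonneg: "R t \<ge> 0"
    and R_antimono: "s \<le> t \<Longrightarrow> R t \<le> R s"
begin

lemma R_meas[measurable]: "R \<in> borel_measurable borel"
proof -
  have "(\<lambda>t. - R t) \<in> borel_measurable borel"
    by (rule borel_measurable_mono) (auto simp: mono_def R_antimono)
  then show ?thesis by (simp only: borel_measurable_uminus_eq)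
qed

lemma countable_discont: "countable {t. \<not> isCont R t}"
proof -
  have "countable {t. \<not> isCont (\<lambda>t. - R t) t}"
    by (rule mono_ctble_discont) (auto simp: mono_def R_antimono)
  moreover have "isCont R t" if "isCont (\<lambda>t. - R t) t" for t
    using continuous_minus[OF that] by simp
  ultimately show ?thesis by (elim countable_subset[rotated]) auto
qed

lemma R_right_cont:
  assumes "t \<ge> 0" "r < R t"
  shows "\<exists>s>t. r < R s"
proof (rule ccontr)
  assume "\<not> (\<exists>s>t. r < R s)"
  then have le: "R s \<le> r" if "s > t" for s using that by (meson not_less)
  have r: "r \<ge> 0" using le[of "t + 1"] R_nonneg[of "t + 1"] by linarith
  let ?w = "unit_ball_vol (real DIM('a))"
  have Un: "{x. f x > t} = (\<Union>n. {x. f x > t + 1 / Suc n})"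
  proof (intro equalityI subsetI)
    fix x assume "x \<in> {x. f x > t}"
    then have "f x - t > 0" by simp
    then obtain n where "inverse (real (Suc n)) < f x - t" using reals_Archimedean by blast
    then have "x \<in> {x. f x > t + 1 / Suc n}" by (simp add: inverse_eq_divide)
    then show "x \<in> (\<Union>n. {x. f x > t + 1 / Suc n})" by (rule UN_I[OF UNIV_I])
  next
    fix x assume "x \<in> (\<Union>n. {x. f x > t + 1 / Suc n})"
    then obtain n where n: "f x > t + 1 / real (Suc n)" by auto
    have "1 / real (Suc n) > 0" by simp
    with n have "f x > t" by linarith
    then show "x \<in> {x. f x > t}" by simp
  qed
  have "emeasure lborel {x. f x > t} = (SUP n. emeasure lborel {x. f x > t + 1 / Suc n})"
    unfolding Un
  proof (rule SUP_emeasure_incseq[symmetric])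
    show "incseq (\<lambda>n. {x. f x > t + 1 / Suc n})"
      unfolding incseq_def
    proof (intro allI impI subsetI)
      fix m n :: nat and x assume "m \<le> n" and x: "x \<in> {x. f x > t + 1 / Suc m}"
      then have "1 / real (Suc n) \<le> 1 / real (Suc m)" by (simp add: frac_le)
      with x show "x \<in> {x. f x > t + 1 / Suc n}" by simp
    qed
  qed auto
  also have "\<dots> \<le> ennreal (?w * r ^ DIM('a))"
  proof (rule SUP_least)
    fix n :: nat
    have s: "t + 1 / Suc n > t" by simp
    have "emeasure lborel {x. f x > t + 1 / Suc n} = ennreal (?w * R (t + 1 / Suc n) ^ DIM('a))"
      using assms(1) s by (intro level) linarith
    also have "\<dots> \<le> ennreal (?w * r ^ DIM('a))"
      using le[OF s] R_nonneg by (intro ennreal_leI mult_left_mono power_mono) auto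
    finally show "emeasure lborel {x. f x > t + 1 / Suc n} \<le> ennreal (?w * r ^ DIM('a))" .
  qed
  finally have "?w * R t ^ DIM('a) \<le> ?w * r ^ DIM('a)"
    using level[OF assms(1)] r by (simp add: ennreal_le_iff)
  then have "R t ^ DIM('a) \<le> r ^ DIM('a)" by simp
  moreover have "r ^ DIM('a) < R t ^ DIM('a)" using assms(2) r by (intro power_strict_mono) auto
  ultimately show False by linarith
qed

text \<open>The spherical decreasing rearrangement of \<open>f\<close>, normalized so that its superlevel sets are exactly the
  open balls of radius \<open>R t\<close>.\<close>

definition fstar :: "'a \<Rightarrow> real" where
  "fstar y = (if \<exists>t\<ge>0. norm y < R t then Sup {t. t \<ge> 0 \<and> norm y < R t} else 0)"

end

locale bounded_profile = radial_profile +
  fixes T :: real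
  assumes R_zero: "t \<ge> T \<Longrightarrow> R t = 0"
begin

lemma fstar_gt_iff:
  assumes t: "t \<ge> 0"
  shows "fstar y > t \<longleftrightarrow> norm y < R t"
proof
  let ?S = "{t. t \<ge> 0 \<and> norm y < R t}"
  have bdd: "bdd_above ?S"
  proof (rule bdd_aboveI)
    fix s assume "s \<in> ?S"
    then have "0 < R s" using norm_ge_zero[of y] by (auto simp del: norm_ge_zero)
    then show "s \<le> T" using R_zero[of s] by (cases "s \<le> T") auto
  qed
  {
    assume "fstar y > t"
    then have ne: "?S \<noteq> {}" and "fstar y = Sup ?S" using t by (auto simp: fstar_def split: if_splits)
    with \<open>fstar y > t\<close> have "t < Sup ?S" by simp
    then obtain s where "s \<in> ?S" "t < s" using less_cSup_iff[OF ne bdd] by auto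
    then show "norm y < R t" using R_antimono[of t s] by auto
  }
  assume "norm y < R t"
  from R_right_cont[OF t this] obtain s where s: "s > t" "norm y < R s" by blast
  then have "s \<le> Sup ?S" using t by (intro cSup_upper bdd) auto
  moreover have "fstar y = Sup ?S" using s t by (auto simp: fstar_def intro!: exI[of _ s])
  ultimately show "fstar y > t" using s by linarith
qed

lemma fstar_nonneg: "fstar y \<ge> 0"
proof (cases "\<exists>t\<ge>0. norm y < R t")
  case True
  then obtain t where t: "t \<ge> 0" "norm y < R t" by blast
  then have "fstar y > t" using fstar_gt_iff[OF t(1)] by simp
  then show ?thesis using t(1) by linarith
next
  case False
  then show ?thesis unfolding fstar_def by (simp only: if_False order_refl)
qed

lemma fstar_meas[measurable]: "fstar \<in> borel_measurable borel"
proof (rule borel_measurableI_greater)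
  fix t
  have "{y. t < fstar y} \<in> sets borel"
  proof (cases "t \<ge> 0")
    case True
    have "{y. t < fstar y} = ball 0 (R t)" unfolding ball_def fstar_gt_iff[OF True] by (simp only: dist_0_norm)
    then show ?thesis by (simp only: borel_open open_ball)
  next
    case False
    have "UNIV = {y. t < fstar y}"
    proof (rule UNIV_eq_I, rule CollectI)
      fix y show "t < fstar y" using fstar_nonneg[of y] False by linarith
    qed
    from this[symmetric] show ?thesis by (simp only: borel_open open_UNIV)
  qed
  then show "{y \<in> space borel. t < fstar y} \<in> sets borel" by (simp only: space_borel UNIV_I simp_thms)
qed

lemma fstar_level:
  assumes t: "t \<ge> 0"
  shows "{y. ennreal t < ennreal (fstar y)} = ball 0 (R t)"
  unfolding ball_def ennreal_less_iff[OF t] fstar_gt_iff[OF t] by (simp only: dist_0_norm)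

lemma fstar_equidistributed:
  assumes "h \<in> borel_measurable borel"
  shows "(\<integral>\<^sup>+x. h (f x) * indicator {x. f x > 0} x \<partial>lborel) = (\<integral>\<^sup>+y. h (fstar y) * indicator {y. fstar y > 0} y \<partial>lborel)"
proof (rule nn_integral_equidistributed)
  fix t :: real assume t: "t \<ge> 0"
  have "{y. fstar y > t} = ball 0 (R t)" unfolding ball_def fstar_gt_iff[OF t] by (simp only: dist_0_norm)
  then show "emeasure lborel {x. f x > t} = emeasure lborel {y. fstar y > t}"
    using level[OF t] R_nonneg by (simp add: emeasure_ball)
qed (use assms level[of 0] in auto)

text \<open>Inverting the rearrangement.  At a jump of \<open>R\<close> the rearrangement is constant on a whole shell, so
  there its value does not determine the norm of the point.\<close>

lemma R_at_fstar:
  assumes "isCont R (fstar y)" "fstar y > 0"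
  shows "R (fstar y) = norm y"
proof (rule antisym)
  show "R (fstar y) \<le> norm y" using fstar_gt_iff[OF fstar_nonneg, of y y] by simp
  have "(R \<longlongrightarrow> R (fstar y)) (at_left (fstar y))"
    using assms(1) by (auto simp: isCont_def intro: tendsto_within_subset)
  moreover have "eventually (\<lambda>s. norm y \<le> R s) (at_left (fstar y))"
    unfolding eventually_at_left_field
    using fstar_gt_iff[of _ y] assms(2) by (intro exI[of _ 0]) (auto intro: less_imp_le)
  ultimately show "norm y \<le> R (fstar y)"
    by (rule tendsto_lowerbound) simp
qed

lemma nn_integral_fstar_powr:
  assumes "a > 0" and [measurable]: "\<psi> \<in> borel_measurable borel"
  shows "(\<integral>\<^sup>+y. ennreal (norm y powr (a - real DIM('a))) * (\<integral>\<^sup>+t. \<psi> t * indicator {t. 0 \<le> t \<and> ennreal t < ennreal (fstar y)} t \<partial>lborel) \<partial>lborel)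
     = (\<integral>\<^sup>+t. \<psi> t * indicator {0..} t * ennreal (real DIM('a) * unit_ball_vol (real DIM('a)) / a * R t powr a) \<partial>lborel)"
proof (subst layer_cake)
  show "(\<integral>\<^sup>+t. \<psi> t * indicator {0..} t * (\<integral>\<^sup>+y. ennreal (norm y powr (a - real DIM('a))) * indicator {y. ennreal t < ennreal (fstar y)} y \<partial>lborel) \<partial>lborel)
     = (\<integral>\<^sup>+t. \<psi> t * indicator {0..} t * ennreal (real DIM('a) * unit_ball_vol (real DIM('a)) / a * R t powr a) \<partial>lborel)"
    by (rule nn_integral_cong) (use assms R_nonneg in \<open>auto simp: fstar_level nn_integral_ball_powr split: split_indicator\<close>)
qed auto

lemma nn_integral_powr_le_profile:
  assumes f0: "\<And>x. f x \<ge> 0" and a: "0 < a" "a \<le> real DIM('a)" and [measurable]: "\<psi> \<in> borel_measurable borel"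
  shows "(\<integral>\<^sup>+x. ennreal (norm x powr (a - real DIM('a))) * (\<integral>\<^sup>+t. \<psi> t * indicator {t. 0 \<le> t \<and> ennreal t < ennreal (f x)} t \<partial>lborel) \<partial>lborel)
     \<le> (\<integral>\<^sup>+t. \<psi> t * indicator {0..} t * ennreal (real DIM('a) * unit_ball_vol (real DIM('a)) / a * R t powr a) \<partial>lborel)"
proof (subst layer_cake)
  have "(\<integral>\<^sup>+x. ennreal (norm x powr (a - real DIM('a))) * indicator {x. ennreal t < ennreal (f x)} x \<partial>lborel)
      \<le> ennreal (real DIM('a) * unit_ball_vol (real DIM('a)) / a * R t powr a)" if "t \<ge> 0" for t
  proof (rule nn_integral_powr_le_ball)
    have "{x. ennreal t < ennreal (f x)} = {x. f x > t}" using that f0 by (auto simp: ennreal_less_iff)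
    then show "{x. ennreal t < ennreal (f x)} \<in> sets borel"
      "emeasure lborel {x. ennreal t < ennreal (f x)} = ennreal (unit_ball_vol (real DIM('a)) * R t ^ DIM('a))"
      using level[OF that] by auto
  qed (use R_nonneg a in auto)
  then show "(\<integral>\<^sup>+t. \<psi> t * indicator {0..} t * (\<integral>\<^sup>+x. ennreal (norm x powr (a - real DIM('a))) * indicator {x. ennreal t < ennreal (f x)} x \<partial>lborel) \<partial>lborel)
     \<le> (\<integral>\<^sup>+t. \<psi> t * indicator {0..} t * ennreal (real DIM('a) * unit_ball_vol (real DIM('a)) / a * R t powr a) \<partial>lborel)"
    by (intro nn_integral_mono) (auto intro!: mult_left_mono split: split_indicator)
qed auto

end

context bounded_profile
begin

text \<open>The Hardy term of the rearrangement, as an integral over levels (see \<open>hardy_energy_fstar\<close>).\<close>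

definition hardy_energy :: ennreal where
  "hardy_energy = (\<integral>\<^sup>+t. ennreal (2 * t) * indicator {0..} t *
     ennreal (real DIM('a) * unit_ball_vol (real DIM('a)) / (real DIM('a) - 2) * R t powr (real DIM('a) - 2)) \<partial>lborel)"

text \<open>For \<open>a = N / p\<close> this is the Lorentz norm up to a constant factor.\<close>

definition lorentz_energy :: "real \<Rightarrow> ennreal" where
  "lorentz_energy a = (\<integral>\<^sup>+t. indicator {0..} t * ennreal (R t powr a) \<partial>lborel)"

text \<open>For an extremal function this is the length of the gradient on the level set \<open>{f = t}\<close>.  It is set to zero at the
  jumps of \<open>R\<close>.  These are countably many levels and do not matter for an integral over \<open>t\<close>, but they can
  be values of \<open>f\<close> on sets of positive volume, where \<open>R\<close> gives no control of the rearrangement.\<close>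

definition weight :: "real \<Rightarrow> real \<Rightarrow> real \<Rightarrow> real" where
  "weight a l t = (if t > 0 \<and> isCont R t \<and> R t > 0
     then (real DIM('a) - 2) / 2 * t / R t + l * R t powr (a - real DIM('a) + 1) else 0)"

lemma weight_meas[measurable]: "weight a l \<in> borel_measurable borel"
proof -
  have [measurable]: "{t. \<not> isCont R t} \<in> sets borel"
    using countable_discont by (rule sets.countable[rotated]) simp
  have [measurable]: "Measurable.pred borel (isCont R)"
  proof -
    have "- {t. \<not> isCont R t} \<in> sets borel" by (rule borel_comp) measurable
    moreover have "- {t. \<not> isCont R t} = {t. isCont R t}" by auto
    ultimately show ?thesis by (simp add: pred_def)
  qed
  show ?thesis unfolding weight_def by measurable
qed

lemma hardy_energy_fstar:
  assumes "DIM('a) \<ge> 3"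
  shows "(\<integral>\<^sup>+y. ennreal (norm y powr (- 2)) * ennreal ((fstar y)\<^sup>2) \<partial>lborel) = hardy_energy"
  using nn_integral_fstar_powr[of "real DIM('a) - 2" "\<lambda>t. ennreal (2 * t)"] assms
  by (simp add: nn_integral_double_below fstar_nonneg hardy_energy_def)

lemma lorentz_energy_fstar:
  assumes a: "a > 0"
  shows "(\<integral>\<^sup>+y. ennreal (norm y powr (a - real DIM('a))) * ennreal (fstar y) \<partial>lborel)
     = ennreal (real DIM('a) * unit_ball_vol (real DIM('a)) / a) * lorentz_energy a"
proof -
  have "(\<integral>\<^sup>+y. ennreal (norm y powr (a - real DIM('a))) * ennreal (fstar y) \<partial>lborel)
      = (\<integral>\<^sup>+t. indicator {0..} t * ennreal (real DIM('a) * unit_ball_vol (real DIM('a)) / a * R t powr a) \<partial>lborel)"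
    using nn_integral_fstar_powr[OF a, of "\<lambda>t. 1"] by (simp add: nn_integral_indicator_below)
  also have "\<dots> = (\<integral>\<^sup>+t. ennreal (real DIM('a) * unit_ball_vol (real DIM('a)) / a) * (indicator {0..} t * ennreal (R t powr a)) \<partial>lborel)"
  proof (rule nn_integral_cong)
    fix t
    have "ennreal (real DIM('a) * unit_ball_vol (real DIM('a)) / a * R t powr a)
        = ennreal (real DIM('a) * unit_ball_vol (real DIM('a)) / a) * ennreal (R t powr a)"
      by (rule ennreal_mult) (use a in auto)
    then show "indicator {0..} t * ennreal (real DIM('a) * unit_ball_vol (real DIM('a)) / a * R t powr a)
      = ennreal (real DIM('a) * unit_ball_vol (real DIM('a)) / a) * (indicator {0..} t * ennreal (R t powr a))"
      by (simp only: mult_ac)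
  qed
  also have "\<dots> = ennreal (real DIM('a) * unit_ball_vol (real DIM('a)) / a) * lorentz_energy a"
    unfolding lorentz_energy_def by (rule nn_integral_cmult) measurable
  finally show ?thesis .
qed

lemma hardy_le_energy:
  assumes "DIM('a) \<ge> 3" "\<And>x. f x \<ge> 0"
  shows "(\<integral>\<^sup>+x. ennreal (norm x powr (- 2)) * ennreal ((f x)\<^sup>2) \<partial>lborel) \<le> hardy_energy"
  using nn_integral_powr_le_profile[of "real DIM('a) - 2" "\<lambda>t. ennreal (2 * t)"] assms
  by (simp add: nn_integral_double_below hardy_energy_def)

text \<open>By equidistribution \<open>f\<close> may be replaced by its rearrangement.  Where the weight of the
  value \<open>fstar y\<close> is nonzero, \<open>R (fstar y) = norm y\<close>, so the weight becomes an explicit function of \<open>norm y\<close> and \<open>fstar y\<close>.\<close>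

lemma weight_square_integral:
  assumes N: "DIM('a) \<ge> 3" and a: "a > (real DIM('a) - 2) / 2" and l: "l \<ge> 0"
    and R0: "\<And>t. t \<ge> 0 \<Longrightarrow> R t \<le> \<rho>" "\<rho> \<ge> 0"
  defines "b \<equiv> (real DIM('a) - 2) / 2"
  defines "K \<equiv> real DIM('a) * unit_ball_vol (real DIM('a))"
  shows "(\<integral>\<^sup>+x. ennreal ((weight a l (f x))\<^sup>2) \<partial>lborel)
     \<le> ennreal (b\<^sup>2) * hardy_energy + ennreal (2 * b * l * K / a) * lorentz_energy a
       + ennreal (l\<^sup>2 * K / (2 * (a - b)) * \<rho> powr (2 * (a - b)))"
proof -
  have b: "b > 0" using N by (simp add: b_def)
  have K: "K > 0" using N by (simp add: K_def)
  have a0: "a > 0" using a b by (simp add: b_def)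
  have [measurable]: "ball (0::'a) \<rho> \<in> sets borel" by simp
  have "(\<integral>\<^sup>+x. ennreal ((weight a l (f x))\<^sup>2) \<partial>lborel) = (\<integral>\<^sup>+x. ennreal ((weight a l (f x))\<^sup>2) * indicator {x. f x > 0} x \<partial>lborel)"
    by (rule nn_integral_cong) (auto simp: weight_def split: split_indicator)
  also have "\<dots> = (\<integral>\<^sup>+y. ennreal ((weight a l (fstar y))\<^sup>2) * indicator {y. fstar y > 0} y \<partial>lborel)"
    by (rule fstar_equidistributed) measurable
  also have "\<dots> \<le> (\<integral>\<^sup>+y. ennreal (b\<^sup>2) * (ennreal (norm y powr (- 2)) * ennreal ((fstar y)\<^sup>2))
      + ennreal (2 * b * l) * (ennreal (norm y powr (a - real DIM('a))) * ennreal (fstar y))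
      + ennreal (l\<^sup>2) * (ennreal (norm y powr (2 * (a - b) - real DIM('a))) * indicator (ball 0 \<rho>) y) \<partial>lborel)"
  proof (rule nn_integral_mono)
    fix y :: 'a
    show "ennreal ((weight a l (fstar y))\<^sup>2) * indicator {y. fstar y > 0} y
       \<le> ennreal (b\<^sup>2) * (ennreal (norm y powr (- 2)) * ennreal ((fstar y)\<^sup>2))
      + ennreal (2 * b * l) * (ennreal (norm y powr (a - real DIM('a))) * ennreal (fstar y))
      + ennreal (l\<^sup>2) * (ennreal (norm y powr (2 * (a - b) - real DIM('a))) * indicator (ball 0 \<rho>) y)"
    proof (cases "fstar y > 0 \<and> isCont R (fstar y) \<and> R (fstar y) > 0")
      case False
      then have "weight a l (fstar y) = 0" unfolding weight_def by (intro if_not_P)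
      then show ?thesis by simp
    next
      case True
      then have Ry: "R (fstar y) = norm y" by (intro R_at_fstar) auto
      then have y: "norm y > 0" using True by simp
      have "norm y < R 0" using fstar_gt_iff[of 0 y] True by simp
      then have yb: "norm y < \<rho>" using R0(1)[of 0] by linarith
      have e1: "norm y powr (a - real DIM('a) + 1) * (fstar y / norm y) = norm y powr (a - real DIM('a)) * fstar y"
        using y by (simp add: powr_add)
      have e2: "(norm y powr (a - real DIM('a) + 1))\<^sup>2 = norm y powr (2 * (a - b) - real DIM('a))"
      proof -
        have "a - real DIM('a) + 1 + (a - real DIM('a) + 1) = 2 * (a - b) - real DIM('a)"
          by (simp add: b_def field_simps)
        then show ?thesis by (simp only: power2_eq_square powr_add[symmetric])
      qed
      have e3: "norm y powr (- 2) * (fstar y)\<^sup>2 = (fstar y / norm y)\<^sup>2"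
        using y by (simp add: powr_minus powr_numeral power_divide field_simps)
      have "(weight a l (fstar y))\<^sup>2 = (b * (fstar y / norm y) + l * norm y powr (a - real DIM('a) + 1))\<^sup>2"
        using True y by (simp add: weight_def Ry b_def)
      also have "\<dots> = b\<^sup>2 * (fstar y / norm y)\<^sup>2 + 2 * b * l * (norm y powr (a - real DIM('a) + 1) * (fstar y / norm y))
          + l\<^sup>2 * (norm y powr (a - real DIM('a) + 1))\<^sup>2"
        by (simp add: power2_sum power_mult_distrib power_divide mult_ac)
      also have "\<dots> = b\<^sup>2 * (norm y powr (- 2) * (fstar y)\<^sup>2) + 2 * b * l * (norm y powr (a - real DIM('a)) * fstar y)
          + l\<^sup>2 * norm y powr (2 * (a - b) - real DIM('a))"
        by (simp only: e1 e2 e3)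
      finally have "ennreal ((weight a l (fstar y))\<^sup>2) = ennreal (b\<^sup>2 * (norm y powr (- 2) * (fstar y)\<^sup>2) + 2 * b * l * (norm y powr (a - real DIM('a)) * fstar y)
          + l\<^sup>2 * norm y powr (2 * (a - b) - real DIM('a)))" by (rule arg_cong)
      also have "\<dots> = ennreal (b\<^sup>2) * (ennreal (norm y powr (- 2)) * ennreal ((fstar y)\<^sup>2))
      + ennreal (2 * b * l) * (ennreal (norm y powr (a - real DIM('a))) * ennreal (fstar y))
      + ennreal (l\<^sup>2) * (ennreal (norm y powr (2 * (a - b) - real DIM('a))) * indicator (ball 0 \<rho>) y)"
        using b l fstar_nonneg[of y] yb by (simp add: ennreal_mult)
      finally show ?thesis by (auto split: split_indicator)
    qed
  qed
  also have "\<dots> = ennreal (b\<^sup>2) * hardy_energy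
      + ennreal (2 * b * l) * (ennreal (K / a) * lorentz_energy a)
      + ennreal (l\<^sup>2) * ennreal (K / (2 * (a - b)) * \<rho> powr (2 * (a - b)))"
  proof -
    have "(\<integral>\<^sup>+y. ennreal (norm (y::'a) powr (2 * (a - b) - real DIM('a))) * indicator (ball 0 \<rho>) y \<partial>lborel)
        = ennreal (K / (2 * (a - b)) * \<rho> powr (2 * (a - b)))"
      unfolding K_def by (rule nn_integral_ball_powr) (use a R0 in \<open>auto simp: b_def\<close>)
    moreover have "(\<integral>\<^sup>+y. ennreal (norm y powr (a - real DIM('a))) * ennreal (fstar y) \<partial>lborel) = ennreal (K / a) * lorentz_energy a"
      unfolding K_def by (rule lorentz_energy_fstar[OF a0])
    moreover note hardy_energy_fstar[OF N]
    ultimately show ?thesis by (simp add: nn_integral_add nn_integral_cmult)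
  qed
  also have "ennreal (2 * b * l) * (ennreal (K / a) * lorentz_energy a) = ennreal (2 * b * l * K / a) * lorentz_energy a"
    using b l K a0 by (simp add: ennreal_mult[symmetric] mult.assoc[symmetric])
  also have "ennreal (l\<^sup>2) * ennreal (K / (2 * (a - b)) * \<rho> powr (2 * (a - b))) = ennreal (l\<^sup>2 * K / (2 * (a - b)) * \<rho> powr (2 * (a - b)))"
    using a K by (subst ennreal_mult[symmetric]) (auto simp: b_def)
  finally show ?thesis .
qed

lemma weight_surface_integral:
  assumes N: "DIM('a) \<ge> 3" and l: "l \<ge> 0"
  defines "b \<equiv> (real DIM('a) - 2) / 2"
  defines "K \<equiv> real DIM('a) * unit_ball_vol (real DIM('a))"
  shows "(\<integral>\<^sup>+t. ennreal (weight a l t) * (ennreal (K * R t ^ (DIM('a) - 1)) * indicator {0..} t) \<partial>lborel)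
     = ennreal (b\<^sup>2) * hardy_energy + ennreal (l * K) * lorentz_energy a"
proof -
  have b: "b > 0" using N by (simp add: b_def)
  have K: "K > 0" using N by (simp add: K_def)
  have "(\<integral>\<^sup>+t. ennreal (weight a l t) * (ennreal (K * R t ^ (DIM('a) - 1)) * indicator {0..} t) \<partial>lborel)
     = (\<integral>\<^sup>+t. ennreal (b\<^sup>2) * (ennreal (2 * t) * indicator {0..} t * ennreal (K / (real DIM('a) - 2) * R t powr (real DIM('a) - 2)))
         + ennreal (l * K) * (indicator {0..} t * ennreal (R t powr a)) \<partial>lborel)"
  proof (rule nn_integral_cong_AE)
    have "AE t in lborel. t \<notin> {t. \<not> isCont R t}"
      using countable_discont by (intro AE_not_in) (simp add: countable_imp_null_set_lborel)
    moreover have "AE t in lborel. t \<noteq> (0::real)" by (rule AE_lborel_singleton)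
    ultimately show "AE t in lborel. ennreal (weight a l t) * (ennreal (K * R t ^ (DIM('a) - 1)) * indicator {0..} t)
       = ennreal (b\<^sup>2) * (ennreal (2 * t) * indicator {0..} t * ennreal (K / (real DIM('a) - 2) * R t powr (real DIM('a) - 2)))
         + ennreal (l * K) * (indicator {0..} t * ennreal (R t powr a))"
    proof eventually_elim
      case (elim t)
      show ?case
      proof (cases "t > 0 \<and> R t > 0")
        case False
        then have "t < 0 \<or> (t > 0 \<and> R t = 0)" using elim R_nonneg[of t] by auto
        then show ?thesis using N by (auto simp: weight_def)
      next
        case True
        then have t: "t > 0" and r: "R t > 0" by auto
        have p1: "R t ^ (DIM('a) - 1) / R t = R t powr (real DIM('a) - 2)"
          using r N by (simp add: powr_realpow[symmetric] powr_diff[symmetric] of_nat_diff)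
           (simp add: powr_diff field_simps power2_eq_square powr_numeral)
        have p2: "R t powr (a - real DIM('a) + 1) * R t ^ (DIM('a) - 1) = R t powr a"
          using r N by (simp add: powr_realpow[symmetric] powr_add[symmetric] of_nat_diff)
        have "weight a l t = b * (t / R t) + l * R t powr (a - real DIM('a) + 1)"
          using elim t r by (simp add: weight_def b_def)
        then have "weight a l t * (K * R t ^ (DIM('a) - 1))
            = b * t * K * (R t ^ (DIM('a) - 1) / R t) + l * K * (R t powr (a - real DIM('a) + 1) * R t ^ (DIM('a) - 1))"
          by (simp add: algebra_simps)
        also have "\<dots> = b\<^sup>2 * ((2 * t) * (K / (real DIM('a) - 2) * R t powr (real DIM('a) - 2))) + l * K * R t powr a"
          unfolding p1 p2 using N by (simp add: b_def field_simps power2_eq_square)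
        finally have e: "weight a l t * (K * R t ^ (DIM('a) - 1))
            = b\<^sup>2 * ((2 * t) * (K / (real DIM('a) - 2) * R t powr (real DIM('a) - 2))) + l * K * R t powr a" .
        have w0: "weight a l t \<ge> 0" using t r l N by (simp add: weight_def)
        have "ennreal (weight a l t) * (ennreal (K * R t ^ (DIM('a) - 1)) * indicator {0..} t)
            = ennreal (weight a l t * (K * R t ^ (DIM('a) - 1)))"
          using t w0 K r by (simp add: ennreal_mult)
        also have "\<dots> = ennreal (b\<^sup>2) * (ennreal (2 * t) * ennreal (K / (real DIM('a) - 2) * R t powr (real DIM('a) - 2)))
            + ennreal (l * K) * ennreal (R t powr a)"
          unfolding e using t K l N by (simp add: ennreal_mult del: times_divide_eq_left)
        finally show ?thesis using t by simp
      qed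
    qed
  qed
  also have "\<dots> = ennreal (b\<^sup>2) * hardy_energy + ennreal (l * K) * lorentz_energy a"
    unfolding hardy_energy_def lorentz_energy_def K_def
    by (subst nn_integral_add) (simp_all add: nn_integral_cmult)
  finally show ?thesis .
qed

lemma energies_finite:
  assumes R0: "\<And>t. t \<ge> 0 \<Longrightarrow> R t \<le> \<rho>" "\<rho> \<ge> 0" and N: "DIM('a) \<ge> 3" and a: "a > 0"
  shows "hardy_energy < \<infinity>" "lorentz_energy a < \<infinity>"
proof -
  have box: "(\<integral>\<^sup>+t. ennreal c * indicator {0..T} t \<partial>lborel) < \<infinity>" for c
    by (subst nn_integral_cmult_indicator) (auto simp: ennreal_mult_less_top emeasure_lborel_Icc_eq)
  let ?k = "real DIM('a) * unit_ball_vol (real DIM('a)) / (real DIM('a) - 2)"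
  have k: "?k \<ge> 0" using N by simp
  have "hardy_energy \<le> (\<integral>\<^sup>+t. ennreal ((2 * T) * (?k * \<rho> powr (real DIM('a) - 2))) * indicator {0..T} t \<partial>lborel)"
    unfolding hardy_energy_def
  proof (rule nn_integral_mono)
    fix t :: real
    show "ennreal (2 * t) * indicator {0..} t * ennreal (?k * R t powr (real DIM('a) - 2))
      \<le> ennreal ((2 * T) * (?k * \<rho> powr (real DIM('a) - 2))) * indicator {0..T} t"
    proof (cases "0 \<le> t \<and> t \<le> T")
      case True
      then have "(2 * t) * (?k * R t powr (real DIM('a) - 2)) \<le> (2 * T) * (?k * \<rho> powr (real DIM('a) - 2))"
        using k R_nonneg R0 N by (intro mult_mono powr_mono2 mult_left_mono mult_nonneg_nonneg) auto
      then show ?thesis using True k by (simp add: ennreal_mult'[symmetric] ennreal_leI del: times_divide_eq_left)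
    next
      case False
      then show ?thesis using R_zero[of t] N by (auto simp: not_le)
    qed
  qed
  then show "hardy_energy < \<infinity>" using box by (rule le_less_trans)
  have "lorentz_energy a \<le> (\<integral>\<^sup>+t. ennreal (\<rho> powr a) * indicator {0..T} t \<partial>lborel)"
    unfolding lorentz_energy_def
  proof (rule nn_integral_mono)
    fix t :: real
    show "indicator {0..} t * ennreal (R t powr a) \<le> ennreal (\<rho> powr a) * indicator {0..T} t"
    proof (cases "0 \<le> t \<and> t \<le> T")
      case True
      then have "R t powr a \<le> \<rho> powr a" using R_nonneg R0 a by (intro powr_mono2) auto
      then show ?thesis using True by (simp add: ennreal_leI)
    next
      case False
      then show ?thesis using R_zero[of t] by (auto simp: not_le)
    qed
  qed
  then show "lorentz_energy a < \<infinity>" using box by (rule le_less_trans)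
qed

text \<open>By \<open>weight_surface_integral\<close> the Hardy term enters the lower bound with factor
  \<open>2 * b\<^sup>2\<close>, and by \<open>weight_square_integral\<close> it is subtracted with factor \<open>b\<^sup>2\<close>, which leaves the Hardy inequality with its sharp
  constant.  The remaining terms are \<open>2 * l * K * I * (a - b) / a - l\<^sup>2 * K * q / (2 * (a - b))\<close>,
  where \<open>I\<close> is the Lorentz energy and \<open>q = \<rho> powr (2 * (a - b))\<close>.\<close>

lemma improved_hardy_profile:
  fixes G :: "'a \<Rightarrow> real"
  assumes N: "DIM('a) \<ge> 3" and a: "a > (real DIM('a) - 2) / 2"
    and R0: "\<And>t. t \<ge> 0 \<Longrightarrow> R t \<le> \<rho>" "\<rho> > 0"
    and G[measurable]: "G \<in> borel_measurable borel" and G0: "\<And>x. G x \<ge> 0"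
    and coarea: "\<And>h. h \<in> borel_measurable borel \<Longrightarrow>
       (\<integral>\<^sup>+t. h t * (ennreal (real DIM('a) * unit_ball_vol (real DIM('a)) * R t ^ (DIM('a) - 1)) * indicator {0..} t) \<partial>lborel)
     \<le> (\<integral>\<^sup>+x. h (f x) * ennreal (G x) \<partial>lborel)"
  defines "b \<equiv> (real DIM('a) - 2) / 2"
  defines "K \<equiv> real DIM('a) * unit_ball_vol (real DIM('a))"
  shows "ennreal (b\<^sup>2) * hardy_energy + ennreal (2 * (a - b) ^ 3 * K / (a\<^sup>2 * \<rho> powr (2 * (a - b)))) * (lorentz_energy a)\<^sup>2
     \<le> (\<integral>\<^sup>+x. ennreal ((G x)\<^sup>2) \<partial>lborel)"
proof (cases "(\<integral>\<^sup>+x. ennreal ((G x)\<^sup>2) \<partial>lborel) = \<infinity>")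
  case True
  then show ?thesis by simp
next
  case False
  then obtain g where g: "g \<ge> 0" "(\<integral>\<^sup>+x. ennreal ((G x)\<^sup>2) \<partial>lborel) = ennreal g"
    by (metis ennreal_cases infinity_ennreal_def)
  have b: "b > 0" using N by (simp add: b_def)
  have K: "K > 0" using N by (simp add: K_def)
  have a0: "a > 0" and ab: "a - b > 0" using a b by (auto simp: b_def)
  obtain H where H: "H \<ge> 0" "hardy_energy = ennreal H"
    using energies_finite(1)[OF R0(1) _ N a0] R0(2) by (metis ennreal_cases less_imp_le less_irrefl infinity_ennreal_def)
  obtain I where I: "I \<ge> 0" "lorentz_energy a = ennreal I"
    using energies_finite(2)[OF R0(1) _ N a0] R0(2) by (metis ennreal_cases less_imp_le less_irrefl infinity_ennreal_def)
  define q where "q = \<rho> powr (2 * (a - b))"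
  have q: "q > 0" using R0(2) by (simp add: q_def)
  \<comment> \<open>The maximizer of the quadratic polynomial in \<open>l\<close>.\<close>
  define l where "l = 2 * (a - b)\<^sup>2 * I / (a * q)"
  have l: "l \<ge> 0" using I a0 q by (simp add: l_def)
  have wn: "weight a l t \<ge> 0" for t
    using N l R_nonneg[of t] by (simp add: weight_def)
  have "2 * (ennreal (b\<^sup>2) * hardy_energy + ennreal (l * K) * lorentz_energy a)
      \<le> 2 * (\<integral>\<^sup>+x. ennreal (weight a l (f x)) * ennreal (G x) \<partial>lborel)"
    using coarea[of "\<lambda>t. ennreal (weight a l t)"] weight_surface_integral[OF N l, of a]
    by (intro mult_left_mono) (auto simp: b_def K_def)
  also have "\<dots> = (\<integral>\<^sup>+x. 2 * (ennreal (weight a l (f x)) * ennreal (G x)) \<partial>lborel)"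
    by (rule nn_integral_cmult[symmetric]) measurable
  also have "\<dots> \<le> (\<integral>\<^sup>+x. ennreal ((G x)\<^sup>2) + ennreal ((weight a l (f x))\<^sup>2) \<partial>lborel)"
  proof (rule nn_integral_mono)
    fix x
    have "0 \<le> (G x - weight a l (f x))\<^sup>2" by simp
    then have "2 * (weight a l (f x) * G x) \<le> (G x)\<^sup>2 + (weight a l (f x))\<^sup>2"
      by (simp add: power2_diff mult_ac)
    then have "ennreal (2 * (weight a l (f x) * G x)) \<le> ennreal ((G x)\<^sup>2 + (weight a l (f x))\<^sup>2)"
      by (rule ennreal_leI)
    then show "2 * (ennreal (weight a l (f x)) * ennreal (G x)) \<le> ennreal ((G x)\<^sup>2) + ennreal ((weight a l (f x))\<^sup>2)"
      using wn[of "f x"] G0[of x] by (simp add: ennreal_mult)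
  qed
  also have "\<dots> = ennreal g + (\<integral>\<^sup>+x. ennreal ((weight a l (f x))\<^sup>2) \<partial>lborel)"
    using g(2) by (subst nn_integral_add) auto
  also have "\<dots> \<le> ennreal g + (ennreal (b\<^sup>2) * hardy_energy + ennreal (2 * b * l * K / a) * lorentz_energy a
       + ennreal (l\<^sup>2 * K / (2 * (a - b)) * \<rho> powr (2 * (a - b))))"
    unfolding b_def K_def using weight_square_integral[OF N a l R0(1)] R0(2) by (intro add_left_mono) simp
  finally have "ennreal (2 * (b\<^sup>2 * H + l * K * I)) \<le> ennreal (g + (b\<^sup>2 * H + 2 * b * l * K / a * I + l\<^sup>2 * K / (2 * (a - b)) * q))"
  proof -
    have nn: "0 \<le> b\<^sup>2 * H" "0 \<le> l * K * I" "0 \<le> 2 * b * l * K / a * I" "0 \<le> l\<^sup>2 * K / (2 * (a - b)) * q"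
      "0 \<le> l * K" "0 \<le> 2 * b * l * K / a"
      using H I l K a0 ab b q by auto
    have "ennreal (b\<^sup>2) * ennreal H = ennreal (b\<^sup>2 * H)" "ennreal (l * K) * ennreal I = ennreal (l * K * I)"
      "ennreal (2 * b * l * K / a) * ennreal I = ennreal (2 * b * l * K / a * I)"
      by (rule ennreal_mult[symmetric]; use H I nn in simp)+
    moreover have "2 * ennreal x = ennreal (2 * x)" if "x \<ge> 0" for x using that by (simp add: ennreal_mult)
    ultimately show "2 * (ennreal (b\<^sup>2) * hardy_energy + ennreal (l * K) * lorentz_energy a)
        \<le> ennreal g + (ennreal (b\<^sup>2) * hardy_energy + ennreal (2 * b * l * K / a) * lorentz_energy a
       + ennreal (l\<^sup>2 * K / (2 * (a - b)) * \<rho> powr (2 * (a - b))))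
       \<Longrightarrow> ennreal (2 * (b\<^sup>2 * H + l * K * I)) \<le> ennreal (g + (b\<^sup>2 * H + 2 * b * l * K / a * I + l\<^sup>2 * K / (2 * (a - b)) * q))"
      unfolding q_def[symmetric] H(2) I(2) using nn g(1)
      by (simp only: ennreal_plus[symmetric] add_nonneg_nonneg)
  qed
  then have main: "2 * (b\<^sup>2 * H + l * K * I) \<le> g + (b\<^sup>2 * H + 2 * b * l * K / a * I + l\<^sup>2 * K / (2 * (a - b)) * q)"
    using H I g l K a0 ab b q by (subst (asm) ennreal_le_iff) (auto intro!: add_nonneg_nonneg mult_nonneg_nonneg divide_nonneg_nonneg)
  have "2 * l * K * I - 2 * b * l * K / a * I - l\<^sup>2 * K / (2 * (a - b)) * q = 2 * (a - b) ^ 3 * K / (a\<^sup>2 * q) * I\<^sup>2"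
  proof -
    define d where "d = a - b"
    have d: "d > 0" using ab by (simp add: d_def)
    have "2 * l * K * I - 2 * b * l * K / a * I = 2 * l * K * I * d / a"
      using a0 by (simp add: d_def field_simps)
    also have "\<dots> = 4 * d ^ 3 * K * I\<^sup>2 / (a\<^sup>2 * q)"
      unfolding l_def d_def[symmetric] by (simp add: power2_eq_square power3_eq_cube mult_ac)
    finally have 1: "2 * l * K * I - 2 * b * l * K / a * I = 4 * d ^ 3 * K * I\<^sup>2 / (a\<^sup>2 * q)" .
    have "l\<^sup>2 * K / (2 * d) * q = 2 * d ^ 3 * K * I\<^sup>2 / (a\<^sup>2 * q)"
      unfolding l_def d_def[symmetric] using a0 d q by (simp add: power2_eq_square power3_eq_cube field_simps)
    with 1 show ?thesis unfolding d_def[symmetric] by (simp add: field_simps)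
  qed
  then have "b\<^sup>2 * H + 2 * (a - b) ^ 3 * K / (a\<^sup>2 * q) * I\<^sup>2 \<le> g"
    using main by (simp add: algebra_simps)
  then have "ennreal (b\<^sup>2 * H + 2 * (a - b) ^ 3 * K / (a\<^sup>2 * q) * I\<^sup>2) \<le> ennreal g" by (rule ennreal_leI)
  then show ?thesis
    unfolding g(2) H(2) I(2) q_def[symmetric] using H I K a0 ab q
    by (simp add: ennreal_mult ennreal_power del: times_divide_eq_left)
qed

end

section \<open>Test functions and radii of level sets\<close>

lemma test_function_differentiable:
  assumes "\<phi> \<in> test_functions \<Omega>"
  shows "(\<phi> has_derivative (\<lambda>h. gradient \<phi> x \<bullet> h)) (at x)"
proof -
  have "Ck (Suc 0) \<phi>" using assms by (auto simp: test_functions_def)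
  then have "\<phi> differentiable (at x)" by simp
  then have d: "(\<phi> has_derivative frechet_derivative \<phi> (at x)) (at x)"
    by (simp add: frechet_derivative_works)
  interpret linear "frechet_derivative \<phi> (at x)" using has_derivative_linear[OF d] .
  have "frechet_derivative \<phi> (at x) h = gradient \<phi> x \<bullet> h" for h
  proof -
    have "frechet_derivative \<phi> (at x) h = frechet_derivative \<phi> (at x) (\<Sum>b\<in>Basis. (h \<bullet> b) *\<^sub>R b)"
      by (simp add: euclidean_representation)
    also have "\<dots> = (\<Sum>b\<in>Basis. (h \<bullet> b) * frechet_derivative \<phi> (at x) b)"
      by (simp add: sum scale)
    also have "\<dots> = gradient \<phi> x \<bullet> h"
      unfolding gradient_def inner_sum_left inner_scaleR_left by (simp add: inner_commute mult.commute)
    finally show ?thesis .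
  qed
  then have "frechet_derivative \<phi> (at x) = (\<lambda>h. gradient \<phi> x \<bullet> h)" by (rule ext)
  from d[unfolded this] show ?thesis .
qed

lemma test_function_continuous:
  assumes "\<phi> \<in> test_functions \<Omega>"
  shows "continuous_on UNIV \<phi>"
  using has_derivative_continuous[OF test_function_differentiable[OF assms]]
  by (intro continuous_at_imp_continuous_on) simp

lemma continuous_gradient:
  assumes "\<phi> \<in> test_functions \<Omega>"
  shows "continuous_on UNIV (gradient \<phi>)"
proof -
  have "Ck (Suc 0) \<phi>" using assms by (auto simp: test_functions_def)
  then have "continuous_on UNIV (\<lambda>x. frechet_derivative \<phi> (at x) v)" for v by simp
  then show ?thesis unfolding gradient_def by (intro continuous_intros)
qed

lemma gradient_outside_support:
  assumes "x \<notin> closure {x. \<phi> x \<noteq> 0}"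
  shows "\<phi> x = 0" "gradient \<phi> x = 0"
proof -
  have x: "x \<in> - closure {x. \<phi> x \<noteq> 0}" using assms by simp
  have z: "\<phi> y = 0" if "y \<in> - closure {x. \<phi> x \<noteq> 0}" for y
  proof (rule ccontr)
    assume "\<phi> y \<noteq> 0"
    then have "y \<in> closure {x. \<phi> x \<noteq> 0}" by (intro subsetD[OF closure_subset] CollectI)
    with that show False by simp
  qed
  from z[OF x] show "\<phi> x = 0" .
  have "(\<phi> has_derivative (\<lambda>_. 0)) (at x)"
  proof (rule has_derivative_transform_within_open)
    show "((\<lambda>_. 0::real) has_derivative (\<lambda>_. 0)) (at x)" by simp
    show "open (- closure {x. \<phi> x \<noteq> 0})" by (intro open_Compl closed_closure)
    show "0 = \<phi> y" if "y \<in> - closure {x. \<phi> x \<noteq> 0}" for y using z[OF that] by (rule sym)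
  qed (rule x)
  then have "frechet_derivative \<phi> (at x) = (\<lambda>_. 0)" by (rule frechet_derivative_at[symmetric])
  then show "gradient \<phi> x = 0" by (simp add: gradient_def)
qed

lemma test_function_support_ball:
  assumes "\<phi> \<in> test_functions \<Omega>"
  obtains M where "M > 0" "\<And>x. norm x \<ge> M \<Longrightarrow> \<phi> x = 0" "\<And>x. norm x \<ge> M \<Longrightarrow> gradient \<phi> x = 0"
proof -
  have "compact (closure {x. \<phi> x \<noteq> 0})" using assms unfolding test_functions_def by (elim CollectE conjE)
  from compact_imp_bounded[OF this, unfolded bounded_pos_less]
  obtain M where M: "M > 0" "\<forall>x\<in>closure {x. \<phi> x \<noteq> 0}. norm x < M" by (elim exE conjE)
  have out: "x \<notin> closure {x. \<phi> x \<noteq> 0}" if "norm x \<ge> M" for x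
  proof
    assume "x \<in> closure {x. \<phi> x \<noteq> 0}"
    then have "norm x < M" using M(2) by (rule bspec[rotated])
    with that show False by linarith
  qed
  show ?thesis
    by (rule that[OF M(1)]) (rule gradient_outside_support[OF out], assumption)+
qed

lemma norm_gradient_bounded:
  assumes "\<phi> \<in> test_functions \<Omega>"
  obtains L where "\<And>x. norm (gradient \<phi> x) \<le> L"
proof -
  obtain M where M: "M > 0" "\<And>x. norm x \<ge> M \<Longrightarrow> gradient \<phi> x = 0"
    by (rule test_function_support_ball[OF assms]) blast
  have "compact (gradient \<phi> ` cball 0 M)"
    using continuous_gradient[OF assms] by (intro compact_continuous_image) (auto intro: continuous_on_subset)
  from compact_imp_bounded[OF this, unfolded bounded_pos]
  obtain L where L: "L > 0" "\<forall>y\<in>gradient \<phi> ` cball 0 M. norm y \<le> L" by (elim exE conjE)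
  have "norm (gradient \<phi> x) \<le> L" for x
  proof (cases "norm x \<le> M")
    case True then show ?thesis using bspec[OF L(2), of "gradient \<phi> x"] by simp
  next
    case False then show ?thesis using M(2)[of x] L(1) by auto
  qed
  then show ?thesis by (rule that)
qed

lemma test_function_bounded:
  assumes "\<phi> \<in> test_functions \<Omega>"
  obtains B where "B > 0" "\<And>x. \<bar>\<phi> x\<bar> \<le> B"
proof -
  obtain M where M: "M > 0" "\<And>x. norm x \<ge> M \<Longrightarrow> \<phi> x = 0"
    by (rule test_function_support_ball[OF assms]) blast
  have "compact (\<phi> ` cball 0 M)"
    using test_function_continuous[OF assms] by (intro compact_continuous_image) (auto intro: continuous_on_subset)
  from compact_imp_bounded[OF this, unfolded bounded_pos]
  obtain L where L: "L > 0" "\<forall>y\<in>\<phi> ` cball 0 M. norm y \<le> L" by (elim exE conjE)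
  have "\<bar>\<phi> x\<bar> \<le> L" for x
  proof (cases "norm x \<le> M")
    case True then show ?thesis using bspec[OF L(2), of "\<phi> x"] by simp
  next
    case False then show ?thesis using M(2)[of x] L(1) by auto
  qed
  with L(1) show ?thesis by (rule that)
qed

text \<open>The mean value inequality with the uniform continuity of the gradient; this is the slope condition
  of \<open>coarea_inequality\<close> for the modulus of \<open>\<phi>\<close>.\<close>

lemma test_function_slope:
  assumes \<phi>: "\<phi> \<in> test_functions \<Omega>" and "\<delta> > 0"
  shows "\<exists>\<epsilon>>0. \<forall>x y. dist y x < \<epsilon> \<longrightarrow> \<bar>\<bar>\<phi> y\<bar> - \<bar>\<phi> x\<bar>\<bar> \<le> (norm (gradient \<phi> x) + \<delta>) * dist y x"
proof -
  obtain M where M: "M > 0" "\<And>x. norm x \<ge> M \<Longrightarrow> gradient \<phi> x = 0"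
    by (rule test_function_support_ball[OF \<phi>]) blast
  have "uniformly_continuous_on (cball 0 (M + 1)) (gradient \<phi>)"
    using continuous_gradient[OF \<phi>] by (intro compact_uniformly_continuous) (auto intro: continuous_on_subset)
  then obtain \<epsilon>1 where \<epsilon>1: "\<epsilon>1 > 0"
    "\<And>x y. x \<in> cball 0 (M + 1) \<Longrightarrow> y \<in> cball 0 (M + 1) \<Longrightarrow> dist y x < \<epsilon>1 \<Longrightarrow> dist (gradient \<phi> y) (gradient \<phi> x) < \<delta>"
    unfolding uniformly_continuous_on_def using \<open>\<delta> > 0\<close> by blast
  define \<epsilon> where "\<epsilon> = min 1 \<epsilon>1"
  have \<epsilon>: "\<epsilon> > 0" "\<epsilon> \<le> 1" "\<epsilon> \<le> \<epsilon>1" using \<epsilon>1 by (auto simp: \<epsilon>_def)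
  have near: "norm (gradient \<phi> z) \<le> norm (gradient \<phi> x) + \<delta>" if "dist z x < \<epsilon>" for x z
  proof (cases "norm x \<le> M + 1 \<and> norm z \<le> M + 1")
    case True
    then have "dist (gradient \<phi> z) (gradient \<phi> x) < \<delta>" using that \<epsilon> by (intro \<epsilon>1(2)) auto
    then show ?thesis using norm_triangle_ineq2[of "gradient \<phi> z" "gradient \<phi> x"] by (simp add: dist_norm)
  next
    case False
    then have "norm z \<ge> M"
      using that \<epsilon> norm_triangle_ineq2[of x z] by (auto simp: dist_norm norm_minus_commute)
    then show ?thesis using M(2) \<open>\<delta> > 0\<close> by simp
  qed
  have "\<bar>\<bar>\<phi> y\<bar> - \<bar>\<phi> x\<bar>\<bar> \<le> (norm (gradient \<phi> x) + \<delta>) * dist y x" if "dist y x < \<epsilon>" for x y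
  proof -
    have "norm (\<phi> y - \<phi> x) \<le> (norm (gradient \<phi> x) + \<delta>) * norm (y - x)"
    proof (rule differentiable_bound[where S = "ball x \<epsilon>" and f' = "\<lambda>z h. gradient \<phi> z \<bullet> h"])
      fix z assume z: "z \<in> ball x \<epsilon>"
      show "(\<phi> has_derivative (\<lambda>h. gradient \<phi> z \<bullet> h)) (at z within ball x \<epsilon>)"
        using test_function_differentiable[OF \<phi>] by (rule has_derivative_at_withinI)
      have "onorm (\<lambda>h. gradient \<phi> z \<bullet> h) \<le> norm (gradient \<phi> z)"
        by (rule onorm_le) (simp add: Cauchy_Schwarz_ineq2)
      also have "\<dots> \<le> norm (gradient \<phi> x) + \<delta>" using z by (intro near) (simp add: dist_commute)
      finally show "onorm (\<lambda>h. gradient \<phi> z \<bullet> h) \<le> norm (gradient \<phi> x) + \<delta>" .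
    qed (use that \<epsilon> in \<open>auto simp: dist_commute\<close>)
    moreover have "\<bar>\<bar>\<phi> y\<bar> - \<bar>\<phi> x\<bar>\<bar> \<le> norm (\<phi> y - \<phi> x)" by simp
    ultimately show ?thesis by (simp add: dist_norm)
  qed
  then show ?thesis using \<epsilon>(1) by blast
qed

definition level_radius :: "'a::euclidean_space set \<Rightarrow> ('a \<Rightarrow> real) \<Rightarrow> real \<Rightarrow> real" where
  "level_radius \<Omega> u t = root DIM('a) (measure lebesgue {x \<in> \<Omega>. \<bar>u x\<bar> > t} / unit_ball_vol (real DIM('a)))"

lemma level_radius_nonneg: "level_radius \<Omega> u t \<ge> 0"
  unfolding level_radius_def by (intro real_root_ge_zero divide_nonneg_nonneg) auto

lemma level_set_measurable:
  fixes \<Omega> :: "'a::euclidean_space set" and u :: "'a \<Rightarrow> real"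
  assumes \<Omega>: "\<Omega> \<in> lmeasurable" and u: "u \<in> borel_measurable (lebesgue_on \<Omega>)"
  shows "{x \<in> \<Omega>. \<bar>u x\<bar> > t} \<in> lmeasurable"
proof (rule fmeasurableI2[OF \<Omega>])
  have "(\<lambda>x. \<bar>u x\<bar>) \<in> borel_measurable (lebesgue_on \<Omega>)" using u by measurable
  then have "{x \<in> space (lebesgue_on \<Omega>). t < \<bar>u x\<bar>} \<in> sets (lebesgue_on \<Omega>)"
    by (rule borel_measurable_less[OF borel_measurable_const])
  then show "{x \<in> \<Omega>. \<bar>u x\<bar> > t} \<in> sets lebesgue"
    using \<Omega> by (simp add: space_restrict_space sets_restrict_space_iff fmeasurableD)
qed auto

lemma measure_level_set:
  fixes \<Omega> :: "'a::euclidean_space set"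
  shows "measure lebesgue {x \<in> \<Omega>. \<bar>u x\<bar> > t} = unit_ball_vol (real DIM('a)) * level_radius \<Omega> u t ^ DIM('a)"
  using less_imp_neq[OF unit_ball_vol_pos[of "real DIM('a)"]] by (simp add: level_radius_def)

lemma emeasure_level_set:
  fixes \<Omega> :: "'a::euclidean_space set"
  assumes "\<Omega> \<in> lmeasurable" "u \<in> borel_measurable (lebesgue_on \<Omega>)"
  shows "emeasure lebesgue {x \<in> \<Omega>. \<bar>u x\<bar> > t} = ennreal (unit_ball_vol (real DIM('a)) * level_radius \<Omega> u t ^ DIM('a))"
proof -
  have "emeasure lebesgue {x \<in> \<Omega>. \<bar>u x\<bar> > t} = ennreal (measure lebesgue {x \<in> \<Omega>. \<bar>u x\<bar> > t})"
    using level_set_measurable[OF assms] by (intro emeasure_eq_measure2) (auto simp: fmeasurableD)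
  then show ?thesis by (simp add: measure_level_set)
qed

lemma level_radius_antimono:
  fixes \<Omega> :: "'a::euclidean_space set"
  assumes "\<Omega> \<in> lmeasurable" "u \<in> borel_measurable (lebesgue_on \<Omega>)" "s \<le> t"
  shows "level_radius \<Omega> u t \<le> level_radius \<Omega> u s"
proof -
  have "measure lebesgue {x \<in> \<Omega>. \<bar>u x\<bar> > t} \<le> measure lebesgue {x \<in> \<Omega>. \<bar>u x\<bar> > s}"
    using assms(3) level_set_measurable[OF assms(1,2)]
    by (intro measure_mono_fmeasurable) (auto simp: fmeasurableD)
  then show ?thesis unfolding level_radius_def by (intro real_root_le_mono divide_right_mono) auto
qed

definition sharp_radius :: "'a::euclidean_space set \<Rightarrow> real" where
  "sharp_radius \<Omega> = (measure lebesgue \<Omega> / unit_ball_vol (real DIM('a))) powr (1 / real DIM('a))"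

lemma sharp_set_eq: "sharp_set \<Omega> = ball 0 (sharp_radius \<Omega>)"
  by (simp add: sharp_set_def sharp_radius_def)

lemma level_radius_le:
  fixes \<Omega> :: "'a::euclidean_space set"
  assumes "\<Omega> \<in> lmeasurable" "u \<in> borel_measurable (lebesgue_on \<Omega>)"
  shows "level_radius \<Omega> u t \<le> sharp_radius \<Omega>"
proof -
  have "measure lebesgue {x \<in> \<Omega>. \<bar>u x\<bar> > t} \<le> measure lebesgue \<Omega>"
    using assms level_set_measurable[OF assms] by (intro measure_mono_fmeasurable) (auto simp: fmeasurableD)
  then have "level_radius \<Omega> u t \<le> root DIM('a) (measure lebesgue \<Omega> / unit_ball_vol (real DIM('a)))"
    unfolding level_radius_def by (intro real_root_le_mono divide_right_mono) auto
  then show ?thesis by (simp add: sharp_radius_def root_powr_inverse)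
qed

lemma borel_measurable_level_radius:
  fixes \<Omega> :: "'a::euclidean_space set"
  assumes "\<Omega> \<in> lmeasurable" "u \<in> borel_measurable (lebesgue_on \<Omega>)"
  shows "level_radius \<Omega> u \<in> borel_measurable borel"
proof -
  have "(\<lambda>t. - level_radius \<Omega> u t) \<in> borel_measurable borel"
    by (rule borel_measurable_mono) (auto simp: mono_def level_radius_antimono[OF assms])
  then show ?thesis by (simp only: borel_measurable_uminus_eq)
qed

section \<open>The Lorentz norm as an integral over levels\<close>

lemma ennreal_powr_one: "ennreal_powr a 1 = a"
  by (cases a) (auto simp: ennreal_powr_def)

lemma superlevel_rearrangement:
  fixes \<Omega> :: "'a::euclidean_space set"
  assumes V: "is_rearrangement \<Omega> u V" and x: "x \<in> sharp_set \<Omega>" "c < V x" and y: "y \<in> sharp_set \<Omega>" "norm y \<le> norm x"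
  shows "c < V y"
proof -
  have "V x \<le> V y" using V x y unfolding is_rearrangement_def by auto
  with x(2) show ?thesis by (rule less_le_trans)
qed

text \<open>Superlevel sets of a rearrangement are the points of the ball whose norm lies in some down-closed
  set of reals.\<close>

lemma borel_measurable_rearrangement:
  fixes \<Omega> :: "'a::euclidean_space set"
  assumes V: "is_rearrangement \<Omega> u V"
  shows "(\<lambda>x. V x * indicator (sharp_set \<Omega>) x) \<in> borel_measurable borel"
proof (rule borel_measurableI_greater)
  fix c :: ennreal
  define J where "J = {r. \<exists>y\<in>sharp_set \<Omega>. c < V y \<and> r \<le> norm y}"
  have "(\<lambda>r. if r \<in> J then 0 else (1::real)) \<in> borel_measurable borel"
    by (rule borel_measurable_mono) (auto simp: mono_def J_def intro: order_trans)
  then have "(\<lambda>r. if r \<in> J then 0 else (1::real)) -` {0} \<inter> space borel \<in> sets borel"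
    by (rule measurable_sets) auto
  moreover have "(\<lambda>r. if r \<in> J then 0 else (1::real)) -` {0} \<inter> space borel = J" by auto
  ultimately have [measurable]: "J \<in> sets borel" by simp
  have [measurable]: "sharp_set \<Omega> \<in> sets borel" by (simp add: sharp_set_def)
  have "{x \<in> space borel. c < V x * indicator (sharp_set \<Omega>) x} = {x \<in> space borel. norm x \<in> J \<and> x \<in> sharp_set \<Omega>}"
  proof (intro Collect_cong conj_cong refl)
    fix x
    show "c < V x * indicator (sharp_set \<Omega>) x \<longleftrightarrow> norm x \<in> J \<and> x \<in> sharp_set \<Omega>"
    proof (cases "x \<in> sharp_set \<Omega>")
      case True
      have "norm x \<in> J \<Longrightarrow> c < V x"
        unfolding J_def using superlevel_rearrangement[OF V _ _ True] by blast
      then show ?thesis using True by (auto simp: J_def)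
    qed simp
  qed
  also have "\<dots> \<in> sets borel" by measurable
  finally show "{x \<in> space borel. c < V x * indicator (sharp_set \<Omega>) x} \<in> sets borel" .
qed

text \<open>A superlevel set of a rearrangement contains every point closer to the origin than one of its
  points.  Hence it contains the open ball of its own volume and differs from it by a null set.\<close>

lemma nn_integral_superlevel_rearrangement:
  fixes \<Omega> :: "'a::euclidean_space set"
  assumes \<Omega>: "\<Omega> \<in> lmeasurable" and u: "u \<in> borel_measurable (lebesgue_on \<Omega>)"
    and V: "is_rearrangement \<Omega> u V" and t: "t \<ge> 0" and a: "a > 0"
  shows "(\<integral>\<^sup>+x. ennreal (norm x powr (a - real DIM('a))) * indicator {x. ennreal t < V x * indicator (sharp_set \<Omega>) x} x \<partial>lborel)
    = ennreal (real DIM('a) * unit_ball_vol (real DIM('a)) / a * level_radius \<Omega> u t powr a)"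
proof -
  let ?R = "level_radius \<Omega> u t"
  let ?w = "unit_ball_vol (real DIM('a))"
  define S where "S = {x. ennreal t < V x * indicator (sharp_set \<Omega>) x}"
  have S: "S = {x \<in> sharp_set \<Omega>. V x > ennreal t}" unfolding S_def by (auto split: split_indicator)
  note borel_measurable_rearrangement[OF V, measurable]
  have Sm: "S \<in> sets borel"
  proof -
    have "{x \<in> space borel. ennreal t < V x * indicator (sharp_set \<Omega>) x} \<in> sets borel" by measurable
    then show ?thesis by (simp add: S_def)
  qed
  note Sm[measurable]
  have eS: "emeasure lborel S = ennreal (?w * ?R ^ DIM('a))"
  proof -
    have "emeasure lborel S = emeasure lebesgue S" using Sm by simp
    also have "\<dots> = emeasure lebesgue {x \<in> \<Omega>. \<bar>u x\<bar> > t}" using V t unfolding S is_rearrangement_def by blast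
    finally show ?thesis by (simp only: emeasure_level_set[OF \<Omega> u])
  qed
  have R0: "?R \<ge> 0" by (rule level_radius_nonneg)
  have sub: "ball 0 ?R \<subseteq> S"
  proof
    fix y :: 'a assume y: "y \<in> ball 0 ?R"
    then have ys: "y \<in> sharp_set \<Omega>" using level_radius_le[OF \<Omega> u, of t] by (simp add: sharp_set_eq)
    show "y \<in> S"
    proof (rule ccontr)
      assume "y \<notin> S"
      then have "S \<subseteq> ball 0 (norm y)"
        using superlevel_rearrangement[OF V _ _ ys] ys unfolding S by (auto simp: not_le[symmetric])
      then have "emeasure lborel S \<le> emeasure lborel (ball (0::'a) (norm y))" by (rule emeasure_mono) simp
      then have "?w * ?R ^ DIM('a) \<le> ?w * norm y ^ DIM('a)" unfolding eS by (simp add: emeasure_ball)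
      then have "?R ^ DIM('a) \<le> norm y ^ DIM('a)" by simp
      moreover have "norm y ^ DIM('a) < ?R ^ DIM('a)" using y by (intro power_strict_mono) auto
      ultimately show False by linarith
    qed
  qed
  have "emeasure lborel (S - ball 0 ?R) = emeasure lborel S - emeasure lborel (ball (0::'a) ?R)"
    by (rule emeasure_Diff) (use sub Sm R0 in \<open>auto simp: emeasure_ball\<close>)
  also have "\<dots> = 0" using R0 by (simp add: eS emeasure_ball)
  finally have "S - ball 0 ?R \<in> null_sets lborel" using Sm by (simp add: null_sets_def)
  then have "AE x in lborel. x \<notin> S - ball 0 ?R" by (rule AE_not_in)
  then have "AE x in lborel. ennreal (norm x powr (a - real DIM('a))) * indicator S x
      = ennreal (norm x powr (a - real DIM('a))) * indicator (ball 0 ?R) x"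
  proof eventually_elim
    case (elim x)
    then have "x \<in> S \<longleftrightarrow> x \<in> ball 0 ?R" using sub by blast
    then show ?case by (simp only: indicator_def)
  qed
  then have "(\<integral>\<^sup>+x. ennreal (norm x powr (a - real DIM('a))) * indicator S x \<partial>lborel)
     = (\<integral>\<^sup>+x. ennreal (norm x powr (a - real DIM('a))) * indicator (ball (0::'a) ?R) x \<partial>lborel)"
    by (rule nn_integral_cong_AE)
  then show ?thesis unfolding S_def nn_integral_ball_powr[OF a R0] .
qed

lemma nn_integral_lebesgue_on_lborel:
  assumes "\<Omega> \<in> sets lebesgue"
  shows "(\<integral>\<^sup>+x. f x \<partial>lebesgue_on \<Omega>) = (\<integral>\<^sup>+x. f x * indicator \<Omega> x \<partial>lborel)"
  using assms by (subst nn_integral_restrict_space) (simp_all add: nn_integral_completion)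

lemma lorentz_norm_eq:
  fixes \<Omega> :: "'a::euclidean_space set"
  assumes \<Omega>: "\<Omega> \<in> lmeasurable" and u: "u \<in> borel_measurable (lebesgue_on \<Omega>)" and p: "p > 0"
  shows "lorentz_norm \<Omega> p 1 u = ennreal (unit_ball_vol (real DIM('a)) powr (1 / p) * p)
     * (\<integral>\<^sup>+t. indicator {0..} t * ennreal (level_radius \<Omega> u t powr (real DIM('a) / p)) \<partial>lborel)"
proof -
  let ?w = "unit_ball_vol (real DIM('a))" and ?N = "real DIM('a)"
  define V where "V = rearrangement \<Omega> u"
  have V: "is_rearrangement \<Omega> u V" unfolding V_def by (rule is_rearrangement_rearrangement[OF \<Omega> u])
  define a where "a = ?N / p"
  have a: "a > 0" using p by (simp add: a_def)
  note borel_measurable_rearrangement[OF V, measurable]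
  have [measurable]: "level_radius \<Omega> u \<in> borel_measurable borel" by (rule borel_measurable_level_radius[OF \<Omega> u])
  have w: "?w > 0" by simp
  have "(\<integral>\<^sup>+x. ennreal_powr (V x * ennreal (norm x powr (?N / p))) 1 / ennreal (norm x ^ DIM('a)) \<partial>lebesgue_on (sharp_set \<Omega>))
      = (\<integral>\<^sup>+x. ennreal (norm x powr (a - ?N)) * (V x * indicator (sharp_set \<Omega>) x) \<partial>lborel)"
  proof (subst nn_integral_lebesgue_on_lborel)
    have *: "ennreal (r powr a) / ennreal (r ^ DIM('a)) = ennreal (r powr (a - ?N))" if "r \<ge> 0" for r :: real
    proof (cases "r = 0")
      case False
      then have "r > 0" using that by simp
      then show ?thesis by (simp add: divide_ennreal powr_diff powr_realpow)
    qed simp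
    have "V x * ennreal (norm x powr a) / ennreal (norm x ^ DIM('a)) * indicator (sharp_set \<Omega>) x
        = ennreal (norm x powr (a - ?N)) * (V x * indicator (sharp_set \<Omega>) x)" for x
      using *[of "norm x"] by (simp add: ennreal_times_divide[symmetric] mult_ac)
    then show "(\<integral>\<^sup>+x. ennreal_powr (V x * ennreal (norm x powr (?N / p))) 1 / ennreal (norm x ^ DIM('a)) * indicator (sharp_set \<Omega>) x \<partial>lborel)
      = (\<integral>\<^sup>+x. ennreal (norm x powr (a - ?N)) * (V x * indicator (sharp_set \<Omega>) x) \<partial>lborel)"
      by (simp add: ennreal_powr_one a_def)
  qed (simp add: sharp_set_def)
  also have "\<dots> = (\<integral>\<^sup>+x. ennreal (norm x powr (a - ?N)) * (\<integral>\<^sup>+t. 1 * indicator {t. 0 \<le> t \<and> ennreal t < V x * indicator (sharp_set \<Omega>) x} t \<partial>lborel) \<partial>lborel)"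
    unfolding mult_1 nn_integral_indicator_below ..
  also have "\<dots> = (\<integral>\<^sup>+t. 1 * indicator {0..} t * (\<integral>\<^sup>+x. ennreal (norm x powr (a - ?N)) * indicator {x. ennreal t < V x * indicator (sharp_set \<Omega>) x} x \<partial>lborel) \<partial>lborel)"
    by (rule layer_cake) measurable
  also have "\<dots> = (\<integral>\<^sup>+t. ennreal (?N * ?w / a) * (indicator {0..} t * ennreal (level_radius \<Omega> u t powr a)) \<partial>lborel)"
  proof (rule nn_integral_cong)
    fix t :: real
    show "1 * indicator {0..} t * (\<integral>\<^sup>+x. ennreal (norm x powr (a - ?N)) * indicator {x. ennreal t < V x * indicator (sharp_set \<Omega>) x} x \<partial>lborel)
       = ennreal (?N * ?w / a) * (indicator {0..} t * ennreal (level_radius \<Omega> u t powr a))"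
    proof (cases "t \<ge> 0")
      case True
      have "ennreal (?N * ?w / a * level_radius \<Omega> u t powr a) = ennreal (?N * ?w / a) * ennreal (level_radius \<Omega> u t powr a)"
        by (rule ennreal_mult) (use a in auto)
      then show ?thesis using nn_integral_superlevel_rearrangement[OF \<Omega> u V True a] True by simp
    qed simp
  qed
  also have "\<dots> = ennreal (?N * ?w / a) * (\<integral>\<^sup>+t. indicator {0..} t * ennreal (level_radius \<Omega> u t powr a) \<partial>lborel)"
    by (rule nn_integral_cmult) measurable
  finally have "lorentz_norm \<Omega> p 1 u = ennreal (?w powr (1 / p - 1)) * (ennreal (?N * ?w / a) * (\<integral>\<^sup>+t. indicator {0..} t * ennreal (level_radius \<Omega> u t powr a) \<partial>lborel))"
    unfolding lorentz_norm_def V_def[symmetric] by (simp add: ennreal_powr_one)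
  also have "\<dots> = ennreal (?w powr (1 / p - 1) * (?N * ?w / a)) * (\<integral>\<^sup>+t. indicator {0..} t * ennreal (level_radius \<Omega> u t powr a) \<partial>lborel)"
    using a w by (subst ennreal_mult) (auto simp: mult.assoc)
  also have "?w powr (1 / p - 1) * (?N * ?w / a) = ?w powr (1 / p) * p"
    using w p by (simp add: powr_diff a_def)
  finally show ?thesis by (simp only: a_def)
qed

section \<open>The inequality on the Sobolev space\<close>

text \<open>The powers of \<open>w\<close> match because \<open>2 / N + 2 / p - 2 / N * g = 1\<close>.\<close>

lemma hardy_lorentz_const_scaling:
  fixes N :: nat and p \<rho> w :: real
  assumes N: "N > 0" and p: "p > 0" and \<rho>: "\<rho> > 0" and w: "w > 0" "w = unit_ball_vol (real N)"
  defines "g \<equiv> real N / p - real N / 2 + 1"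
  shows "hardy_lorentz_const N p (w * \<rho> ^ N) * (w powr (1 / p) * p)\<^sup>2
     = 2 * g ^ 3 * (real N * w) / ((real N / p)\<^sup>2 * \<rho> powr (2 * g))"
proof -
  have "(w * \<rho> ^ N) powr (2 / real N * g) = w powr (2 / real N * g) * \<rho> powr (2 * g)"
    using w \<rho> N by (simp add: powr_mult powr_realpow[symmetric] powr_powr)
  moreover have "(w powr (1 / p))\<^sup>2 = w powr (2 / p)"
    using w by (simp add: power2_eq_square powr_add[symmetric])
  ultimately have "hardy_lorentz_const N p (w * \<rho> ^ N) * (w powr (1 / p) * p)\<^sup>2
     = 2 * g ^ 3 * p\<^sup>2 / (real N * \<rho> powr (2 * g)) * (w powr (2 / real N) * w powr (2 / p) / w powr (2 / real N * g))"
    unfolding hardy_lorentz_const_def g_def[symmetric] w(2)[symmetric] by (simp add: field_simps power_mult_distrib)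
  also have "w powr (2 / real N) * w powr (2 / p) / w powr (2 / real N * g) = w"
  proof -
    have "2 / real N + 2 / p - 2 / real N * g = 1" using N p by (simp add: g_def field_simps)
    then show ?thesis using w by (simp add: powr_add[symmetric] powr_diff[symmetric])
  qed
  also have "2 * g ^ 3 * p\<^sup>2 / (real N * \<rho> powr (2 * g)) * w = 2 * g ^ 3 * (real N * w) / ((real N / p)\<^sup>2 * \<rho> powr (2 * g))"
    using N p by (simp add: field_simps power2_eq_square)
  finally show ?thesis .
qed

lemma hardy_lorentz_const_pos:
  assumes "N > 0" "m > 0" "real N / p - real N / 2 + 1 > 0"
  shows "hardy_lorentz_const N p m > 0"
  using assms less_imp_neq[OF unit_ball_vol_pos[of "real N"]] unfolding hardy_lorentz_const_def by (intro mult_pos_pos divide_pos_pos zero_less_power) auto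

lemma measure_eq_sharp_radius:
  fixes \<Omega> :: "'a::euclidean_space set"
  shows "measure lebesgue \<Omega> = unit_ball_vol (real DIM('a)) * sharp_radius \<Omega> ^ DIM('a)"
  using powr_inverse_power[of "measure lebesgue \<Omega> / unit_ball_vol (real DIM('a))" "DIM('a)"]
    less_imp_neq[OF unit_ball_vol_pos[of "real DIM('a)"]]
  by (simp add: sharp_radius_def)

lemma sharp_radius_pos:
  fixes \<Omega> :: "'a::euclidean_space set"
  assumes "open \<Omega>" "bounded \<Omega>" "\<Omega> \<noteq> {}"
  shows "sharp_radius \<Omega> > 0"
  using measure_open_pos[OF assms(1,3,2)] less_imp_neq[OF unit_ball_vol_pos[of "real DIM('a)"]]
  by (simp add: sharp_radius_def)

lemma test_function_measurable:
  assumes "\<phi> \<in> test_functions \<Omega>"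
  shows "\<phi> \<in> borel_measurable borel" "gradient \<phi> \<in> borel_measurable borel"
  using test_function_continuous[OF assms] continuous_gradient[OF assms] by (auto intro: borel_measurable_continuous_onI)

lemma borel_measurable_lebesgue_onI:
  fixes f :: "'a::euclidean_space \<Rightarrow> 'b::euclidean_space"
  assumes "f \<in> borel_measurable borel"
  shows "f \<in> borel_measurable (lebesgue_on \<Omega>)"
  using assms by (intro measurable_restrict_space1 measurable_completion) simp

lemma test_function_outside:
  assumes "\<phi> \<in> test_functions \<Omega>" "x \<notin> \<Omega>"
  shows "\<phi> x = 0" "gradient \<phi> x = 0"
proof -
  have "x \<notin> closure {x. \<phi> x \<noteq> 0}" using assms by (auto simp: test_functions_def)
  then show "\<phi> x = 0" "gradient \<phi> x = 0" by (rule gradient_outside_support)+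
qed

lemma improved_hardy_test_function:
  fixes \<Omega> :: "'a::euclidean_space set"
  assumes \<Omega>: "open \<Omega>" "bounded \<Omega>" "\<Omega> \<noteq> {}" and \<phi>: "\<phi> \<in> test_functions \<Omega>" and N: "DIM('a) \<ge> 3"
    and p: "p > 0" "real DIM('a) / p - real DIM('a) / 2 + 1 > 0"
  shows "ennreal (hardy_lorentz_const DIM('a) p (measure lebesgue \<Omega>)) * (lorentz_norm \<Omega> p 1 \<phi>)\<^sup>2
     + ennreal ((real DIM('a) - 2)\<^sup>2 / 4) * (\<integral>\<^sup>+x. ennreal ((\<phi> x)\<^sup>2 / (norm x)\<^sup>2) \<partial>lebesgue_on \<Omega>)
    \<le> (\<integral>\<^sup>+x. ennreal ((norm (gradient \<phi> x))\<^sup>2) \<partial>lebesgue_on \<Omega>)"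
proof -
  let ?w = "unit_ball_vol (real DIM('a))" and ?N = "real DIM('a)"
  define b where "b = (?N - 2) / 2"
  define a where "a = ?N / p"
  define f where "f x = \<bar>\<phi> x\<bar>" for x
  define G where "G x = norm (gradient \<phi> x)" for x
  define R where "R = level_radius \<Omega> \<phi>"
  have lm: "\<Omega> \<in> lmeasurable" using \<Omega> by (intro lmeasurable_open)
  then have Ws: "\<Omega> \<in> sets lebesgue" by (rule fmeasurableD)
  have [measurable]: "\<Omega> \<in> sets borel" using \<Omega> by simp
  note [measurable] = test_function_measurable[OF \<phi>]
  have \<phi>m: "\<phi> \<in> borel_measurable (lebesgue_on \<Omega>)" by (rule borel_measurable_lebesgue_onI) measurable
  have set_eq: "{x \<in> \<Omega>. \<bar>\<phi> x\<bar> > t} = {x. f x > t}" if "t \<ge> 0" for t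
    using test_function_outside(1)[OF \<phi>] that unfolding f_def by force
  obtain B where B: "B > 0" "\<And>x. \<bar>\<phi> x\<bar> \<le> B" by (rule test_function_bounded[OF \<phi>]) blast
  have measure_level: "measure lebesgue {x. f x > t} = ?w * R t ^ DIM('a)" if "t \<ge> 0" for t
    using measure_level_set[where \<Omega> = \<Omega> and u = \<phi> and t = t] unfolding set_eq[OF that] R_def .
  interpret bounded_profile f R B
  proof
    show "f \<in> borel_measurable borel" unfolding f_def by measurable
    show "emeasure lborel {x. f x > t} = ennreal (?w * R t ^ DIM('a))" if "t \<ge> 0" for t
    proof -
      have "{x \<in> space borel. f x > t} \<in> sets borel" unfolding f_def by measurable
      then have "emeasure lborel {x. f x > t} = emeasure lebesgue {x. f x > t}" by simp
      then show ?thesis using emeasure_level_set[OF lm \<phi>m, of t] unfolding set_eq[OF that] R_def by simp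
    qed
    show "R t \<ge> 0" for t unfolding R_def by (rule level_radius_nonneg)
    show "R t \<le> R s" if "s \<le> t" for s t unfolding R_def by (rule level_radius_antimono[OF lm \<phi>m that])
    show "R t = 0" if "t \<ge> B" for t
    proof -
      have "\<not> t < \<bar>\<phi> x\<bar>" for x using B(2)[of x] that by linarith
      then have e: "{x \<in> \<Omega>. \<bar>\<phi> x\<bar> > t} = {}" by blast
      show ?thesis unfolding R_def level_radius_def e by simp
    qed
  qed
  obtain M where M: "M > 0" "\<And>x. norm x \<ge> M \<Longrightarrow> \<phi> x = 0" "\<And>x. norm x \<ge> M \<Longrightarrow> gradient \<phi> x = 0"
    by (rule test_function_support_ball[OF \<phi>]) blast
  obtain L where L: "\<And>x. norm (gradient \<phi> x) \<le> L" by (rule norm_gradient_bounded[OF \<phi>]) blast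
  define \<rho> where "\<rho> = sharp_radius \<Omega>"
  have \<rho>: "\<rho> > 0" unfolding \<rho>_def by (rule sharp_radius_pos[OF \<Omega>])
  have ab: "a - b = ?N / p - ?N / 2 + 1" by (simp add: a_def b_def field_simps)
  have main: "ennreal (b\<^sup>2) * hardy_energy + ennreal (2 * (a - b) ^ 3 * (?N * ?w) / (a\<^sup>2 * \<rho> powr (2 * (a - b)))) * (lorentz_energy a)\<^sup>2
     \<le> (\<integral>\<^sup>+x. ennreal ((G x)\<^sup>2) \<partial>lborel)"
    unfolding b_def
  proof (rule improved_hardy_profile[OF N])
    show "(?N - 2) / 2 < a" using p(2) unfolding ab[symmetric] b_def by linarith
    show "R t \<le> \<rho>" for t unfolding R_def \<rho>_def by (rule level_radius_le[OF lm \<phi>m])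
    show "\<rho> > 0" by (rule \<rho>)
    show "G \<in> borel_measurable borel" unfolding G_def by measurable
    show "G x \<ge> 0" for x by (simp add: G_def)
    fix h :: "real \<Rightarrow> ennreal" assume h: "h \<in> borel_measurable borel"
    show "(\<integral>\<^sup>+t. h t * (ennreal (?N * ?w * R t ^ (DIM('a) - 1)) * indicator {0..} t) \<partial>lborel)
       \<le> (\<integral>\<^sup>+x. h (f x) * ennreal (G x) \<partial>lborel)"
    proof (rule coarea_inequality[where M = M and L = L])
      show "DIM('a) \<ge> 2" using N by simp
      show "continuous_on UNIV f" unfolding f_def by (intro continuous_intros test_function_continuous[OF \<phi>])
      show "continuous_on UNIV G" unfolding G_def by (intro continuous_intros continuous_gradient[OF \<phi>])
      show "\<exists>\<epsilon>>0. \<forall>x y. dist y x < \<epsilon> \<longrightarrow> \<bar>f y - f x\<bar> \<le> (G x + \<delta>) * dist y x" if "\<delta> > 0" for \<delta>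
        unfolding f_def G_def by (rule test_function_slope[OF \<phi> that])
    qed (use M L measure_level R_nonneg h R_meas in \<open>auto simp: f_def G_def\<close>)
  qed
  have hardy: "(\<integral>\<^sup>+x. ennreal ((\<phi> x)\<^sup>2 / (norm x)\<^sup>2) \<partial>lebesgue_on \<Omega>) \<le> hardy_energy"
  proof -
    have "(\<integral>\<^sup>+x. ennreal ((\<phi> x)\<^sup>2 / (norm x)\<^sup>2) \<partial>lebesgue_on \<Omega>)
        \<le> (\<integral>\<^sup>+x. ennreal (norm x powr (- 2)) * ennreal ((f x)\<^sup>2) \<partial>lborel)"
      unfolding nn_integral_lebesgue_on_lborel[OF Ws]
    proof (rule nn_integral_mono)
      fix x :: 'a
      have "(\<phi> x)\<^sup>2 / (norm x)\<^sup>2 = norm x powr (- 2) * (f x)\<^sup>2"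
        by (cases "x = 0") (simp_all add: f_def powr_minus powr_numeral field_simps)
      then show "ennreal ((\<phi> x)\<^sup>2 / (norm x)\<^sup>2) * indicator \<Omega> x \<le> ennreal (norm x powr (- 2)) * ennreal ((f x)\<^sup>2)"
        by (simp add: ennreal_mult split: split_indicator)
    qed
    also have "\<dots> \<le> hardy_energy" by (rule hardy_le_energy[OF N]) (simp add: f_def)
    finally show ?thesis .
  qed
  have grad: "(\<integral>\<^sup>+x. ennreal ((G x)\<^sup>2) \<partial>lborel) = (\<integral>\<^sup>+x. ennreal ((norm (gradient \<phi> x))\<^sup>2) \<partial>lebesgue_on \<Omega>)"
    unfolding nn_integral_lebesgue_on_lborel[OF Ws]
    by (rule nn_integral_cong) (use test_function_outside(2)[OF \<phi>] in \<open>auto simp: G_def split: split_indicator\<close>)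
  have lor: "ennreal (hardy_lorentz_const DIM('a) p (measure lebesgue \<Omega>)) * (lorentz_norm \<Omega> p 1 \<phi>)\<^sup>2
      = ennreal (2 * (a - b) ^ 3 * (?N * ?w) / (a\<^sup>2 * \<rho> powr (2 * (a - b)))) * (lorentz_energy a)\<^sup>2"
  proof -
    have L: "lorentz_norm \<Omega> p 1 \<phi> = ennreal (?w powr (1 / p) * p) * lorentz_energy a"
      unfolding lorentz_energy_def unfolding lorentz_norm_eq[OF lm \<phi>m p(1)] R_def a_def ..
    have C: "hardy_lorentz_const DIM('a) p (measure lebesgue \<Omega>) > 0"
      by (rule hardy_lorentz_const_pos) (use p measure_open_pos[OF \<Omega>(1,3,2)] in auto)
    have e: "hardy_lorentz_const DIM('a) p (measure lebesgue \<Omega>) * (?w powr (1 / p) * p)\<^sup>2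
        = 2 * (a - b) ^ 3 * (?N * ?w) / (a\<^sup>2 * \<rho> powr (2 * (a - b)))"
      unfolding measure_eq_sharp_radius[of \<Omega>] \<rho>_def[symmetric] ab unfolding a_def
      by (rule hardy_lorentz_const_scaling) (use p \<rho> in auto)
    have "(lorentz_norm \<Omega> p 1 \<phi>)\<^sup>2 = ennreal ((?w powr (1 / p) * p)\<^sup>2) * (lorentz_energy a)\<^sup>2"
    proof -
      have "(ennreal (?w powr (1 / p) * p))\<^sup>2 = ennreal ((?w powr (1 / p) * p)\<^sup>2)"
        by (rule ennreal_power) (use p in auto)
      then show ?thesis unfolding L by (simp only: power_mult_distrib[of "ennreal (?w powr (1 / p) * p)"])
    qed
    then show ?thesis unfolding e[symmetric] using C p by (simp add: ennreal_mult mult.assoc)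
  qed
  have "ennreal (hardy_lorentz_const DIM('a) p (measure lebesgue \<Omega>)) * (lorentz_norm \<Omega> p 1 \<phi>)\<^sup>2
     + ennreal ((?N - 2)\<^sup>2 / 4) * (\<integral>\<^sup>+x. ennreal ((\<phi> x)\<^sup>2 / (norm x)\<^sup>2) \<partial>lebesgue_on \<Omega>)
     \<le> ennreal (2 * (a - b) ^ 3 * (?N * ?w) / (a\<^sup>2 * \<rho> powr (2 * (a - b)))) * (lorentz_energy a)\<^sup>2
       + ennreal (b\<^sup>2) * hardy_energy"
  proof -
    have "(?N - 2)\<^sup>2 / 4 = b\<^sup>2" by (simp add: b_def power_divide)
    then show ?thesis unfolding lor using hardy by (simp add: add_left_mono mult_left_mono)
  qed
  also have "\<dots> \<le> (\<integral>\<^sup>+x. ennreal ((norm (gradient \<phi> x))\<^sup>2) \<partial>lebesgue_on \<Omega>)"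
    using main unfolding grad by (simp only: add.commute)
  finally show ?thesis .
qed

lemma liminf_quadratic_le:
  fixes a h :: "nat \<Rightarrow> ennreal"
  assumes "A \<le> liminf a" "B \<le> liminf h" and cd: "c < top" "d < top"
    and le: "eventually (\<lambda>n. c * (a n)\<^sup>2 + d * h n \<le> Y) sequentially"
  shows "c * A\<^sup>2 + d * B \<le> Y"
proof -
  define a' where "a' n = (INF m\<in>{n..}. a m)" for n
  define h' where "h' n = (INF m\<in>{n..}. h m)" for n
  have inc: "incseq a'" "incseq h'"
    unfolding incseq_def a'_def h'_def by (auto intro!: INF_superset_mono)
  have la: "a' \<longlonglongrightarrow> liminf a" and lh: "h' \<longlonglongrightarrow> liminf h"
    using LIMSEQ_SUP[OF inc(1)] LIMSEQ_SUP[OF inc(2)] by (simp_all add: a'_def[abs_def] h'_def[abs_def] liminf_SUP_INF)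
  have "(\<lambda>n. a' n * a' n) \<longlonglongrightarrow> liminf a * liminf a"
    by (rule tendsto_mult_ennreal[OF la la]) auto
  then have "(\<lambda>n. c * (a' n)\<^sup>2 + d * h' n) \<longlonglongrightarrow> c * (liminf a)\<^sup>2 + d * liminf h"
    by (intro tendsto_add ennreal_tendsto_cmult cd lh) (simp only: power2_eq_square)
  moreover have "eventually (\<lambda>n. c * (a' n)\<^sup>2 + d * h' n \<le> Y) sequentially"
    using le
  proof eventually_elim
    case (elim n)
    have "a' n \<le> a n" "h' n \<le> h n" unfolding a'_def h'_def by (auto intro: INF_lower)
    then have "c * (a' n)\<^sup>2 + d * h' n \<le> c * (a n)\<^sup>2 + d * h n"
      by (intro add_mono mult_left_mono power_mono) auto
    with elim show ?case by (rule order_trans[rotated])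
  qed
  ultimately have "c * (liminf a)\<^sup>2 + d * liminf h \<le> Y"
    by (intro tendsto_upperbound) auto
  moreover have "c * A\<^sup>2 + d * B \<le> c * (liminf a)\<^sup>2 + d * liminf h"
    using assms(1,2) by (intro add_mono mult_left_mono power_mono) auto
  ultimately show ?thesis by (rule order_trans[rotated])
qed

text \<open>Moving the Hardy term to the other side turns the difference of extended reals into a sum of
  nonnegative terms, to which Fatou's lemma applies.  Finiteness of the Dirichlet integral excludes
  that an infinite Hardy term is hidden by \<open>\<infinity> - \<infinity>\<close>.\<close>

lemma hardy_lorentz_ineq_iff:
  fixes \<Omega> :: "'a::euclidean_space set"
  assumes c: "c > 0" and N: "DIM('a) \<ge> 3" and G: "(\<integral>\<^sup>+x. ennreal ((norm (g x))\<^sup>2) \<partial>lebesgue_on \<Omega>) < \<infinity>"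
  shows "hardy_lorentz_ineq p c \<Omega> u g \<longleftrightarrow>
    ennreal c * (lorentz_norm \<Omega> p 1 u)\<^sup>2
     + ennreal ((real DIM('a) - 2)\<^sup>2 / 4) * (\<integral>\<^sup>+x. ennreal ((u x)\<^sup>2 / (norm x)\<^sup>2) \<partial>lebesgue_on \<Omega>)
    \<le> (\<integral>\<^sup>+x. ennreal ((norm (g x))\<^sup>2) \<partial>lebesgue_on \<Omega>)"
proof -
  obtain G' where G': "(\<integral>\<^sup>+x. ennreal ((norm (g x))\<^sup>2) \<partial>lebesgue_on \<Omega>) = ennreal G'" "G' \<ge> 0"
    using G by (metis ennreal_cases infinity_ennreal_def less_irrefl)
  define k where "k = (real DIM('a) - 2)\<^sup>2 / 4"
  have k: "k > 0" using N by (simp add: k_def)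
  define H where "H = (\<integral>\<^sup>+x. ennreal ((u x)\<^sup>2 / (norm x)\<^sup>2) \<partial>lebesgue_on \<Omega>)"
  define L where "L = lorentz_norm \<Omega> p 1 u"
  have "(ereal c * (enn2ereal L)\<^sup>2 \<le> ereal G' - ereal k * enn2ereal H) \<longleftrightarrow> (ennreal c * L\<^sup>2 + ennreal k * H \<le> ennreal G')"
  proof (cases H)
    case top
    have "\<not> ereal c * (enn2ereal L)\<^sup>2 \<le> - \<infinity>"
    proof (cases L)
      case (real l)
      then show ?thesis by (simp add: power2_eq_square)
    next
      case top
      then show ?thesis using c by (simp add: power2_eq_square)
    qed
    then show ?thesis using top k c by (simp add: ennreal_mult_top top_unique)
  next
    case (real h)
    show ?thesis
    proof (cases L)
      case top
      then show ?thesis using c k real by (simp add: power2_eq_square ennreal_mult_top top_unique)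
    next
      case (real l)
      have "ennreal c * L\<^sup>2 + ennreal k * H = ennreal (c * l\<^sup>2 + k * h)"
        using c k real \<open>H = ennreal h\<close> \<open>0 \<le> h\<close> by (simp add: ennreal_mult ennreal_power)
      then have "ennreal c * L\<^sup>2 + ennreal k * H \<le> ennreal G' \<longleftrightarrow> c * l\<^sup>2 + k * h \<le> G'"
        using G'(2) by (simp add: ennreal_le_iff)
      moreover have "(ereal c * (enn2ereal L)\<^sup>2 \<le> ereal G' - ereal k * enn2ereal H) \<longleftrightarrow> c * l\<^sup>2 \<le> G' - k * h"
        using real \<open>H = ennreal h\<close> \<open>0 \<le> h\<close> by (simp add: power2_eq_square)
      ultimately show ?thesis by linarith
    qed
  qed
  then show ?thesis
    unfolding hardy_lorentz_ineq_def k_def[symmetric] H_def[symmetric] L_def[symmetric] G'(1) using G'(2) by simp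
qed

lemma square_integrable_test_function:
  fixes \<Omega> :: "'a::euclidean_space set"
  assumes \<Omega>: "\<Omega> \<in> lmeasurable" and \<phi>: "\<phi> \<in> test_functions \<Omega>"
  shows "square_integrable_on \<phi> \<Omega>" "square_integrable_on (gradient \<phi>) \<Omega>"
proof -
  interpret finite_measure "lebesgue_on \<Omega>" by (rule finite_measure_lebesgue_on[OF \<Omega>])
  note m = test_function_measurable[OF \<phi>, THEN borel_measurable_lebesgue_onI, of \<Omega>]
  note [measurable] = m
  obtain B where B: "B > 0" "\<And>x. \<bar>\<phi> x\<bar> \<le> B" by (rule test_function_bounded[OF \<phi>]) blast
  obtain L where L: "\<And>x. norm (gradient \<phi> x) \<le> L" by (rule norm_gradient_bounded[OF \<phi>]) blast
  have "integrable (lebesgue_on \<Omega>) (\<lambda>x. (norm (\<phi> x))\<^sup>2)"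
    by (rule integrable_const_bound[where B = "B\<^sup>2"]) (use B in \<open>auto intro!: AE_I2 power_mono simp: abs_le_square_iff[symmetric]\<close>)
  then show "square_integrable_on \<phi> \<Omega>" using m by (simp add: square_integrable_on_def)
  have "integrable (lebesgue_on \<Omega>) (\<lambda>x. (norm (gradient \<phi> x))\<^sup>2)"
    by (rule integrable_const_bound[where B = "L\<^sup>2"]) (use L in \<open>auto intro!: AE_I2 power_mono\<close>)
  then show "square_integrable_on (gradient \<phi>) \<Omega>" using m by (simp add: square_integrable_on_def)
qed

lemma square_integrable_diff:
  fixes f g :: "'a::euclidean_space \<Rightarrow> 'b::euclidean_space"
  assumes "square_integrable_on f \<Omega>" "square_integrable_on g \<Omega>"
  shows "integrable (lebesgue_on \<Omega>) (\<lambda>x. (norm (f x - g x))\<^sup>2)"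
proof (rule Bochner_Integration.integrable_bound)
  show "integrable (lebesgue_on \<Omega>) (\<lambda>x. 2 * (norm (f x))\<^sup>2 + 2 * (norm (g x))\<^sup>2)"
    using assms by (simp add: square_integrable_on_def)
  show "(\<lambda>x. (norm (f x - g x))\<^sup>2) \<in> borel_measurable (lebesgue_on \<Omega>)"
  proof -
    have [measurable]: "f \<in> borel_measurable (lebesgue_on \<Omega>)" "g \<in> borel_measurable (lebesgue_on \<Omega>)"
      using assms by (auto simp: square_integrable_on_def)
    show ?thesis by measurable
  qed
  have "(norm (f x - g x))\<^sup>2 \<le> 2 * (norm (f x))\<^sup>2 + 2 * (norm (g x))\<^sup>2" for x
  proof -
    have "(norm (f x - g x))\<^sup>2 \<le> (norm (f x) + norm (g x))\<^sup>2"
      by (intro power_mono norm_triangle_ineq4) simp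
    also have "\<dots> \<le> 2 * (norm (f x))\<^sup>2 + 2 * (norm (g x))\<^sup>2"
      using sum_squares_bound[of "norm (f x)" "norm (g x)"] by (simp add: power2_sum)
    finally show ?thesis .
  qed
  then show "AE x in lebesgue_on \<Omega>. norm ((norm (f x - g x))\<^sup>2) \<le> norm (2 * (norm (f x))\<^sup>2 + 2 * (norm (g x))\<^sup>2)"
    by (intro AE_I2) (simp add: abs_of_nonneg)
qed

text \<open>Fatou's lemma for the indicators of the strict superlevel sets.\<close>

lemma level_radius_lower_semicontinuous:
  fixes \<Omega> :: "'a::euclidean_space set"
  assumes \<Omega>: "\<Omega> \<in> lmeasurable" and u: "u \<in> borel_measurable (lebesgue_on \<Omega>)"
    and f: "\<And>n. f n \<in> borel_measurable (lebesgue_on \<Omega>)"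
    and lim: "AE x in lebesgue_on \<Omega>. (\<lambda>n. f n x) \<longlonglongrightarrow> u x"
    and s: "c < level_radius \<Omega> u t"
  shows "eventually (\<lambda>n. c < level_radius \<Omega> (f n) t) sequentially"
proof (cases "c < 0")
  case True
  then show ?thesis using level_radius_nonneg by (intro always_eventually allI) (rule less_le_trans)
next
  case False
  let ?w = "unit_ball_vol (real DIM('a))"
  have Ws: "\<Omega> \<in> sets lebesgue" using \<Omega> by (rule fmeasurableD)
  have m: "{x \<in> \<Omega>. \<bar>h x\<bar> > t} \<in> sets (lebesgue_on \<Omega>)"
      "(\<integral>\<^sup>+x. indicator {x \<in> \<Omega>. \<bar>h x\<bar> > t} x \<partial>lebesgue_on \<Omega>) = ennreal (?w * level_radius \<Omega> h t ^ DIM('a))"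
    if h: "h \<in> borel_measurable (lebesgue_on \<Omega>)" for h
  proof -
    have l: "{x \<in> \<Omega>. \<bar>h x\<bar> > t} \<in> sets lebesgue" using level_set_measurable[OF \<Omega> h] by (rule fmeasurableD)
    then show s: "{x \<in> \<Omega>. \<bar>h x\<bar> > t} \<in> sets (lebesgue_on \<Omega>)"
      using Ws by (subst sets_restrict_space_iff) auto
    have "(\<integral>\<^sup>+x. indicator {x \<in> \<Omega>. \<bar>h x\<bar> > t} x \<partial>lebesgue_on \<Omega>) = emeasure (lebesgue_on \<Omega>) {x \<in> \<Omega>. \<bar>h x\<bar> > t}"
      by (rule nn_integral_indicator[OF s])
    also have "\<dots> = emeasure lebesgue {x \<in> \<Omega>. \<bar>h x\<bar> > t}"
      using Ws by (subst emeasure_restrict_space) auto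
    finally show "(\<integral>\<^sup>+x. indicator {x \<in> \<Omega>. \<bar>h x\<bar> > t} x \<partial>lebesgue_on \<Omega>) = ennreal (?w * level_radius \<Omega> h t ^ DIM('a))"
      unfolding emeasure_level_set[OF \<Omega> h] .
  qed
  have "AE x in lebesgue_on \<Omega>. (indicator {x \<in> \<Omega>. \<bar>u x\<bar> > t} x :: ennreal) \<le> liminf (\<lambda>n. indicator {x \<in> \<Omega>. \<bar>f n x\<bar> > t} x)"
    using lim
  proof eventually_elim
    case (elim x)
    show ?case
    proof (cases "x \<in> {x \<in> \<Omega>. \<bar>u x\<bar> > t}")
      case True
      have "(\<lambda>n. \<bar>f n x\<bar>) \<longlonglongrightarrow> \<bar>u x\<bar>" using elim by (rule tendsto_rabs)
      then have "eventually (\<lambda>n. t < \<bar>f n x\<bar>) sequentially" using True by (intro order_tendstoD(1)) auto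
      then have "eventually (\<lambda>n. (1::ennreal) \<le> indicator {x \<in> \<Omega>. \<bar>f n x\<bar> > t} x) sequentially"
        by eventually_elim (use True in auto)
      then have "(1::ennreal) \<le> liminf (\<lambda>n. indicator {x \<in> \<Omega>. \<bar>f n x\<bar> > t} x)" by (rule Liminf_bounded)
      then show ?thesis using True by simp
    qed simp
  qed
  then have "(\<integral>\<^sup>+x. indicator {x \<in> \<Omega>. \<bar>u x\<bar> > t} x \<partial>lebesgue_on \<Omega>)
      \<le> (\<integral>\<^sup>+x. liminf (\<lambda>n. indicator {x \<in> \<Omega>. \<bar>f n x\<bar> > t} x) \<partial>lebesgue_on \<Omega>)"
    by (rule nn_integral_mono_AE)
  also have "\<dots> \<le> liminf (\<lambda>n. (\<integral>\<^sup>+x. indicator {x \<in> \<Omega>. \<bar>f n x\<bar> > t} x \<partial>lebesgue_on \<Omega>))"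
    by (rule nn_integral_liminf) (use m(1)[OF f] in measurable)
  finally have le: "ennreal (?w * level_radius \<Omega> u t ^ DIM('a)) \<le> liminf (\<lambda>n. ennreal (?w * level_radius \<Omega> (f n) t ^ DIM('a)))"
    unfolding m(2)[OF u] m(2)[OF f] .
  have "c ^ DIM('a) < level_radius \<Omega> u t ^ DIM('a)" using False s by (intro power_strict_mono) auto
  then have "ennreal (?w * c ^ DIM('a)) < ennreal (?w * level_radius \<Omega> u t ^ DIM('a))"
    using False by (subst ennreal_less_iff) auto
  then have "ennreal (?w * c ^ DIM('a)) < liminf (\<lambda>n. ennreal (?w * level_radius \<Omega> (f n) t ^ DIM('a)))"
    using le by (rule less_le_trans)
  from less_LiminfD[OF this] show ?thesis
  proof eventually_elim
    case (elim n)
    then have "?w * c ^ DIM('a) < ?w * level_radius \<Omega> (f n) t ^ DIM('a)"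
      using False by (subst (asm) ennreal_less_iff) auto
    then have "c ^ DIM('a) < level_radius \<Omega> (f n) t ^ DIM('a)" by simp
    then show ?case using level_radius_nonneg by (rule power_less_imp_less_base)
  qed
qed

text \<open>Fatou's lemma in the level \<open>t\<close>, applied to the pointwise semicontinuity of the radii.\<close>

lemma lorentz_norm_lower_semicontinuous:
  fixes \<Omega> :: "'a::euclidean_space set"
  assumes \<Omega>: "\<Omega> \<in> lmeasurable" and u: "u \<in> borel_measurable (lebesgue_on \<Omega>)"
    and f: "\<And>n. f n \<in> borel_measurable (lebesgue_on \<Omega>)"
    and lim: "AE x in lebesgue_on \<Omega>. (\<lambda>n. f n x) \<longlonglongrightarrow> u x" and p: "p > 0"
  shows "lorentz_norm \<Omega> p 1 u \<le> liminf (\<lambda>n. lorentz_norm \<Omega> p 1 (f n))"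
proof -
  define c where "c = ennreal (unit_ball_vol (real DIM('a)) powr (1 / p) * p)"
  define a where "a = real DIM('a) / p"
  have a: "a > 0" using p by (simp add: a_def)
  have c: "c < top" by (simp add: c_def)
  define F where "F h t = c * (indicator {0..} t * ennreal (level_radius \<Omega> h t powr a))" for h and t :: real
  have L: "lorentz_norm \<Omega> p 1 h = (\<integral>\<^sup>+t. F h t \<partial>lborel)" "F h \<in> borel_measurable lborel"
    if h: "h \<in> borel_measurable (lebesgue_on \<Omega>)" for h
  proof -
    have [measurable]: "level_radius \<Omega> h \<in> borel_measurable borel" by (rule borel_measurable_level_radius[OF \<Omega> h])
    show "lorentz_norm \<Omega> p 1 h = (\<integral>\<^sup>+t. F h t \<partial>lborel)"
      unfolding lorentz_norm_eq[OF \<Omega> h p] F_def c_def[symmetric] a_def[symmetric]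
      by (rule nn_integral_cmult[symmetric]) measurable
    show "F h \<in> borel_measurable lborel" unfolding F_def by measurable
  qed
  have le: "F u t \<le> liminf (\<lambda>n. F (f n) t)" for t
  proof (rule LIMSEQ_le_const2)
    define r where "r = level_radius \<Omega> u t"
    define s where "s k = max 0 (r - 1 / real (Suc k))" for k
    have r0: "r \<ge> 0" unfolding r_def by (rule level_radius_nonneg)
    have "(\<lambda>k. max 0 (r - 1 / real (Suc k))) \<longlonglongrightarrow> max 0 (r - 0)"
      by (intro tendsto_intros LIMSEQ_Suc lim_1_over_n)
    then have sr: "s \<longlonglongrightarrow> r" using r0 by (simp add: s_def[abs_def])
    show "(\<lambda>k. c * (indicator {0..} t * ennreal (s k powr a))) \<longlonglongrightarrow> F u t"
      unfolding F_def r_def[symmetric]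
    proof (intro ennreal_tendsto_cmult c)
      show "indicator {0..} t < (top::ennreal)" by (simp split: split_indicator)
      show "(\<lambda>k. ennreal (s k powr a)) \<longlonglongrightarrow> ennreal (r powr a)"
        using a by (intro tendsto_ennrealI tendsto_powr2 sr tendsto_const) (auto simp: s_def)
    qed
    show "\<exists>N. \<forall>k\<ge>N. c * (indicator {0..} t * ennreal (s k powr a)) \<le> liminf (\<lambda>n. F (f n) t)"
    proof (intro exI allI impI Liminf_bounded)
      fix k :: nat
      have ev: "eventually (\<lambda>n. r - 1 / real (Suc k) < level_radius \<Omega> (f n) t) sequentially"
        by (rule level_radius_lower_semicontinuous[OF \<Omega> u f lim]) (simp add: r_def)
      show "eventually (\<lambda>n. c * (indicator {0..} t * ennreal (s k powr a)) \<le> F (f n) t) sequentially"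
        using ev
      proof eventually_elim
        case (elim n)
        then have "s k \<le> level_radius \<Omega> (f n) t" using level_radius_nonneg[of \<Omega> "f n" t] by (simp add: s_def)
        then have "s k powr a \<le> level_radius \<Omega> (f n) t powr a" using a by (intro powr_mono2) (auto simp: s_def)
        then show ?case unfolding F_def by (intro mult_left_mono ennreal_leI) auto
      qed
    qed
  qed
  have "lorentz_norm \<Omega> p 1 u = (\<integral>\<^sup>+t. F u t \<partial>lborel)" by (rule L(1)[OF u])
  also have "\<dots> \<le> (\<integral>\<^sup>+t. liminf (\<lambda>n. F (f n) t) \<partial>lborel)" by (rule nn_integral_mono) (rule le)
  also have "\<dots> \<le> liminf (\<lambda>n. (\<integral>\<^sup>+t. F (f n) t \<partial>lborel))" by (rule nn_integral_liminf) (rule L(2)[OF f])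
  also have "\<dots> = liminf (\<lambda>n. lorentz_norm \<Omega> p 1 (f n))" by (simp only: L(1)[OF f])
  finally show ?thesis .
qed

lemma hardy_term_lower_semicontinuous:
  fixes \<Omega> :: "'a::euclidean_space set"
  assumes f: "\<And>n. f n \<in> borel_measurable (lebesgue_on \<Omega>)"
    and lim: "AE x in lebesgue_on \<Omega>. (\<lambda>n. f n x) \<longlonglongrightarrow> u x"
  shows "(\<integral>\<^sup>+x. ennreal ((u x)\<^sup>2 / (norm x)\<^sup>2) \<partial>lebesgue_on \<Omega>)
     \<le> liminf (\<lambda>n. \<integral>\<^sup>+x. ennreal ((f n x)\<^sup>2 / (norm x)\<^sup>2) \<partial>lebesgue_on \<Omega>)"
proof -
  note [measurable] = f
  have [measurable]: "(\<lambda>x. norm x) \<in> borel_measurable (lebesgue_on \<Omega>)"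
    by (rule borel_measurable_lebesgue_onI) measurable
  have "AE x in lebesgue_on \<Omega>. ennreal ((u x)\<^sup>2 / (norm x)\<^sup>2) \<le> liminf (\<lambda>n. ennreal ((f n x)\<^sup>2 / (norm x)\<^sup>2))"
    using lim
  proof eventually_elim
    case (elim x)
    have "(\<lambda>n. (f n x)\<^sup>2 * inverse ((norm x)\<^sup>2)) \<longlonglongrightarrow> (u x)\<^sup>2 * inverse ((norm x)\<^sup>2)"
      by (intro tendsto_intros elim)
    then have "(\<lambda>n. ennreal ((f n x)\<^sup>2 / (norm x)\<^sup>2)) \<longlonglongrightarrow> ennreal ((u x)\<^sup>2 / (norm x)\<^sup>2)"
      by (simp only: divide_inverse tendsto_ennrealI)
    from lim_imp_Liminf[OF _ this] show ?case by simp
  qed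
  then have "(\<integral>\<^sup>+x. ennreal ((u x)\<^sup>2 / (norm x)\<^sup>2) \<partial>lebesgue_on \<Omega>)
     \<le> (\<integral>\<^sup>+x. liminf (\<lambda>n. ennreal ((f n x)\<^sup>2 / (norm x)\<^sup>2)) \<partial>lebesgue_on \<Omega>)"
    by (rule nn_integral_mono_AE)
  also have "\<dots> \<le> liminf (\<lambda>n. \<integral>\<^sup>+x. ennreal ((f n x)\<^sup>2 / (norm x)\<^sup>2) \<partial>lebesgue_on \<Omega>)"
    by (rule nn_integral_liminf) measurable
  finally show ?thesis .
qed

lemma power2_norm_le_eps:
  fixes x y :: "'b::real_inner"
  assumes "e > 0"
  shows "(norm x)\<^sup>2 \<le> (1 + e) * (norm y)\<^sup>2 + (1 + 1 / e) * (norm (y - x))\<^sup>2"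
proof -
  have "norm x \<le> norm y + norm (y - x)" using norm_triangle_ineq4[of y "y - x"] by simp
  then have "(norm x)\<^sup>2 \<le> (norm y + norm (y - x))\<^sup>2" by (intro power_mono) auto
  moreover have "2 * norm y * norm (y - x) \<le> e * (norm y)\<^sup>2 + 1 / e * (norm (y - x))\<^sup>2"
  proof -
    have "0 \<le> (e * norm y - norm (y - x))\<^sup>2 / e" using assms by simp
    also have "\<dots> = e * (norm y)\<^sup>2 + 1 / e * (norm (y - x))\<^sup>2 - 2 * norm y * norm (y - x)"
      using assms by (simp add: power2_diff power_mult_distrib field_simps power2_eq_square)
    finally show ?thesis by linarith
  qed
  ultimately show ?thesis by (simp add: power2_sum algebra_simps)
qed

text \<open>Along a subsequence the test functions converge almost everywhere, so the Lorentz norm and the Hardy term are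
  lower semicontinuous, while the Dirichlet integrals are controlled by
  \<open>power2_norm_le_eps\<close> with a small parameter \<open>e\<close>.\<close>

lemma improved_hardy_H01:
  fixes \<Omega> :: "'a::euclidean_space set"
  assumes \<Omega>: "open \<Omega>" "bounded \<Omega>" "\<Omega> \<noteq> {}" and N: "DIM('a) \<ge> 3"
    and p: "p > 0" "real DIM('a) / p - real DIM('a) / 2 + 1 > 0"
    and H01: "H01_gradient \<Omega> u g"
  shows "hardy_lorentz_ineq p (hardy_lorentz_const DIM('a) p (measure lebesgue \<Omega>)) \<Omega> u g"
proof -
  let ?M = "lebesgue_on \<Omega>"
  have lm: "\<Omega> \<in> lmeasurable" using \<Omega> by (intro lmeasurable_open)
  obtain \<phi> where \<phi>: "\<And>k::nat. \<phi> k \<in> test_functions \<Omega>"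
    and conv: "(\<lambda>k. (\<integral>x. (u x - \<phi> k x)\<^sup>2 \<partial>?M) + (\<integral>x. (norm (g x - gradient (\<phi> k) x))\<^sup>2 \<partial>?M)) \<longlonglongrightarrow> 0"
    using H01 unfolding H01_gradient_def by blast
  have su: "square_integrable_on u \<Omega>" and sg: "square_integrable_on g \<Omega>"
    using H01 unfolding H01_gradient_def H1_gradient_def by auto
  have um: "u \<in> borel_measurable ?M" and gm: "g \<in> borel_measurable ?M" and gi: "integrable ?M (\<lambda>x. (norm (g x))\<^sup>2)"
    using su sg by (auto simp: square_integrable_on_def)
  note \<phi>m = test_function_measurable[OF \<phi>, THEN borel_measurable_lebesgue_onI, of _ \<Omega>]
  define e1 where "e1 k = (\<integral>x. (u x - \<phi> k x)\<^sup>2 \<partial>?M)" for k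
  define e2 where "e2 k = (\<integral>x. (norm (g x - gradient (\<phi> k) x))\<^sup>2 \<partial>?M)" for k
  have e0: "e1 k \<ge> 0" "e2 k \<ge> 0" for k unfolding e1_def e2_def by simp_all
  have conv': "(\<lambda>k. e1 k + e2 k) \<longlonglongrightarrow> 0" using conv by (simp add: e1_def e2_def)
  have e1: "e1 \<longlonglongrightarrow> 0"
    by (rule tendsto_sandwich[OF _ _ tendsto_const conv']) (use e0 in auto)
  have e2: "e2 \<longlonglongrightarrow> 0"
    by (rule tendsto_sandwich[OF _ _ tendsto_const conv']) (use e0 in auto)
  have i1: "integrable ?M (\<lambda>x. (u x - \<phi> k x)\<^sup>2)" for k
    using square_integrable_diff[OF su square_integrable_test_function(1)[OF lm \<phi>], of k] by simp
  have i2: "integrable ?M (\<lambda>x. (norm (g x - gradient (\<phi> k) x))\<^sup>2)" for k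
    by (rule square_integrable_diff[OF sg square_integrable_test_function(2)[OF lm \<phi>]])
  have "\<exists>r. strict_mono r \<and> (AE x in ?M. (\<lambda>n. (u x - \<phi> (r n) x)\<^sup>2) \<longlonglongrightarrow> 0)"
    by (rule tendsto_L1_AE_subseq[OF i1]) (use e1 in \<open>simp add: e1_def[abs_def]\<close>)
  then obtain r where r: "strict_mono r" and ae: "AE x in ?M. (\<lambda>n. (u x - \<phi> (r n) x)\<^sup>2) \<longlonglongrightarrow> 0" by blast
  have lim: "AE x in ?M. (\<lambda>n. \<phi> (r n) x) \<longlonglongrightarrow> u x"
    using ae
  proof eventually_elim
    case (elim x)
    have "(\<lambda>n. sqrt ((u x - \<phi> (r n) x)\<^sup>2)) \<longlonglongrightarrow> sqrt 0" by (intro tendsto_real_sqrt elim)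
    then have "(\<lambda>n. u x - \<phi> (r n) x) \<longlonglongrightarrow> 0" by (simp add: tendsto_rabs_zero_iff)
    from tendsto_diff[OF tendsto_const[of "u x"] this] show ?case by simp
  qed
  define C where "C = hardy_lorentz_const DIM('a) p (measure lebesgue \<Omega>)"
  have C: "C > 0" unfolding C_def
    by (rule hardy_lorentz_const_pos) (use p measure_open_pos[OF \<Omega>(1,3,2)] in auto)
  define G where "G = (\<integral>x. (norm (g x))\<^sup>2 \<partial>?M)"
  have G: "(\<integral>\<^sup>+x. ennreal ((norm (g x))\<^sup>2) \<partial>?M) = ennreal G" "G \<ge> 0"
    using gi unfolding G_def by (auto intro!: nn_integral_eq_integral AE_I2)
  define k where "k = (real DIM('a) - 2)\<^sup>2 / 4"
  have test: "ennreal C * (lorentz_norm \<Omega> p 1 (\<phi> n))\<^sup>2 + ennreal k * (\<integral>\<^sup>+x. ennreal ((\<phi> n x)\<^sup>2 / (norm x)\<^sup>2) \<partial>?M)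
      \<le> ennreal ((1 + e) * G + (1 + 1 / e) * e2 n)" if e: "e > 0" for e n
  proof -
    have "ennreal C * (lorentz_norm \<Omega> p 1 (\<phi> n))\<^sup>2 + ennreal k * (\<integral>\<^sup>+x. ennreal ((\<phi> n x)\<^sup>2 / (norm x)\<^sup>2) \<partial>?M)
      \<le> (\<integral>\<^sup>+x. ennreal ((norm (gradient (\<phi> n) x))\<^sup>2) \<partial>?M)"
      unfolding C_def k_def by (rule improved_hardy_test_function[OF \<Omega> \<phi> N p])
    also have "\<dots> \<le> (\<integral>\<^sup>+x. ennreal ((1 + e) * (norm (g x))\<^sup>2 + (1 + 1 / e) * (norm (g x - gradient (\<phi> n) x))\<^sup>2) \<partial>?M)"
      by (intro nn_integral_mono ennreal_leI power2_norm_le_eps e)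
    also have "\<dots> = ennreal (\<integral>x. (1 + e) * (norm (g x))\<^sup>2 + (1 + 1 / e) * (norm (g x - gradient (\<phi> n) x))\<^sup>2 \<partial>?M)"
      using e gi i2 by (intro nn_integral_eq_integral AE_I2) auto
    also have "(\<integral>x. (1 + e) * (norm (g x))\<^sup>2 + (1 + 1 / e) * (norm (g x - gradient (\<phi> n) x))\<^sup>2 \<partial>?M) = (1 + e) * G + (1 + 1 / e) * e2 n"
      using gi i2 by (simp add: G_def e2_def)
    finally show ?thesis .
  qed
  have lower: "lorentz_norm \<Omega> p 1 u \<le> liminf (\<lambda>n. lorentz_norm \<Omega> p 1 (\<phi> (r n)))"
    by (rule lorentz_norm_lower_semicontinuous[OF lm um \<phi>m(1) lim p(1)])
  have lower': "(\<integral>\<^sup>+x. ennreal ((u x)\<^sup>2 / (norm x)\<^sup>2) \<partial>?M) \<le> liminf (\<lambda>n. \<integral>\<^sup>+x. ennreal ((\<phi> (r n) x)\<^sup>2 / (norm x)\<^sup>2) \<partial>?M)"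
    by (rule hardy_term_lower_semicontinuous[OF \<phi>m(1) lim])
  have "ennreal C * (lorentz_norm \<Omega> p 1 u)\<^sup>2 + ennreal k * (\<integral>\<^sup>+x. ennreal ((u x)\<^sup>2 / (norm x)\<^sup>2) \<partial>?M) \<le> ennreal G"
  proof (rule ennreal_le_epsilon)
    fix d :: real assume d: "0 < d"
    define e where "e = d / (G + 1)"
    have e: "e > 0" "e * (G + 1) = d" using d G(2) by (auto simp: e_def)
    have "(\<lambda>n. (1 + 1 / e) * e2 (r n)) \<longlonglongrightarrow> (1 + 1 / e) * 0"
      using LIMSEQ_subseq_LIMSEQ[OF e2 r] by (intro tendsto_intros) (simp add: o_def)
    then have "eventually (\<lambda>n. (1 + 1 / e) * e2 (r n) < e) sequentially" using e by (intro order_tendstoD(2)) auto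
    then have "eventually (\<lambda>n. ennreal C * (lorentz_norm \<Omega> p 1 (\<phi> (r n)))\<^sup>2 + ennreal k * (\<integral>\<^sup>+x. ennreal ((\<phi> (r n) x)\<^sup>2 / (norm x)\<^sup>2) \<partial>?M)
      \<le> ennreal (G + d)) sequentially"
    proof eventually_elim
      case (elim n)
      have "(1 + e) * G + (1 + 1 / e) * e2 (r n) \<le> G + e * (G + 1)" using elim by (simp add: algebra_simps)
      then have "ennreal ((1 + e) * G + (1 + 1 / e) * e2 (r n)) \<le> ennreal (G + d)" unfolding e(2) by (rule ennreal_leI)
      with test[OF e(1), of "r n"] show ?case by (rule order_trans)
    qed
    from liminf_quadratic_le[OF lower lower' _ _ this]
    show "ennreal C * (lorentz_norm \<Omega> p 1 u)\<^sup>2 + ennreal k * (\<integral>\<^sup>+x. ennreal ((u x)\<^sup>2 / (norm x)\<^sup>2) \<partial>?M) \<le> ennreal G + ennreal d"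
      using d G(2) by simp
  qed
  then show ?thesis
    using G unfolding C_def[symmetric] k_def by (subst hardy_lorentz_ineq_iff[OF C N]) auto
qed

section \<open>Smooth functions and integration by parts\<close>

lemma Ck_SucI:
  assumes "\<And>x. (f has_derivative f' x) (at x)" "\<And>v. Ck k (\<lambda>x. f' x v)"
  shows "Ck (Suc k) f"
proof -
  have "frechet_derivative f (at x) = f' x" for x using assms(1) by (rule frechet_derivative_at[symmetric])
  then show ?thesis using assms by (auto simp: differentiable_def)
qed

lemma Ck_has_derivative:
  assumes "Ck (Suc k) f"
  shows "(f has_derivative frechet_derivative f (at x)) (at x)" "Ck k (\<lambda>x. frechet_derivative f (at x) v)"
  using assms by (simp_all add: frechet_derivative_works[symmetric])

lemma Ck_imp_continuous:
  assumes "Ck k f"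
  shows "continuous_on UNIV f"
proof (cases k)
  case 0
  then show ?thesis using assms by simp
next
  case (Suc j)
  then have "(f has_derivative frechet_derivative f (at x)) (at x)" for x using assms Ck_has_derivative by blast
  then show ?thesis by (intro continuous_at_imp_continuous_on ballI has_derivative_continuous)
qed

lemma Ck_Suc_imp_Ck: "Ck (Suc k) f \<Longrightarrow> Ck k f"
proof (induction k arbitrary: f)
  case 0
  then show ?case using Ck_imp_continuous[OF 0] by simp
next
  case (Suc k)
  show ?case
    by (rule Ck_SucI[OF Ck_has_derivative(1)[OF Suc.prems] Suc.IH[OF Ck_has_derivative(2)[OF Suc.prems]]])
qed

lemma Ck_const: "Ck k (\<lambda>x. c)"
proof (induction k arbitrary: c)
  case (Suc k)
  show ?case by (rule Ck_SucI[where f' = "\<lambda>_ _. 0"]) (auto intro: Suc.IH)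
qed simp

lemma Ck_add: "Ck k f \<Longrightarrow> Ck k g \<Longrightarrow> Ck k (\<lambda>x. f x + g x)"
proof (induction k arbitrary: f g)
  case 0
  then show ?case by (auto intro: continuous_intros)
next
  case (Suc k)
  show ?case
    by (rule Ck_SucI[OF has_derivative_add[OF Ck_has_derivative(1)[OF Suc.prems(1)] Ck_has_derivative(1)[OF Suc.prems(2)]]])
       (intro Suc.IH Ck_has_derivative(2) Suc.prems)
qed

lemma Ck_mult: "Ck k f \<Longrightarrow> Ck k g \<Longrightarrow> Ck k (\<lambda>x. f x * g x)"
proof (induction k arbitrary: f g)
  case 0
  then show ?case by (auto intro: continuous_intros)
next
  case (Suc k)
  show ?case
    by (rule Ck_SucI[OF has_derivative_mult[OF Ck_has_derivative(1)[OF Suc.prems(1)] Ck_has_derivative(1)[OF Suc.prems(2)]]])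
       (intro Ck_add Suc.IH Ck_has_derivative(2) Suc.prems Ck_Suc_imp_Ck)
qed

lemma Ck_linear:
  assumes "bounded_linear f"
  shows "Ck k f"
proof (cases k)
  case 0
  then show ?thesis using assms by (simp add: linear_continuous_on)
next
  case (Suc j)
  then show ?thesis
    using Ck_SucI[OF bounded_linear_imp_has_derivative[OF assms] Ck_const] by simp
qed

lemma Ck_norm_square: "Ck k (\<lambda>x. (norm x)\<^sup>2)"
proof (cases k)
  case 0
  then show ?thesis by (auto intro: continuous_intros)
next
  case (Suc j)
  have "((\<lambda>x. (norm x)\<^sup>2) has_derivative (\<lambda>h. 2 * (x \<bullet> h))) (at x)" for x :: 'a
    unfolding power2_norm_eq_inner by (auto intro!: derivative_eq_intros simp: inner_commute)
  moreover have "Ck j (\<lambda>x::'a. 2 * (x \<bullet> v))" for v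
    by (intro Ck_mult Ck_const Ck_linear bounded_linear_inner_left)
  ultimately show ?thesis unfolding Suc by (rule Ck_SucI)
qed

lemma Ck_powr:
  assumes "\<And>k. Ck k \<phi>" "\<And>x. \<phi> x > 0"
  shows "Ck k (\<lambda>x. \<phi> x powr a)"
proof (induction k arbitrary: a)
  case 0
  show ?case using Ck_imp_continuous[OF assms(1)] assms(2)
    by (auto intro!: continuous_on_powr continuous_intros simp: less_imp_neq[symmetric])
next
  case (Suc k)
  have "((\<lambda>x. \<phi> x powr a) has_derivative (\<lambda>v. (a * \<phi> x powr (a - 1)) * frechet_derivative \<phi> (at x) v)) (at x)" for x
  proof -
    have "((\<lambda>s. s powr a) has_derivative (\<lambda>h. (a * \<phi> x powr (a - 1)) * h)) (at (\<phi> x))"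
      using has_real_derivative_powr[where z = "\<phi> x" and r = a, OF assms(2)] by (simp add: has_field_derivative_def)
    from has_derivative_compose[OF Ck_has_derivative(1)[OF assms(1)] this] show ?thesis .
  qed
  then show ?case
    by (rule Ck_SucI) (intro Ck_mult Ck_const Suc.IH Ck_has_derivative(2) assms(1))
qed

text \<open>The classical flat function \<open>exp (- 1 / w)\<close> together with its quotients by powers of \<open>w\<close>: derivatives of members of
  the family are linear combinations of members, which makes smoothness an induction on the order.\<close>

definition flat :: "nat \<Rightarrow> real \<Rightarrow> real" where
  "flat i w = (if w > 0 then exp (- 1 / w) / w ^ i else 0)"

lemma flat_tendsto_0: "(flat i \<longlongrightarrow> 0) (at 0)"
proof -
  have "((\<lambda>y::real. y ^ i / exp y) \<longlongrightarrow> 0) at_top" by (rule tendsto_power_div_exp_0)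
  then have "((\<lambda>w::real. inverse w ^ i / exp (inverse w)) \<longlongrightarrow> 0) (at_right 0)"
    by (rule filterlim_compose[OF _ filterlim_inverse_at_top_right])
  moreover have "eventually (\<lambda>w. inverse w ^ i / exp (inverse w) = flat i w) (at_right 0)"
    unfolding eventually_at_right_field
    by (intro exI[of _ 1]) (auto simp: flat_def exp_minus field_simps power_inverse inverse_eq_divide)
  ultimately have "(flat i \<longlongrightarrow> 0) (at_right 0)" by (rule Lim_transform_eventually)
  moreover have "(flat i \<longlongrightarrow> 0) (at_left 0)"
  proof (rule Lim_transform_eventually[OF tendsto_const])
    show "eventually (\<lambda>w. 0 = flat i w) (at_left 0)"
      unfolding eventually_at_left_field by (intro exI[of _ "-1"]) (auto simp: flat_def)
  qed
  ultimately show ?thesis by (simp add: filterlim_split_at)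
qed

lemma flat_has_derivative:
  "(flat i has_real_derivative (flat (Suc (Suc i)) w - real i * flat (Suc i) w)) (at w)"
proof -
  consider "w > 0" | "w < 0" | "w = 0" by linarith
  then show ?thesis
  proof cases
    case 1
    have "((\<lambda>w. exp (- 1 / w) / w ^ i) has_real_derivative
       (exp (- 1 / w) * (1 / w\<^sup>2) * w ^ i - exp (- 1 / w) * (real i * w ^ (i - 1))) / (w ^ i * w ^ i)) (at w)"
      using 1 by (auto intro!: derivative_eq_intros simp: power2_eq_square)
    also have "(exp (- 1 / w) * (1 / w\<^sup>2) * w ^ i - exp (- 1 / w) * (real i * w ^ (i - 1))) / (w ^ i * w ^ i)
        = flat (Suc (Suc i)) w - real i * flat (Suc i) w"
      using 1 by (cases i) (simp_all add: flat_def field_simps power2_eq_square)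
    finally show ?thesis
      by (rule has_field_derivative_transform_within_open[where S = "{0<..}"]) (use 1 in \<open>auto simp: flat_def\<close>)
  next
    case 2
    have "((\<lambda>w. 0) has_real_derivative 0) (at w)" by simp
    then have "(flat i has_real_derivative 0) (at w)"
      by (rule has_field_derivative_transform_within_open[where S = "{..<0}"]) (use 2 in \<open>auto simp: flat_def\<close>)
    then show ?thesis using 2 by (simp add: flat_def)
  next
    case 3
    have "eventually (\<lambda>w. flat (Suc i) w = (flat i w - flat i 0) / (w - 0)) (at 0)"
      unfolding eventually_at by (intro exI[of _ 1]) (auto simp: flat_def)
    from Lim_transform_eventually[OF flat_tendsto_0 this]
    have "(flat i has_real_derivative 0) (at 0)" by (simp add: has_field_derivative_iff)
    then show ?thesis using 3 by (simp add: flat_def)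
  qed
qed

lemma Ck_flat:
  assumes "\<And>k. Ck k \<phi>"
  shows "Ck k (\<lambda>x. flat i (\<phi> x))"
proof (induction k arbitrary: i)
  case 0
  have "continuous_on UNIV (flat i)"
    using flat_has_derivative DERIV_isCont by (blast intro: continuous_at_imp_continuous_on)
  from continuous_on_compose2[OF this Ck_imp_continuous[OF assms]] show ?case by simp
next
  case (Suc k)
  have "((\<lambda>x. flat i (\<phi> x)) has_derivative
      (\<lambda>v. (flat (Suc (Suc i)) (\<phi> x) + - real i * flat (Suc i) (\<phi> x)) * frechet_derivative \<phi> (at x) v)) (at x)" for x
    using has_derivative_compose[OF Ck_has_derivative(1)[OF assms] flat_has_derivative[unfolded has_field_derivative_def]]
    by simp
  then show ?case
    by (rule Ck_SucI) (intro Ck_mult Ck_add Ck_const Suc.IH Ck_has_derivative(2) assms)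
qed

text \<open>The integral of a difference quotient vanishes by translation invariance of Lebesgue measure; the
  quotients are dominated because \<open>\<phi>\<close> is Lipschitz with compact support.\<close>

lemma integral_gradient_eq_0:
  fixes \<phi> :: "'a::euclidean_space \<Rightarrow> real"
  assumes \<phi>: "\<phi> \<in> test_functions \<Omega>"
  shows "(\<integral>x. gradient \<phi> x \<bullet> b \<partial>lborel) = 0"
proof -
  obtain M where M: "M > 0" "\<And>x. norm x \<ge> M \<Longrightarrow> \<phi> x = 0" "\<And>x. norm x \<ge> M \<Longrightarrow> gradient \<phi> x = 0"
    by (rule test_function_support_ball[OF \<phi>]) blast
  obtain L where L: "\<And>x. norm (gradient \<phi> x) \<le> L" by (rule norm_gradient_bounded[OF \<phi>]) blast
  obtain B where B: "B > 0" "\<And>x. \<bar>\<phi> x\<bar> \<le> B" by (rule test_function_bounded[OF \<phi>]) blast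
  note [measurable] = test_function_measurable[OF \<phi>]
  have L0: "L \<ge> 0" using L[of 0] norm_ge_zero order_trans by blast
  have ball: "integrable lborel (\<lambda>x. c * indicator (ball (0::'a) r) x)" for c r :: real
    using emeasure_lborel_ball_finite[of "0::'a" r] by (intro integrable_mult_right integrable_real_indicator) auto
  have int: "integrable lborel \<phi>"
    by (rule Bochner_Integration.integrable_bound[OF ball[of B M]])
       (use B M in \<open>auto intro!: AE_I2 simp: indicator_def not_less\<close>)
  have shift: "integrable lborel (\<lambda>x. \<phi> (c + x))" "(\<integral>x. \<phi> (c + x) \<partial>lborel) = (\<integral>x. \<phi> x \<partial>lborel)" for c
  proof -
    have "integrable (distr lborel borel ((+) c)) \<phi>"
      unfolding lborel_distr_plus using int .
    then show "integrable lborel (\<lambda>x. \<phi> (c + x))" by (subst (asm) integrable_distr_eq) auto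
    have "(\<integral>x. \<phi> x \<partial>distr lborel borel ((+) c)) = (\<integral>x. \<phi> (c + x) \<partial>lborel)"
      by (rule integral_distr) auto
    then show "(\<integral>x. \<phi> (c + x) \<partial>lborel) = (\<integral>x. \<phi> x \<partial>lborel)" unfolding lborel_distr_plus by simp
  qed
  define q where "q n x = (\<phi> ((1 / real (Suc n)) *\<^sub>R b + x) - \<phi> x) * real (Suc n)" for n x
  have lip: "\<bar>\<phi> y - \<phi> x\<bar> \<le> L * norm (y - x)" for x y
  proof -
    have "norm (\<phi> y - \<phi> x) \<le> L * norm (y - x)"
    proof (rule differentiable_bound[where S = UNIV and f' = "\<lambda>z h. gradient \<phi> z \<bullet> h"])
      fix z :: 'a
      show "(\<phi> has_derivative (\<lambda>h. gradient \<phi> z \<bullet> h)) (at z within UNIV)"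
        by (rule test_function_differentiable[OF \<phi>])
      have "onorm (\<lambda>h. gradient \<phi> z \<bullet> h) \<le> norm (gradient \<phi> z)"
        by (rule onorm_le) (simp add: Cauchy_Schwarz_ineq2)
      then show "onorm (\<lambda>h. gradient \<phi> z \<bullet> h) \<le> L" using L[of z] by linarith
    qed auto
    then show ?thesis by simp
  qed
  have "(\<lambda>n. \<integral>x. q n x \<partial>lborel) \<longlonglongrightarrow> (\<integral>x. gradient \<phi> x \<bullet> b \<partial>lborel)"
  proof (rule integral_dominated_convergence[where w = "\<lambda>x. (L * norm b) * indicator (ball 0 (M + norm b)) x"])
    show "integrable lborel (\<lambda>x. (L * norm b) * indicator (ball (0::'a) (M + norm b)) x)" by (rule ball)
    show "AE x in lborel. (\<lambda>n. q n x) \<longlonglongrightarrow> gradient \<phi> x \<bullet> b"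
    proof (rule AE_I2)
      fix x
      have "((\<lambda>t. t *\<^sub>R b + x) has_derivative (\<lambda>t. t *\<^sub>R b)) (at (0::real))"
        by (auto intro!: derivative_eq_intros)
      from has_derivative_compose[OF this test_function_differentiable[OF \<phi>]]
      have "((\<lambda>t. \<phi> (t *\<^sub>R b + x)) has_derivative (\<lambda>t. gradient \<phi> x \<bullet> (t *\<^sub>R b))) (at (0::real))" by simp
      then have "((\<lambda>t. \<phi> (t *\<^sub>R b + x)) has_real_derivative (gradient \<phi> x \<bullet> b)) (at 0)"
      proof -
        have "(\<lambda>t. gradient \<phi> x \<bullet> (t *\<^sub>R b)) = (*) (gradient \<phi> x \<bullet> b)" by (simp add: fun_eq_iff)
        then show "((\<lambda>t. \<phi> (t *\<^sub>R b + x)) has_derivative (\<lambda>t. gradient \<phi> x \<bullet> (t *\<^sub>R b))) (at 0) \<Longrightarrow>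
            ((\<lambda>t. \<phi> (t *\<^sub>R b + x)) has_real_derivative (gradient \<phi> x \<bullet> b)) (at 0)"
          by (simp add: has_field_derivative_def)
      qed
      then have "((\<lambda>t. (\<phi> (t *\<^sub>R b + x) - \<phi> x) / t) \<longlongrightarrow> gradient \<phi> x \<bullet> b) (at 0)"
        by (simp add: has_field_derivative_iff)
      moreover have "filterlim (\<lambda>n. 1 / real (Suc n)) (at 0) sequentially"
        unfolding filterlim_at using LIMSEQ_Suc[OF lim_1_over_n] by (auto intro: always_eventually)
      ultimately have "(\<lambda>n. (\<phi> ((1 / real (Suc n)) *\<^sub>R b + x) - \<phi> x) / (1 / real (Suc n))) \<longlonglongrightarrow> gradient \<phi> x \<bullet> b"
        by (rule filterlim_compose)
      then show "(\<lambda>n. q n x) \<longlonglongrightarrow> gradient \<phi> x \<bullet> b" by (simp add: q_def)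
    qed
    fix n
    show "q n \<in> borel_measurable lborel" unfolding q_def by measurable
    show "AE x in lborel. norm (q n x) \<le> (L * norm b) * indicator (ball 0 (M + norm b)) x"
    proof (rule AE_I2)
      fix x :: 'a
      have s: "norm ((1 / real (Suc n)) *\<^sub>R b) \<le> norm b"
        using mult_right_mono[of "1 / real (Suc n)" 1 "norm b"] by (simp del: of_nat_Suc)
      show "norm (q n x) \<le> (L * norm b) * indicator (ball 0 (M + norm b)) x"
      proof (cases "norm x < M + norm b")
        case True
        have "\<bar>\<phi> ((1 / real (Suc n)) *\<^sub>R b + x) - \<phi> x\<bar> \<le> L * norm ((1 / real (Suc n)) *\<^sub>R b)"
          using lip[of "(1 / real (Suc n)) *\<^sub>R b + x" x] by simp
        then have "\<bar>\<phi> ((1 / real (Suc n)) *\<^sub>R b + x) - \<phi> x\<bar> * real (Suc n) \<le> L * norm ((1 / real (Suc n)) *\<^sub>R b) * real (Suc n)"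
          by (rule mult_right_mono) simp
        also have "\<dots> = L * norm b" by (simp del: of_nat_Suc)
        finally show ?thesis using True by (simp add: q_def abs_mult del: of_nat_Suc)
      next
        case False
        have "norm x \<le> norm ((1 / real (Suc n)) *\<^sub>R b + x) + norm ((1 / real (Suc n)) *\<^sub>R b)"
          using norm_triangle_ineq4[of "(1 / real (Suc n)) *\<^sub>R b + x" "(1 / real (Suc n)) *\<^sub>R b"] by simp
        then have "norm ((1 / real (Suc n)) *\<^sub>R b + x) \<ge> M" using s False by linarith
        moreover have "norm x \<ge> M" using False norm_ge_zero[of b] by linarith
        ultimately have "q n x = 0" unfolding q_def by (simp add: M(2))
        then show ?thesis using False by simp
      qed
    qed
  qed measurable
  moreover have "(\<integral>x. q n x \<partial>lborel) = 0" for n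
    unfolding q_def using shift int by simp
  ultimately show ?thesis by (simp add: LIMSEQ_const_iff)
qed

lemma test_function_mult:
  assumes "\<phi> \<in> test_functions \<Omega>" "\<And>k. Ck k \<psi>"
  shows "(\<lambda>x. \<phi> x * \<psi> x) \<in> test_functions \<Omega>"
proof -
  have sub: "{x. \<phi> x * \<psi> x \<noteq> 0} \<subseteq> {x. \<phi> x \<noteq> 0}" by auto
  have c: "compact (closure {x. \<phi> x \<noteq> 0})" "closure {x. \<phi> x \<noteq> 0} \<subseteq> \<Omega>" "\<And>k. Ck k \<phi>"
    using assms(1) by (simp_all add: test_functions_def)
  have "compact (closure {x. \<phi> x * \<psi> x \<noteq> 0})"
    using compact_Int_closed[OF c(1) closed_closure, of "{x. \<phi> x * \<psi> x \<noteq> 0}"] closure_mono[OF sub]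
    by (simp only: Int_absorb1)
  moreover have "closure {x. \<phi> x * \<psi> x \<noteq> 0} \<subseteq> \<Omega>" using closure_mono[OF sub] c(2) by (rule order_trans)
  moreover have "Ck k (\<lambda>x. \<phi> x * \<psi> x)" for k by (intro Ck_mult c(3) assms(2))
  ultimately show ?thesis by (simp add: test_functions_def)
qed

lemma gradient_eqI:
  assumes "\<And>h. f' h = g \<bullet> h" "(f has_derivative f') (at x)"
  shows "gradient f x = g"
proof -
  have "frechet_derivative f (at x) = f'" using assms(2) by (rule frechet_derivative_at[symmetric])
  then have "gradient f x = (\<Sum>b\<in>Basis. (g \<bullet> b) *\<^sub>R b)" by (simp add: gradient_def assms(1))
  then show ?thesis by (simp add: euclidean_representation)
qed

lemma test_function_integration_by_parts:
  fixes \<phi> \<psi> :: "'a::euclidean_space \<Rightarrow> real"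
  assumes \<Omega>: "\<Omega> \<in> sets borel" and \<phi>: "\<phi> \<in> test_functions \<Omega>" and \<psi>: "\<psi> \<in> test_functions \<Omega>"
    and fin: "\<Omega> \<in> lmeasurable"
  shows "(\<integral>x. \<phi> x * (gradient \<psi> x \<bullet> b) \<partial>lebesgue_on \<Omega>) = - (\<integral>x. (gradient \<phi> x \<bullet> b) * \<psi> x \<partial>lebesgue_on \<Omega>)"
proof -
  interpret finite_measure "lebesgue_on \<Omega>" by (rule finite_measure_lebesgue_on[OF fin])
  have prod: "(\<lambda>x. \<phi> x * \<psi> x) \<in> test_functions \<Omega>"
    using \<psi> by (intro test_function_mult[OF \<phi>]) (simp add: test_functions_def)
  have grad: "gradient (\<lambda>x. \<phi> x * \<psi> x) x = \<phi> x *\<^sub>R gradient \<psi> x + \<psi> x *\<^sub>R gradient \<phi> x" for x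
    by (rule gradient_eqI[OF _ has_derivative_mult[OF test_function_differentiable[OF \<phi>] test_function_differentiable[OF \<psi>]]])
       (simp add: inner_add_left)
  have "(\<integral>x. gradient (\<lambda>x. \<phi> x * \<psi> x) x \<bullet> b \<partial>lebesgue_on \<Omega>) = (\<integral>x. indicator \<Omega> x *\<^sub>R (gradient (\<lambda>x. \<phi> x * \<psi> x) x \<bullet> b) \<partial>lebesgue)"
    using \<Omega> by (subst integral_restrict_space) auto
  also have "\<dots> = (\<integral>x. gradient (\<lambda>x. \<phi> x * \<psi> x) x \<bullet> b \<partial>lebesgue)"
    by (intro Bochner_Integration.integral_cong refl) (simp add: test_function_outside(2)[OF prod] split: split_indicator)
  also have "\<dots> = (\<integral>x. gradient (\<lambda>x. \<phi> x * \<psi> x) x \<bullet> b \<partial>lborel)"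
    using test_function_measurable(2)[OF prod] by (intro integral_completion) simp
  also have "\<dots> = 0" by (rule integral_gradient_eq_0[OF prod])
  finally have 0: "(\<integral>x. \<phi> x * (gradient \<psi> x \<bullet> b) + (gradient \<phi> x \<bullet> b) * \<psi> x \<partial>lebesgue_on \<Omega>) = 0"
    by (simp add: grad inner_add_left mult.commute)
  note m = test_function_measurable[OF \<phi>, THEN borel_measurable_lebesgue_onI, of \<Omega>]
    test_function_measurable[OF \<psi>, THEN borel_measurable_lebesgue_onI, of \<Omega>]
  note [measurable] = m
  obtain B where B: "B > 0" "\<And>x. \<bar>\<phi> x\<bar> \<le> B" by (rule test_function_bounded[OF \<phi>]) blast
  obtain B' where B': "B' > 0" "\<And>x. \<bar>\<psi> x\<bar> \<le> B'" by (rule test_function_bounded[OF \<psi>]) blast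
  obtain L where L: "\<And>x. norm (gradient \<phi> x) \<le> L" by (rule norm_gradient_bounded[OF \<phi>]) blast
  obtain L' where L': "\<And>x. norm (gradient \<psi> x) \<le> L'" by (rule norm_gradient_bounded[OF \<psi>]) blast
  have in_le: "\<bar>y \<bullet> b\<bar> \<le> l * norm b" if "norm y \<le> l" for y :: 'a and l
    using Cauchy_Schwarz_ineq2[of y b] mult_right_mono[OF that, of "norm b"] by simp
  have "integrable (lebesgue_on \<Omega>) (\<lambda>x. \<phi> x * (gradient \<psi> x \<bullet> b))"
  proof (rule integrable_const_bound[where B = "B * (L' * norm b)"])
    show "AE x in lebesgue_on \<Omega>. norm (\<phi> x * (gradient \<psi> x \<bullet> b)) \<le> B * (L' * norm b)"
      using B L' by (intro AE_I2) (simp add: abs_mult mult_mono in_le)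
  qed measurable
  moreover have "integrable (lebesgue_on \<Omega>) (\<lambda>x. (gradient \<phi> x \<bullet> b) * \<psi> x)"
  proof (rule integrable_const_bound[where B = "(L * norm b) * B'"])
    have "0 \<le> L" using L[of 0] norm_ge_zero order_trans by blast
    then show "AE x in lebesgue_on \<Omega>. norm ((gradient \<phi> x \<bullet> b) * \<psi> x) \<le> (L * norm b) * B'"
      using B' L by (intro AE_I2) (simp add: abs_mult mult_mono in_le)
  qed measurable
  ultimately show ?thesis using 0 by simp
qed

lemma test_function_H01:
  fixes \<Omega> :: "'a::euclidean_space set"
  assumes \<Omega>: "open \<Omega>" "bounded \<Omega>" and \<phi>: "\<phi> \<in> test_functions \<Omega>"
  shows "H01_gradient \<Omega> \<phi> (gradient \<phi>)"
proof -
  have lm: "\<Omega> \<in> lmeasurable" using \<Omega> by (intro lmeasurable_open)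
  have loc: "locally_integrable_on \<phi> \<Omega>" "locally_integrable_on (gradient \<phi>) \<Omega>"
    unfolding locally_integrable_on_def
  proof (safe)
    fix K :: "'a set" assume K: "compact K"
    interpret finite_measure "lebesgue_on K" by (rule finite_measure_lebesgue_on[OF lmeasurable_compact[OF K]])
    note m = test_function_measurable[OF \<phi>, THEN borel_measurable_lebesgue_onI, of K]
    obtain B where B: "B > 0" "\<And>x. \<bar>\<phi> x\<bar> \<le> B" by (rule test_function_bounded[OF \<phi>]) blast
    obtain L where L: "\<And>x. norm (gradient \<phi> x) \<le> L" by (rule norm_gradient_bounded[OF \<phi>]) blast
    show "integrable (lebesgue_on K) \<phi>" by (rule integrable_const_bound[where B = B]) (use B m in auto)
    show "integrable (lebesgue_on K) (gradient \<phi>)" by (rule integrable_const_bound[where B = L]) (use L m in auto)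
  qed
  have "weak_gradient \<Omega> \<phi> (gradient \<phi>)"
    unfolding weak_gradient_def using loc test_function_integration_by_parts[OF _ \<phi> _ lm] \<Omega>(1) by auto
  then have "H1_gradient \<Omega> \<phi> (gradient \<phi>)"
    unfolding H1_gradient_def using square_integrable_test_function[OF lm \<phi>] by simp
  then show ?thesis unfolding H01_gradient_def using \<phi> by (intro conjI exI[of _ "\<lambda>_. \<phi>"]) auto
qed

section \<open>Smooth near-extremal functions\<close>

text \<open>As a function of \<open>s = (norm x)\<^sup>2\<close>, with \<open>q = (b - k) / 2\<close>, \<open>d = (\<gamma> - k) / 2\<close> and
  \<open>A = R powr (\<gamma> - k)\<close>, this is the function \<open>r powr (- b) * (A * r powr k - r powr \<gamma>)\<close> of \<open>r = norm x\<close>.\<close>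

definition profile :: "real \<Rightarrow> real \<Rightarrow> real \<Rightarrow> real \<Rightarrow> real" where
  "profile A q d s = A * s powr (- q) - s powr (d - q)"

text \<open>Minus the derivative of the profile (\<open>profile_has_derivative\<close>).\<close>

definition descent :: "real \<Rightarrow> real \<Rightarrow> real \<Rightarrow> real \<Rightarrow> real" where
  "descent A q d s = q * A * s powr (- q - 1) + (d - q) * s powr (d - q - 1)"

lemma profile_has_derivative:
  assumes "s > 0"
  shows "(profile A q d has_real_derivative - descent A q d s) (at s)"
  unfolding profile_def descent_def using assms
  by (auto intro!: derivative_eq_intros simp: algebra_simps)

lemma profile_factor:
  assumes "s > 0"
  shows "profile A q d s = s powr (- q) * (A - s powr d)"
  using assms by (simp add: profile_def right_diff_distrib powr_add[symmetric] add.commute)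

lemma powr_square:
  fixes R d :: real
  assumes "R > 0"
  shows "R powr (2 * d) = (R\<^sup>2) powr d"
proof -
  have "R powr (2 * d) = (R powr 2) powr d" by (simp only: powr_powr)
  also have "R powr 2 = R\<^sup>2" using assms by simp
  finally show ?thesis .
qed

lemma profile_pos_iff:
  assumes s: "s > 0" and R: "R > 0" and d: "d > 0"
  shows "profile (R powr (2 * d)) q d s > 0 \<longleftrightarrow> s < R\<^sup>2"
proof -
  note powr_square[OF R, of d]
  moreover have "s powr d < (R\<^sup>2) powr d \<longleftrightarrow> s < R\<^sup>2"
  proof
    assume "s < R\<^sup>2"
    then show "s powr d < (R\<^sup>2) powr d" using s d by (intro powr_less_mono2) auto
  next
    assume less: "s powr d < (R\<^sup>2) powr d"
    show "s < R\<^sup>2"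
    proof (rule ccontr)
      assume "\<not> s < R\<^sup>2"
      then have "(R\<^sup>2) powr d \<le> s powr d" using d by (intro powr_mono2) auto
      with less show False by linarith
    qed
  qed
  ultimately show ?thesis using s by (simp add: profile_factor zero_less_mult_iff)
qed

lemma powr_le_radius:
  fixes s R d :: real
  assumes "s > 0" "s \<le> R\<^sup>2" "R > 0" "d > 0"
  shows "s powr d \<le> R powr (2 * d)"
proof -
  show ?thesis unfolding powr_square[OF assms(3)] using assms by (intro powr_mono2) auto
qed

lemma descent_nonneg:
  assumes s: "s > 0" "s \<le> R\<^sup>2" and R: "R > 0" and d: "d > 0" and q: "q > 0"
  shows "descent (R powr (2 * d)) q d s \<ge> 0"
proof -
  have e: "s powr (d - q - 1) = s powr (- q - 1) * s powr d"
    unfolding powr_add[symmetric] by (rule arg_cong[of _ _ "\<lambda>a. s powr a"]) simp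
  have "0 \<le> s powr (- q - 1) * (q * (R powr (2 * d) - s powr d) + d * s powr d)"
    using powr_le_radius[OF s R d] q d by (intro mult_nonneg_nonneg add_nonneg_nonneg) auto
  also have "\<dots> = descent (R powr (2 * d)) q d s" unfolding descent_def e by (simp add: algebra_simps)
  finally show ?thesis .
qed

text \<open>The profile is convex where it is nonnegative.  Since \<open>x powr d \<le> R powr (2 * d)\<close> there, the
  sign of the second derivative is governed by
  \<open>(d - q) * (d - q - 1) - q * (q + 1) = d * (d - (2 * q + 1))\<close>.
  Convexity is what makes the shift \<open>s + e\<close> in \<open>near_extremal\<close> decrease the gradient.\<close>

lemma descent_antimono:
  assumes st: "0 < s" "s \<le> t" "t \<le> R\<^sup>2" and R: "R > 0" and d: "d > 0" and q: "q > 0" "d \<le> 2 * q + 1"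
  shows "descent (R powr (2 * d)) q d t \<le> descent (R powr (2 * d)) q d s"
proof (rule DERIV_nonpos_imp_nonincreasing[OF st(2)])
  fix x assume x: "s \<le> x" "x \<le> t"
  let ?A = "R powr (2 * d)"
  have x0: "x > 0" "x \<le> R\<^sup>2" using x st by auto
  have D: "(descent ?A q d has_real_derivative
      (q * ?A * ((- q - 1) * x powr (- q - 2)) + (d - q) * ((d - q - 1) * x powr (d - q - 2)))) (at x)"
    unfolding descent_def using x0 by (auto intro!: derivative_eq_intros simp: algebra_simps)
  have e: "x powr (d - q - 2) = x powr (- q - 2) * x powr d"
    unfolding powr_add[symmetric] by (rule arg_cong[of _ _ "\<lambda>a. x powr a"]) simp
  have "(d - q) * (d - q - 1) - q * (q + 1) = d * (d - (2 * q + 1))" by (simp add: algebra_simps)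
  also have "\<dots> \<le> 0" using d q by (intro mult_nonneg_nonpos) auto
  finally have c: "(d - q) * (d - q - 1) \<le> q * (q + 1)" by simp
  have "(d - q) * (d - q - 1) * x powr d \<le> q * (q + 1) * x powr d" by (rule mult_right_mono[OF c]) simp
  also have "\<dots> \<le> q * (q + 1) * ?A" using powr_le_radius[OF x0 R d] q by (intro mult_left_mono) auto
  finally have "x powr (- q - 2) * ((d - q) * (d - q - 1) * x powr d - q * (q + 1) * ?A) \<le> 0"
    by (intro mult_nonneg_nonpos) auto
  then have "q * ?A * ((- q - 1) * x powr (- q - 2)) + (d - q) * ((d - q - 1) * x powr (d - q - 2)) \<le> 0"
    unfolding e by (simp add: algebra_simps)
  with D show "\<exists>y. (descent ?A q d has_real_derivative y) (at x) \<and> y \<le> 0" by blast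
qed

text \<open>For positive \<open>y\<close> this is \<open>y * exp (- e / y)\<close>, and it is zero otherwise: a smooth substitute for the positive part whose derivative lies
  between zero and one.\<close>

definition damp :: "real \<Rightarrow> real \<Rightarrow> real" where
  "damp e y = y * flat 0 (y / e)"

lemma damp_has_derivative:
  assumes "e > 0"
  shows "\<exists>D. (damp e has_real_derivative D) (at y) \<and> 0 \<le> D \<and> D \<le> 1 \<and> (y \<le> 0 \<longrightarrow> D = 0)"
proof (intro exI conjI)
  let ?D = "flat 0 (y / e) + y * (flat 2 (y / e) * (1 / e))"
  have "((\<lambda>y. flat 0 (y / e)) has_real_derivative (flat 2 (y / e) * (1 / e))) (at y)"
  proof -
    have "((\<lambda>y. y / e) has_real_derivative 1 / e) (at y)"
      using assms by (auto intro!: derivative_eq_intros)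
    from DERIV_chain2[where f = "flat 0" and g = "\<lambda>y. y / e", OF flat_has_derivative this]
    show ?thesis by (simp add: numeral_2_eq_2)
  qed
  then show "(damp e has_real_derivative ?D) (at y)"
    unfolding damp_def by (auto intro!: derivative_eq_intros)
  have pos: "?D = exp (- (e / y)) * (1 + e / y)" if "y > 0"
    using that assms by (simp add: flat_def field_simps power2_eq_square)
  show "0 \<le> ?D"
  proof (cases "y > 0")
    case True
    then show ?thesis unfolding pos[OF True] using assms by simp
  qed (use assms in \<open>simp add: flat_def zero_less_divide_iff\<close>)
  show "?D \<le> 1"
  proof (cases "y > 0")
    case True
    have "exp (- (e / y)) * (1 + e / y) \<le> exp (- (e / y)) * exp (e / y)"
      by (intro mult_left_mono exp_ge_add_one_self) simp
    then show ?thesis unfolding pos[OF True] by (simp add: exp_minus)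
  qed (use assms in \<open>simp add: flat_def zero_less_divide_iff\<close>)
  show "y \<le> 0 \<longrightarrow> ?D = 0" using assms by (auto simp: flat_def zero_less_divide_iff)
qed

text \<open>The shift by \<open>e\<close> removes the singularity at the origin, and damping cuts the function off where the
  shifted profile vanishes, which is inside the ball of radius \<open>R\<close>.\<close>

definition near_extremal :: "real \<Rightarrow> real \<Rightarrow> real \<Rightarrow> real \<Rightarrow> 'a::euclidean_space \<Rightarrow> real" where
  "near_extremal R q d e x = damp e (profile (R powr (2 * d)) q d ((norm x)\<^sup>2 + e))"

lemma near_extremal_test_function:
  assumes R: "R > 0" and d: "d > 0" and e: "e > 0"
  shows "near_extremal R q d e \<in> test_functions (ball (0::'a::euclidean_space) R)"
proof -
  let ?u = "near_extremal R q d e :: 'a \<Rightarrow> real"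
  have s: "Ck k (\<lambda>x::'a. (norm x)\<^sup>2 + e)" for k by (intro Ck_add Ck_norm_square Ck_const)
  have pos: "(norm x)\<^sup>2 + e > 0" for x :: 'a using e by (intro add_nonneg_pos) auto
  have P: "Ck k (\<lambda>x::'a. c * ((norm x)\<^sup>2 + e) powr a)" for k a c
    by (rule Ck_mult[OF Ck_const]) (rule Ck_powr[OF s pos])
  define V where "V x = profile (R powr (2 * d)) q d ((norm x)\<^sup>2 + e)" for x :: 'a
  have V_eq: "V = (\<lambda>x. R powr (2 * d) * ((norm x)\<^sup>2 + e) powr (- q) + (- 1) * ((norm x)\<^sup>2 + e) powr (d - q))"
    unfolding V_def profile_def by (rule ext) simp
  have V: "Ck k V" for k unfolding V_eq by (rule Ck_add) (rule P)+
  have V': "Ck k (\<lambda>x. V x * (1 / e))" for k by (rule Ck_mult[OF V]) (rule Ck_const)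
  have F: "Ck k (\<lambda>x. flat 0 (V x * (1 / e)))" for k by (rule Ck_flat) (rule V')
  have u: "?u = (\<lambda>x. V x * flat 0 (V x * (1 / e)))"
    unfolding near_extremal_def[abs_def] damp_def V_def by (rule ext) simp
  have Ck: "Ck k ?u" for k unfolding u by (rule Ck_mult[OF V]) (rule F)
  have "{x. ?u x \<noteq> 0} \<subseteq> {x. (norm x)\<^sup>2 + e \<le> R\<^sup>2}"
  proof
    fix x assume "x \<in> {x. ?u x \<noteq> 0}"
    then have "V x * flat 0 (V x * (1 / e)) \<noteq> 0" unfolding u by (rule CollectD)
    then have "flat 0 (V x * (1 / e)) \<noteq> 0" by (metis mult_zero_right)
    then have "V x * (1 / e) > 0" unfolding flat_def by presburger
    then have "V x > 0" using e by (simp add: zero_less_divide_iff)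
    then have "(norm x)\<^sup>2 + e < R\<^sup>2" unfolding V_def profile_pos_iff[OF pos R d] .
    then show "x \<in> {x. (norm x)\<^sup>2 + e \<le> R\<^sup>2}" by simp
  qed
  moreover have "closed {x::'a. (norm x)\<^sup>2 + e \<le> R\<^sup>2}" by (intro closed_Collect_le continuous_intros)
  ultimately have cl: "closure {x. ?u x \<noteq> 0} \<subseteq> {x. (norm x)\<^sup>2 + e \<le> R\<^sup>2}" by (rule closure_minimal)
  have "{x::'a. (norm x)\<^sup>2 + e \<le> R\<^sup>2} \<subseteq> ball 0 R"
  proof
    fix x :: 'a assume "x \<in> {x. (norm x)\<^sup>2 + e \<le> R\<^sup>2}"
    then have "(norm x)\<^sup>2 < R\<^sup>2" using e by simp
    then have "norm x < R" by (rule power2_less_imp_less) (use R in simp)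
    then show "x \<in> ball 0 R" by simp
  qed
  with cl have sub: "closure {x. ?u x \<noteq> 0} \<subseteq> ball 0 R" by (rule order_trans)
  then have "bounded (closure {x. ?u x \<noteq> 0})" using bounded_ball by (rule bounded_subset[rotated])
  then have "compact (closure {x. ?u x \<noteq> 0})" by (simp only: compact_eq_bounded_closed closed_closure)
  then show ?thesis unfolding test_functions_def using Ck sub by (intro CollectI conjI allI)
qed

text \<open>Neither the damping nor the shift increases the gradient, so it stays below the gradient of the
  limit profile.\<close>

lemma norm_gradient_near_extremal:
  fixes x :: "'a::euclidean_space"
  assumes R: "R > 0" and d: "d > 0" and e: "e > 0" and q: "q > 0" "d \<le> 2 * q + 1" and x: "x \<noteq> 0"
  shows "norm (gradient (near_extremal R q d e) x) \<le> 2 * norm x * descent (R powr (2 * d)) q d ((norm x)\<^sup>2) * indicator (ball 0 R) x"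
proof -
  let ?A = "R powr (2 * d)"
  let ?s = "(norm x)\<^sup>2 + e"
  have s0: "?s > 0" using e by (intro add_nonneg_pos) auto
  obtain D where D: "(damp e has_real_derivative D) (at (profile ?A q d ?s))" "0 \<le> D" "D \<le> 1"
    "profile ?A q d ?s \<le> 0 \<longrightarrow> D = 0"
    using damp_has_derivative[OF e] by blast
  have n: "((\<lambda>x. (norm x)\<^sup>2 + e) has_derivative (\<lambda>h. 2 * (x \<bullet> h))) (at x)"
    unfolding power2_norm_eq_inner by (auto intro!: derivative_eq_intros simp: inner_commute)
  have v: "((\<lambda>x. profile ?A q d ((norm x)\<^sup>2 + e)) has_derivative (\<lambda>h. - descent ?A q d ?s * (2 * (x \<bullet> h)))) (at x)"
    by (rule has_derivative_compose[OF n profile_has_derivative[OF s0, unfolded has_field_derivative_def]])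
  have "(near_extremal R q d e has_derivative (\<lambda>h. D * (- descent ?A q d ?s * (2 * (x \<bullet> h))))) (at x)"
    unfolding near_extremal_def[abs_def]
    by (rule has_derivative_compose[OF v D(1)[unfolded has_field_derivative_def]])
  then have g: "gradient (near_extremal R q d e) x = (D * (- descent ?A q d ?s * 2)) *\<^sub>R x"
    by (rule gradient_eqI[rotated]) simp
  show ?thesis
  proof (cases "?s < R\<^sup>2")
    case False
    then have "D = 0" using D(4) profile_pos_iff[OF s0 R d, of q] by auto
    moreover have "0 \<le> 2 * norm x * descent ?A q d ((norm x)\<^sup>2) * indicator (ball 0 R) x"
    proof (cases "norm x < R")
      case True
      then have "(norm x)\<^sup>2 \<le> R\<^sup>2" by (intro power_mono) auto
      then show ?thesis using descent_nonneg[of "(norm x)\<^sup>2" R d q] x R d q by simp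
    qed simp
    ultimately show ?thesis using g by simp
  next
    case True
    have "(norm x)\<^sup>2 < R\<^sup>2" using True e by simp
    then have xR: "norm x < R" by (rule power2_less_imp_less) (use R in simp)
    have sl: "0 \<le> descent ?A q d ?s" using True s0 by (intro descent_nonneg R d q) auto
    have "norm (gradient (near_extremal R q d e) x) = D * (descent ?A q d ?s * (2 * norm x))"
      using D(2) sl by (simp add: g abs_mult)
    also have "\<dots> \<le> 1 * (descent ?A q d ?s * (2 * norm x))"
      using D(3) sl by (intro mult_right_mono) auto
    also have "\<dots> \<le> 1 * (descent ?A q d ((norm x)\<^sup>2) * (2 * norm x))"
      using x e True by (intro mult_left_mono mult_right_mono descent_antimono R d q) auto
    finally show ?thesis using xR by (simp add: mult_ac)
  qed
qed

lemma near_extremal_tendsto: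
  fixes x :: "'a::euclidean_space"
  assumes R: "R > 0" and d: "d > 0" and x: "x \<noteq> 0" "norm x < R"
  shows "(\<lambda>n. near_extremal R q d (1 / real (Suc n)) x) \<longlonglongrightarrow> profile (R powr (2 * d)) q d ((norm x)\<^sup>2)"
proof -
  let ?V = "profile (R powr (2 * d)) q d"
  let ?e = "\<lambda>n. 1 / real (Suc n)"
  have e: "?e \<longlonglongrightarrow> 0" by (rule LIMSEQ_Suc[OF lim_1_over_n])
  have s0: "(norm x)\<^sup>2 > 0" using x by simp
  have "(norm x)\<^sup>2 < R\<^sup>2" using x by (intro power_strict_mono) auto
  then have V0: "?V ((norm x)\<^sup>2) > 0" using profile_pos_iff[OF s0 R d] by simp
  have s: "(\<lambda>n. (norm x)\<^sup>2 + ?e n) \<longlonglongrightarrow> (norm x)\<^sup>2"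
    using tendsto_add[OF tendsto_const[of "(norm x)\<^sup>2"] e] by simp
  have V: "(\<lambda>n. ?V ((norm x)\<^sup>2 + ?e n)) \<longlonglongrightarrow> ?V ((norm x)\<^sup>2)"
    using isCont_tendsto_compose[OF DERIV_isCont[OF profile_has_derivative[OF s0]] s] .
  have "(\<lambda>n. ?V ((norm x)\<^sup>2 + ?e n) * exp (- (?e n / ?V ((norm x)\<^sup>2 + ?e n)))) \<longlonglongrightarrow> ?V ((norm x)\<^sup>2) * exp (- (0 / ?V ((norm x)\<^sup>2)))"
    using V0 by (intro tendsto_intros V e) auto
  moreover have "eventually (\<lambda>n. ?V ((norm x)\<^sup>2 + ?e n) * exp (- (?e n / ?V ((norm x)\<^sup>2 + ?e n))) = near_extremal R q d (?e n) x) sequentially"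
    using order_tendstoD(1)[OF V V0]
  proof eventually_elim
    case (elim n)
    then show ?case by (simp add: near_extremal_def damp_def flat_def del: of_nat_Suc)
  qed
  ultimately show ?thesis by (simp add: Lim_transform_eventually)
qed

text \<open>The radial weight is decreasing because \<open>p \<ge> 1\<close>, so on each superlevel set its integral is at most
  the one over the ball of equal volume (\<open>nn_integral_powr_le_ball\<close>).\<close>

lemma lorentz_norm_ge:
  fixes \<Omega> :: "'a::euclidean_space set"
  assumes \<Omega>: "open \<Omega>" "bounded \<Omega>" and \<phi>: "\<phi> \<in> test_functions \<Omega>" and p: "p \<ge> 1"
  shows "ennreal (unit_ball_vol (real DIM('a)) powr (1 / p - 1)) * (\<integral>\<^sup>+x. ennreal (norm x powr (real DIM('a) / p - real DIM('a)) * \<bar>\<phi> x\<bar>) \<partial>lborel)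
     \<le> lorentz_norm \<Omega> p 1 \<phi>"
proof -
  let ?w = "unit_ball_vol (real DIM('a))" and ?N = "real DIM('a)"
  have lm: "\<Omega> \<in> lmeasurable" using \<Omega> by (intro lmeasurable_open)
  note [measurable] = test_function_measurable[OF \<phi>]
  have \<phi>m: "\<phi> \<in> borel_measurable (lebesgue_on \<Omega>)" by (rule borel_measurable_lebesgue_onI) measurable
  have [measurable]: "level_radius \<Omega> \<phi> \<in> borel_measurable borel" by (rule borel_measurable_level_radius[OF lm \<phi>m])
  define a where "a = ?N / p"
  have a: "a > 0" "a \<le> ?N" using p by (auto simp: a_def divide_le_eq mult_le_cancel_left1)
  have w: "?w > 0" by simp
  have "(\<integral>\<^sup>+x. ennreal (norm x powr (a - ?N) * \<bar>\<phi> x\<bar>) \<partial>lborel)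
      = (\<integral>\<^sup>+x. ennreal (norm x powr (a - ?N)) * (\<integral>\<^sup>+t. 1 * indicator {t. 0 \<le> t \<and> ennreal t < ennreal \<bar>\<phi> x\<bar>} t \<partial>lborel) \<partial>lborel)"
    unfolding mult_1 nn_integral_indicator_below by (simp add: ennreal_mult)
  also have "\<dots> = (\<integral>\<^sup>+t. 1 * indicator {0..} t * (\<integral>\<^sup>+x. ennreal (norm x powr (a - ?N)) * indicator {x. ennreal t < ennreal \<bar>\<phi> x\<bar>} x \<partial>lborel) \<partial>lborel)"
    by (rule layer_cake) measurable
  also have "\<dots> \<le> (\<integral>\<^sup>+t. ennreal (?N * ?w / a) * (indicator {0..} t * ennreal (level_radius \<Omega> \<phi> t powr a)) \<partial>lborel)"
  proof (rule nn_integral_mono)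
    fix t :: real
    show "1 * indicator {0..} t * (\<integral>\<^sup>+x. ennreal (norm x powr (a - ?N)) * indicator {x. ennreal t < ennreal \<bar>\<phi> x\<bar>} x \<partial>lborel)
       \<le> ennreal (?N * ?w / a) * (indicator {0..} t * ennreal (level_radius \<Omega> \<phi> t powr a))"
    proof (cases "t \<ge> 0")
      case True
      have eq: "{x. ennreal t < ennreal \<bar>\<phi> x\<bar>} = {x \<in> \<Omega>. \<bar>\<phi> x\<bar> > t}"
        using test_function_outside(1)[OF \<phi>] True unfolding ennreal_less_iff[OF True] by force
      have b: "{x. ennreal t < ennreal \<bar>\<phi> x\<bar>} \<in> sets borel"
      proof -
        have "{x \<in> space borel. ennreal t < ennreal \<bar>\<phi> x\<bar>} \<in> sets borel" by measurable
        then show ?thesis by simp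
      qed
      have "emeasure lborel {x. ennreal t < ennreal \<bar>\<phi> x\<bar>} = emeasure lebesgue {x. ennreal t < ennreal \<bar>\<phi> x\<bar>}" using b by simp
      also have "\<dots> = ennreal (?w * level_radius \<Omega> \<phi> t ^ DIM('a))" unfolding eq by (rule emeasure_level_set[OF lm \<phi>m])
      finally have "(\<integral>\<^sup>+x. ennreal (norm x powr (a - ?N)) * indicator {x. ennreal t < ennreal \<bar>\<phi> x\<bar>} x \<partial>lborel)
          \<le> ennreal (?N * ?w / a * level_radius \<Omega> \<phi> t powr a)"
        by (rule nn_integral_powr_le_ball[OF b _ level_radius_nonneg a])
      also have "\<dots> = ennreal (?N * ?w / a) * ennreal (level_radius \<Omega> \<phi> t powr a)"
        by (rule ennreal_mult) (use a in auto)
      finally show ?thesis using True by simp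
    qed simp
  qed
  also have "\<dots> = ennreal (?N * ?w / a) * (\<integral>\<^sup>+t. indicator {0..} t * ennreal (level_radius \<Omega> \<phi> t powr a) \<partial>lborel)"
    by (rule nn_integral_cmult) measurable
  finally have "ennreal (?w powr (1 / p - 1)) * (\<integral>\<^sup>+x. ennreal (norm x powr (a - ?N) * \<bar>\<phi> x\<bar>) \<partial>lborel)
      \<le> ennreal (?w powr (1 / p - 1)) * (ennreal (?N * ?w / a) * (\<integral>\<^sup>+t. indicator {0..} t * ennreal (level_radius \<Omega> \<phi> t powr a) \<partial>lborel))"
    by (rule mult_left_mono) simp
  also have "\<dots> = ennreal (?w powr (1 / p - 1) * (?N * ?w / a)) * (\<integral>\<^sup>+t. indicator {0..} t * ennreal (level_radius \<Omega> \<phi> t powr a) \<partial>lborel)"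
    using a w by (subst ennreal_mult) (auto simp: mult.assoc)
  also have "?w powr (1 / p - 1) * (?N * ?w / a) = ?w powr (1 / p) * p"
    using w p by (simp add: powr_diff a_def)
  finally show ?thesis using p unfolding a_def by (subst lorentz_norm_eq[OF lm \<phi>m]) auto
qed

section \<open>Optimality of the constant\<close>

lemma has_bochner_integral_ball_powr:
  assumes "a > 0" "R \<ge> 0"
  shows "has_bochner_integral lborel (\<lambda>x. norm (x::'a::euclidean_space) powr (a - real DIM('a)) * indicator (ball 0 R) x)
     (real DIM('a) * unit_ball_vol (real DIM('a)) / a * R powr a)"
proof (rule has_bochner_integral_nn_integral)
  have [measurable]: "ball (0::'a) R \<in> sets borel" by simp
  show "(\<lambda>x::'a. norm x powr (a - real DIM('a)) * indicator (ball 0 R) x) \<in> borel_measurable lborel" by measurable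
  have "(\<integral>\<^sup>+x. ennreal (norm (x::'a) powr (a - real DIM('a)) * indicator (ball 0 R) x) \<partial>lborel)
     = (\<integral>\<^sup>+x. ennreal (norm (x::'a) powr (a - real DIM('a))) * indicator (ball 0 R) x \<partial>lborel)"
    by (rule nn_integral_cong) (auto split: split_indicator)
  also have "\<dots> = ennreal (real DIM('a) * unit_ball_vol (real DIM('a)) / a * R powr a)"
    by (rule nn_integral_ball_powr[OF assms])
  finally show "(\<integral>\<^sup>+x. ennreal (norm (x::'a) powr (a - real DIM('a)) * indicator (ball 0 R) x) \<partial>lborel)
     = ennreal (real DIM('a) * unit_ball_vol (real DIM('a)) / a * R powr a)" .
qed (use assms in auto)

lemma nn_integral_three_powers:
  fixes f :: "'a::euclidean_space \<Rightarrow> real"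
  assumes pos: "k1 > 0" "k2 > 0" "k3 > 0" and R: "R \<ge> 0"
    and f: "\<And>x. x \<in> ball 0 R \<Longrightarrow> x \<noteq> 0 \<Longrightarrow> f x = c1 * norm x powr (k1 - real DIM('a)) + c2 * norm x powr (k2 - real DIM('a)) + c3 * norm x powr (k3 - real DIM('a))"
    and f0: "\<And>x. x \<in> ball 0 R \<Longrightarrow> f x \<ge> 0"
  defines "P \<equiv> \<lambda>a. real DIM('a) * unit_ball_vol (real DIM('a)) / a * R powr a"
  shows "(\<integral>\<^sup>+x. ennreal (f x) * indicator (ball 0 R) x \<partial>lborel) = ennreal (c1 * P k1 + c2 * P k2 + c3 * P k3)"
proof -
  define g where "g x = c1 * (norm x powr (k1 - real DIM('a)) * indicator (ball 0 R) x)
    + c2 * (norm x powr (k2 - real DIM('a)) * indicator (ball 0 R) x)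
    + c3 * (norm x powr (k3 - real DIM('a)) * indicator (ball 0 R) x)" for x :: 'a
  have g: "has_bochner_integral lborel g (c1 * P k1 + c2 * P k2 + c3 * P k3)"
    unfolding g_def P_def
    by (intro has_bochner_integral_add has_bochner_integral_mult_right has_bochner_integral_ball_powr pos R)
  have ae0: "AE x in lborel. x \<noteq> (0::'a)" by (rule AE_lborel_singleton)
  then have ae: "AE x in lborel. ennreal (f x) * indicator (ball 0 R) x = ennreal (g x)"
  proof eventually_elim
    case (elim x)
    then show ?case by (cases "x \<in> ball 0 R") (simp_all add: g_def f)
  qed
  from ae0 have "AE x in lborel. g x \<ge> 0"
  proof eventually_elim
    case (elim x)
    then show ?case using f[of x] f0[of x] by (cases "x \<in> ball 0 R") (simp_all add: g_def)
  qed
  then have "(\<integral>\<^sup>+x. ennreal (g x) \<partial>lborel) = ennreal (c1 * P k1 + c2 * P k2 + c3 * P k3)"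
    using g by (subst nn_integral_eq_integral) (auto simp: has_bochner_integral_iff)
  then show ?thesis using nn_integral_cong_AE[OF ae] by simp
qed

lemma norm_power2_powr:
  "((norm x)\<^sup>2) powr a = norm x powr (2 * a)"
proof (cases "x = 0")
  case False
  then show ?thesis using powr_square[of "norm x" a] by simp
qed simp

text \<open>The left-hand side is the Dirichlet integral of the limit profile, the factor of \<open>b\<^sup>2\<close> its Hardy
  term and the last summand the difference between the two sides of the Hardy inequality, all up to a common factor.\<close>

lemma extremal_defect_identity:
  fixes k g b :: real
  assumes "k > 0" "g > 0"
  shows "(b - k)\<^sup>2 / (2 * k) + (g - b)\<^sup>2 / (2 * g) + 2 * (b - k) * (g - b) / (k + g)
     = b\<^sup>2 * (1 / (2 * k) + 1 / (2 * g) - 2 / (k + g)) + (g - k)\<^sup>2 / (2 * (k + g))"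
proof -
  have 1: "(b - k)\<^sup>2 / (2 * k) = b\<^sup>2 / (2 * k) - b + k / 2"
    using assms by (simp add: field_simps power2_eq_square)
  have 2: "(g - b)\<^sup>2 / (2 * g) = b\<^sup>2 / (2 * g) - b + g / 2"
    using assms by (simp add: field_simps power2_eq_square)
  have 3: "2 * (b - k) * (g - b) / (k + g) = 2 * b - 2 * b\<^sup>2 / (k + g) - 2 * k * g / (k + g)"
  proof -
    have "2 * (b - k) * (g - b) = 2 * b * (k + g) - 2 * b\<^sup>2 - 2 * k * g"
      by (simp add: algebra_simps power2_eq_square)
    then show ?thesis using assms by (simp add: diff_divide_distrib)
  qed
  have 4: "(g - k)\<^sup>2 / (2 * (k + g)) = k / 2 + g / 2 - 2 * k * g / (k + g)"
    using assms by (simp add: field_simps power2_eq_square)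
  show ?thesis unfolding 1 2 3 4 by (simp add: algebra_simps)
qed

text \<open>Testing the inequality with \<open>near_extremal\<close> and letting the smoothing parameter tend to zero gives
  the inequality for the limit profile, all three terms of which are integrals of powers of the norm.\<close>

lemma near_optimal_bound:
  fixes c k p R :: real
  defines "b \<equiv> (real DIM('a::euclidean_space) - 2) / 2"
  defines "g \<equiv> real DIM('a) / p - real DIM('a) / 2 + 1"
  defines "w \<equiv> unit_ball_vol (real DIM('a))"
  assumes N: "DIM('a) \<ge> 3" and p: "p \<ge> 1" and R: "R > 0"
    and k: "0 < k" "k < g" "k < b" "g + k \<le> real DIM('a)" and c: "c > 0"
    and ineq: "\<And>u h. H01_gradient (ball (0::'a) R) u h \<Longrightarrow> hardy_lorentz_ineq p c (ball (0::'a) R) u h"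
  shows "c \<le> 2 * g\<^sup>2 * (k + g) * w powr (2 - 2 / p) / (real DIM('a) * w * R powr (2 * g))"
proof -
  let ?N = "real DIM('a)" and ?B = "ball (0::'a) R"
  define K where "K = ?N * w"
  define q where "q = (b - k) / 2"
  define d where "d = (g - k) / 2"
  define A where "A = R powr (2 * d)"
  define P where "P a = K / a * R powr a" for a
  have w: "w > 0" by (simp add: w_def)
  have K: "K > 0" using w by (simp add: K_def)
  have b: "b > 0" using N by (simp add: b_def)
  have g0: "g > 0" using k by linarith
  have qd: "q > 0" "d > 0" "d \<le> 2 * q + 1" using k by (auto simp: q_def d_def b_def field_simps)
  have A0: "A > 0" using R by (simp add: A_def)
  define f where "f x = profile A q d ((norm x)\<^sup>2)" for x :: 'a
  have f_eq: "f x = A * norm x powr (k - b) - norm x powr (g - b)" for x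
  proof -
    have e: "2 * - q = k - b" "2 * (d - q) = g - b" by (auto simp: q_def d_def field_simps)
    show ?thesis unfolding f_def profile_def norm_power2_powr e ..
  qed
  have f_pos: "f x \<ge> 0" if "x \<in> ?B" for x
  proof (cases "x = 0")
    case True
    then show ?thesis by (simp add: f_eq)
  next
    case False
    then have "(norm x)\<^sup>2 > 0" by simp
    moreover have "(norm x)\<^sup>2 < R\<^sup>2" using that by (intro power_strict_mono) auto
    ultimately show ?thesis using profile_pos_iff[of "(norm x)\<^sup>2" R d q] R qd by (simp add: f_def A_def less_imp_le)
  qed
  define F where "F x = 2 * norm x * descent A q d ((norm x)\<^sup>2)" for x :: 'a
  have F_eq: "F x = (b - k) * A * norm x powr (k - b - 1) + (g - b) * norm x powr (g - b - 1)" if "x \<noteq> 0" for x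
  proof -
    have e1: "1 + 2 * (- q - 1) = k - b - 1" "1 + 2 * (d - q - 1) = g - b - 1"
      by (auto simp: q_def d_def field_simps)
    have e: "norm x * norm x powr (2 * (- q - 1)) = norm x powr (k - b - 1)"
      "norm x * norm x powr (2 * (d - q - 1)) = norm x powr (g - b - 1)"
      by (simp_all only: powr_mult_base[OF norm_ge_zero] e1)
    have "F x = 2 * q * A * (norm x * norm x powr (2 * (- q - 1))) + 2 * (d - q) * (norm x * norm x powr (2 * (d - q - 1)))"
      unfolding F_def descent_def norm_power2_powr by (simp add: algebra_simps)
    moreover have "2 * q = b - k" "2 * (d - q) = g - b" by (simp_all add: q_def d_def field_simps)
    ultimately show ?thesis unfolding e by (simp only:)
  qed
  have pw: "norm x powr s * norm x powr t = norm x powr (s + t)" for x :: 'a and s t by (simp add: powr_add)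
  have square: "(r * s * X + t * Y)\<^sup>2 = r\<^sup>2 * s\<^sup>2 * (X * X) + t\<^sup>2 * (Y * Y) + 2 * r * t * s * (X * Y)" for r s t X Y :: real
    by (simp add: power2_eq_square algebra_simps)
  have D: "(\<integral>\<^sup>+x. ennreal ((F x)\<^sup>2) * indicator ?B x \<partial>lborel)
      = ennreal ((b - k)\<^sup>2 * A\<^sup>2 * P (2 * k) + (g - b)\<^sup>2 * P (2 * g) + 2 * (b - k) * (g - b) * A * P (k + g))"
    unfolding P_def K_def w_def
  proof (rule nn_integral_three_powers)
    fix x :: 'a assume x: "x \<noteq> 0"
    have e: "k - b - 1 + (k - b - 1) = 2 * k - ?N" "g - b - 1 + (g - b - 1) = 2 * g - ?N" "k - b - 1 + (g - b - 1) = k + g - ?N"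
      by (auto simp: b_def field_simps)
    have "(F x)\<^sup>2 = (b - k)\<^sup>2 * A\<^sup>2 * (norm x powr (k - b - 1) * norm x powr (k - b - 1))
        + (g - b)\<^sup>2 * (norm x powr (g - b - 1) * norm x powr (g - b - 1))
        + 2 * (b - k) * (g - b) * A * (norm x powr (k - b - 1) * norm x powr (g - b - 1))"
      unfolding F_eq[OF x] by (rule square)
    then show "(F x)\<^sup>2 = (b - k)\<^sup>2 * A\<^sup>2 * norm x powr (2 * k - ?N) + (g - b)\<^sup>2 * norm x powr (2 * g - ?N)
        + 2 * (b - k) * (g - b) * A * norm x powr (k + g - ?N)"
      unfolding pw e .
  qed (use k g0 R in auto)
  have H: "(\<integral>\<^sup>+x. ennreal ((f x)\<^sup>2 / (norm x)\<^sup>2) * indicator ?B x \<partial>lborel)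
      = ennreal (A\<^sup>2 * P (2 * k) + 1 * P (2 * g) + (- 2 * A) * P (k + g))"
    unfolding P_def K_def w_def
  proof (rule nn_integral_three_powers)
    fix x :: 'a assume x: "x \<noteq> 0"
    have e: "k - b + (k - b) - 2 = 2 * k - ?N" "g - b + (g - b) - 2 = 2 * g - ?N" "k - b + (g - b) - 2 = k + g - ?N"
      by (auto simp: b_def field_simps)
    have n: "(norm x)\<^sup>2 = norm x powr 2" using x by simp
    have "(f x)\<^sup>2 / (norm x)\<^sup>2 = A\<^sup>2 * (norm x powr (k - b) * norm x powr (k - b) / norm x powr 2)
        + 1 * (norm x powr (g - b) * norm x powr (g - b) / norm x powr 2)
        + (- 2 * A) * (norm x powr (k - b) * norm x powr (g - b) / norm x powr 2)"
      unfolding f_eq n by (simp add: power2_eq_square algebra_simps diff_divide_distrib add_divide_distrib)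
    then show "(f x)\<^sup>2 / (norm x)\<^sup>2 = A\<^sup>2 * norm x powr (2 * k - ?N) + 1 * norm x powr (2 * g - ?N)
        + (- 2 * A) * norm x powr (k + g - ?N)"
      unfolding pw powr_diff[symmetric] e .
  qed (use k g0 R in auto)
  have J: "(\<integral>\<^sup>+x. ennreal (norm x powr (?N / p - ?N) * f x) * indicator ?B x \<partial>lborel)
      = ennreal (A * P (k + g) + (- 1) * P (2 * g) + 0 * P 1)"
    unfolding P_def K_def w_def
  proof (rule nn_integral_three_powers)
    fix x :: 'a
    have e: "?N / p - ?N + (k - b) = k + g - ?N" "?N / p - ?N + (g - b) = 2 * g - ?N"
      by (auto simp: b_def g_def field_simps)
    have "norm x powr (?N / p - ?N) * f x = A * (norm x powr (?N / p - ?N) * norm x powr (k - b))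
        + (- 1) * (norm x powr (?N / p - ?N) * norm x powr (g - b)) + 0 * norm x powr (1 - ?N)"
      unfolding f_eq by (simp add: algebra_simps)
    then show "norm x powr (?N / p - ?N) * f x = A * norm x powr (k + g - ?N)
        + (- 1) * norm x powr (2 * g - ?N) + 0 * norm x powr (1 - ?N)"
      unfolding pw e .
  qed (use k g0 R f_pos in auto)
  define D' where "D' = (b - k)\<^sup>2 * A\<^sup>2 * P (2 * k) + (g - b)\<^sup>2 * P (2 * g) + 2 * (b - k) * (g - b) * A * P (k + g)"
  define H' where "H' = A\<^sup>2 * P (2 * k) + 1 * P (2 * g) + (- 2 * A) * P (k + g)"
  define J' where "J' = A * P (k + g) + (- 1) * P (2 * g) + 0 * P 1"
  define Q where "Q = R powr (2 * g)"
  have Q: "Q > 0" using R by (simp add: Q_def)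
  have AQ: "A\<^sup>2 * R powr (2 * k) = Q" "A * R powr (k + g) = Q"
    unfolding A_def Q_def power2_eq_square powr_add[symmetric]
    by (rule arg_cong[of _ _ "\<lambda>a. R powr a"], simp add: d_def field_simps)+
  have AP: "A\<^sup>2 * P (2 * k) = K * Q / (2 * k)" "P (2 * g) = K * Q / (2 * g)" "A * P (k + g) = K * Q / (k + g)"
    unfolding P_def AQ(1)[symmetric] by (simp_all add: AQ(2)[unfolded AQ(1)[symmetric], symmetric])
       (simp_all add: AQ Q_def[symmetric])
  have D'_eq: "D' = K * Q * ((b - k)\<^sup>2 / (2 * k) + (g - b)\<^sup>2 / (2 * g) + 2 * (b - k) * (g - b) / (k + g))"
  proof -
    have "D' = (b - k)\<^sup>2 * (A\<^sup>2 * P (2 * k)) + (g - b)\<^sup>2 * P (2 * g) + 2 * (b - k) * (g - b) * (A * P (k + g))"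
      by (simp add: D'_def mult.assoc)
    then show ?thesis unfolding AP by (simp add: distrib_left mult_ac)
  qed
  have H'_eq: "H' = K * Q * (1 / (2 * k) + 1 / (2 * g) - 2 / (k + g))"
  proof -
    have "H' = A\<^sup>2 * P (2 * k) + P (2 * g) - 2 * (A * P (k + g))" by (simp add: H'_def)
    then show ?thesis unfolding AP by (simp add: algebra_simps)
  qed
  have J'_eq: "J' = K * Q * (g - k) / (2 * g * (k + g))"
  proof -
    have "J' = A * P (k + g) - P (2 * g)" by (simp add: J'_def)
    also have "\<dots> = K * Q * (1 / (k + g) - 1 / (2 * g))" unfolding AP by (simp add: algebra_simps)
    also have "1 / (k + g) - 1 / (2 * g) = (g - k) / (2 * g * (k + g))" using k g0 by (simp add: field_simps)
    finally show ?thesis by simp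
  qed
  have J'0: "J' \<ge> 0" unfolding J'_eq using K Q k g0 by simp
  have H'0: "H' \<ge> 0"
  proof -
    have "1 / (2 * k) + 1 / (2 * g) - 2 / (k + g) = (g - k)\<^sup>2 / (2 * k * g * (k + g))"
      using k g0 by (simp add: field_simps power2_eq_square)
    then show ?thesis unfolding H'_eq using K Q k g0 by simp
  qed
  have D'0: "D' \<ge> 0"
    unfolding D'_eq extremal_defect_identity[OF k(1) g0] using H'0 K Q k g0 unfolding H'_eq
    by (simp add: distrib_left mult.left_commute[of "K * Q"])
  define u :: "nat \<Rightarrow> 'a \<Rightarrow> real" where "u n = near_extremal R q d (1 / real (Suc n))" for n :: nat
  have ut: "u n \<in> test_functions ?B" for n
    unfolding u_def by (rule near_extremal_test_function[OF R qd(2)]) simp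
  have Bs: "?B \<in> sets lebesgue" by simp
  have ae: "AE x in lborel. x \<noteq> (0::'a)" by (rule AE_lborel_singleton)
  have grad: "(\<integral>\<^sup>+x. ennreal ((norm (gradient (u n) x))\<^sup>2) \<partial>lebesgue_on ?B) \<le> ennreal D'" for n
  proof -
    have "(\<integral>\<^sup>+x. ennreal ((norm (gradient (u n) x))\<^sup>2) * indicator ?B x \<partial>lborel) \<le> (\<integral>\<^sup>+x. ennreal ((F x)\<^sup>2) * indicator ?B x \<partial>lborel)"
    proof (rule nn_integral_mono_AE)
      from ae show "AE x in lborel. ennreal ((norm (gradient (u n) x))\<^sup>2) * indicator ?B x \<le> ennreal ((F x)\<^sup>2) * indicator ?B x"
      proof eventually_elim
        case (elim x)
        show ?case
        proof (cases "x \<in> ?B")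
          case True
          have "norm (gradient (u n) x) \<le> F x"
            using norm_gradient_near_extremal[OF R qd(2) _ qd(1,3) elim, of "1 / real (Suc n)"] True
            by (simp add: u_def F_def A_def)
          then have "(norm (gradient (u n) x))\<^sup>2 \<le> (F x)\<^sup>2" by (intro power_mono) auto
          then show ?thesis using True by (simp add: ennreal_leI)
        qed simp
      qed
    qed
    then show ?thesis unfolding nn_integral_lebesgue_on_lborel[OF Bs] D D'_def[symmetric] .
  qed
  define L where "L n = (\<integral>\<^sup>+x. ennreal (norm x powr (?N / p - ?N) * \<bar>u n x\<bar>) \<partial>lborel)" for n
  have each: "ennreal (c * (w powr (1 / p - 1))\<^sup>2) * (L n)\<^sup>2
      + ennreal (b\<^sup>2) * (\<integral>\<^sup>+x. ennreal ((u n x)\<^sup>2 / (norm x)\<^sup>2) \<partial>lebesgue_on ?B) \<le> ennreal D'" for n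
  proof -
    have b2: "(?N - 2)\<^sup>2 / 4 = b\<^sup>2" by (simp add: b_def power_divide)
    have "(\<integral>\<^sup>+x. ennreal ((norm (gradient (u n) x))\<^sup>2) \<partial>lebesgue_on ?B) < \<infinity>"
      using grad[of n] by (rule le_less_trans) simp
    note iff = hardy_lorentz_ineq_iff[OF c N this]
    have "hardy_lorentz_ineq p c ?B (u n) (gradient (u n))"
      by (rule ineq[OF test_function_H01[OF open_ball bounded_ball ut]])
    then have i: "ennreal c * (lorentz_norm ?B p 1 (u n))\<^sup>2
      + ennreal (b\<^sup>2) * (\<integral>\<^sup>+x. ennreal ((u n x)\<^sup>2 / (norm x)\<^sup>2) \<partial>lebesgue_on ?B) \<le> ennreal D'"
      unfolding iff b2 using grad[of n] by (rule order_trans)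
    have "ennreal (c * (w powr (1 / p - 1))\<^sup>2) * (L n)\<^sup>2 = ennreal c * (ennreal (w powr (1 / p - 1)) * L n)\<^sup>2"
      using c by (simp add: ennreal_mult power_mult_distrib ennreal_power mult.assoc)
    also have "\<dots> \<le> ennreal c * (lorentz_norm ?B p 1 (u n))\<^sup>2"
      using lorentz_norm_ge[OF open_ball bounded_ball ut p, of n]
      by (intro mult_left_mono power_mono) (auto simp: w_def L_def)
    finally show ?thesis using i by (meson add_right_mono order_trans)
  qed
  have lim: "(\<lambda>n. u n x) \<longlonglongrightarrow> f x" if "x \<noteq> 0" "x \<in> ?B" for x
    unfolding u_def f_def A_def by (rule near_extremal_tendsto[OF R qd(2) that(1)]) (use that in simp)
  have lowJ: "ennreal J' \<le> liminf L"
  proof -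
    have "ennreal J' = (\<integral>\<^sup>+x. ennreal (norm x powr (?N / p - ?N) * f x) * indicator ?B x \<partial>lborel)"
      unfolding J J'_def ..
    also have "\<dots> \<le> (\<integral>\<^sup>+x. liminf (\<lambda>n. ennreal (norm x powr (?N / p - ?N) * \<bar>u n x\<bar>)) \<partial>lborel)"
    proof (rule nn_integral_mono_AE)
      from ae show "AE x in lborel. ennreal (norm x powr (?N / p - ?N) * f x) * indicator ?B x
          \<le> liminf (\<lambda>n. ennreal (norm x powr (?N / p - ?N) * \<bar>u n x\<bar>))"
      proof eventually_elim
        case (elim x)
        show ?case
        proof (cases "x \<in> ?B")
          case True
          have "(\<lambda>n. ennreal (norm x powr (?N / p - ?N) * \<bar>u n x\<bar>)) \<longlonglongrightarrow> ennreal (norm x powr (?N / p - ?N) * \<bar>f x\<bar>)"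
            by (intro tendsto_ennrealI tendsto_mult tendsto_const tendsto_rabs lim elim True)
          from lim_imp_Liminf[OF _ this] show ?thesis using True f_pos[OF True] by simp
        qed simp
      qed
    qed
    also have "\<dots> \<le> liminf L"
      unfolding L_def
    proof (rule nn_integral_liminf)
      fix n
      note [measurable] = test_function_measurable(1)[OF ut[of n]]
      show "(\<lambda>x. ennreal (norm x powr (?N / p - ?N) * \<bar>u n x\<bar>)) \<in> borel_measurable lborel" by measurable
    qed
    finally show ?thesis .
  qed
  have lowH: "ennreal H' \<le> liminf (\<lambda>n. \<integral>\<^sup>+x. ennreal ((u n x)\<^sup>2 / (norm x)\<^sup>2) \<partial>lebesgue_on ?B)"
  proof -
    have "ennreal H' = (\<integral>\<^sup>+x. ennreal ((f x)\<^sup>2 / (norm x)\<^sup>2) \<partial>lebesgue_on ?B)"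
      unfolding nn_integral_lebesgue_on_lborel[OF Bs] H H'_def ..
    also have "\<dots> \<le> liminf (\<lambda>n. \<integral>\<^sup>+x. ennreal ((u n x)\<^sup>2 / (norm x)\<^sup>2) \<partial>lebesgue_on ?B)"
    proof (rule hardy_term_lower_semicontinuous)
      show "u n \<in> borel_measurable (lebesgue_on ?B)" for n
        by (rule borel_measurable_lebesgue_onI[OF test_function_measurable(1)[OF ut]])
      have "AE x in lebesgue. x \<in> ?B \<longrightarrow> (\<lambda>n. u n x) \<longlonglongrightarrow> f x"
        using AE_completion[OF ae] by eventually_elim (use lim in blast)
      then show "AE x in lebesgue_on ?B. (\<lambda>n. u n x) \<longlonglongrightarrow> f x"
        by (subst AE_restrict_space_iff) auto
    qed
    finally show ?thesis .
  qed
  have "ennreal (c * (w powr (1 / p - 1))\<^sup>2) * (ennreal J')\<^sup>2 + ennreal (b\<^sup>2) * ennreal H' \<le> ennreal D'"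
    by (rule liminf_quadratic_le[OF lowJ lowH]) (use each in \<open>auto intro: always_eventually\<close>)
  moreover have "ennreal (c * (w powr (1 / p - 1))\<^sup>2) * (ennreal J')\<^sup>2 + ennreal (b\<^sup>2) * ennreal H'
      = ennreal (c * (w powr (1 / p - 1))\<^sup>2 * J'\<^sup>2 + b\<^sup>2 * H')"
  proof -
    have "ennreal (c * (w powr (1 / p - 1))\<^sup>2 * J'\<^sup>2 + b\<^sup>2 * H') = ennreal (c * (w powr (1 / p - 1))\<^sup>2 * J'\<^sup>2) + ennreal (b\<^sup>2 * H')"
      by (rule ennreal_plus) (use c H'0 in auto)
    also have "ennreal (c * (w powr (1 / p - 1))\<^sup>2 * J'\<^sup>2) = ennreal (c * (w powr (1 / p - 1))\<^sup>2) * ennreal (J'\<^sup>2)"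
      by (rule ennreal_mult) (use c in auto)
    also have "ennreal (J'\<^sup>2) = (ennreal J')\<^sup>2" by (rule ennreal_power[OF J'0, symmetric])
    also have "ennreal (b\<^sup>2 * H') = ennreal (b\<^sup>2) * ennreal H'" by (rule ennreal_mult) (use H'0 in auto)
    finally show ?thesis ..
  qed
  ultimately have "c * (w powr (1 / p - 1))\<^sup>2 * J'\<^sup>2 + b\<^sup>2 * H' \<le> D'"
    using D'0 by (simp add: ennreal_le_iff)
  then have "c * (w powr (1 / p - 1))\<^sup>2 * J'\<^sup>2 \<le> K * Q * ((g - k)\<^sup>2 / (2 * (k + g)))"
    unfolding D'_eq H'_eq extremal_defect_identity[OF k(1) g0] by (simp add: algebra_simps)
  then have le: "c * w powr (2 / p - 2) * (K * Q * (g - k) / (2 * g * (k + g)))\<^sup>2 \<le> K * Q * ((g - k)\<^sup>2 / (2 * (k + g)))"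
    unfolding J'_eq by (simp add: power2_eq_square powr_add[symmetric])
  define Y where "Y = K * Q * ((g - k)\<^sup>2 / (2 * (k + g)))"
  have Y: "Y > 0" using K Q k g0 by (simp add: Y_def)
  have "(K * Q * (g - k) / (2 * g * (k + g)))\<^sup>2 = Y * (K * Q / (2 * g\<^sup>2 * (k + g)))"
    using k g0 by (simp add: Y_def power2_eq_square field_simps)
  with le have "Y * (c * w powr (2 / p - 2) * (K * Q / (2 * g\<^sup>2 * (k + g)))) \<le> Y * 1"
    unfolding Y_def[symmetric] by (simp add: mult_ac)
  then have "c * w powr (2 / p - 2) * (K * Q / (2 * g\<^sup>2 * (k + g))) \<le> 1"
    using Y by (simp only: mult_le_cancel_left_pos)
  then have div_le: "c * w powr (2 / p - 2) * (K * Q) / (2 * g\<^sup>2 * (k + g)) \<le> 1"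
    by (simp only: times_divide_eq_right)
  have "0 < 2 * g\<^sup>2 * (k + g)" using k g0 by simp
  from div_le[unfolded pos_divide_le_eq[OF this] mult_1]
  have "c * w powr (2 / p - 2) * (K * Q) \<le> 2 * g\<^sup>2 * (k + g)" .
  then have "w powr (2 - 2 / p) * (c * w powr (2 / p - 2) * (K * Q)) \<le> w powr (2 - 2 / p) * (2 * g\<^sup>2 * (k + g))"
    by (rule mult_left_mono) simp
  moreover have "w powr (2 - 2 / p) * w powr (2 / p - 2) = 1"
    unfolding powr_add[symmetric] using w by simp
  ultimately have "c * (K * Q) \<le> 2 * g\<^sup>2 * (k + g) * w powr (2 - 2 / p)"
    by (metis (no_types, opaque_lifting) mult.assoc mult.commute mult.left_commute mult_1)
  then show ?thesis using K Q unfolding K_def[symmetric] Q_def[symmetric] by (simp add: pos_le_divide_eq)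
qed

lemma hardy_lorentz_const_optimal:
  fixes c p m :: real
  assumes N: "DIM('a::euclidean_space) \<ge> 3" and p: "p \<ge> 1" and g: "real DIM('a) / p - real DIM('a) / 2 + 1 > 0" and m: "m > 0"
    and ineq: "\<And>(\<Omega> :: 'a set) u h. bounded \<Omega> \<Longrightarrow> open \<Omega> \<Longrightarrow> 0 \<in> \<Omega> \<Longrightarrow> measure lebesgue \<Omega> = m \<Longrightarrow>
       H01_gradient \<Omega> u h \<Longrightarrow> hardy_lorentz_ineq p c \<Omega> u h"
  shows "c \<le> hardy_lorentz_const DIM('a) p m"
proof (rule ccontr)
  assume "\<not> c \<le> hardy_lorentz_const DIM('a) p m"
  define C where "C = hardy_lorentz_const DIM('a) p m"
  define N where "N = real DIM('a)"
  define w where "w = unit_ball_vol N"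
  define \<gamma> where "\<gamma> = N / p - N / 2 + 1"
  define b where "b = (N - 2) / 2"
  define R where "R = (m / w) powr (1 / N)"
  have cC: "C < c" using \<open>\<not> c \<le> hardy_lorentz_const DIM('a) p m\<close> by (simp add: C_def)
  have C: "C > 0" unfolding C_def by (rule hardy_lorentz_const_pos) (use m g in auto)
  have w: "w > 0" by (simp add: w_def N_def)
  have N3: "N \<ge> 3" using assms(1) by (simp add: N_def)
  have R: "R > 0" using m w by (simp add: R_def)
  have \<gamma>: "\<gamma> > 0" using g by (simp add: \<gamma>_def N_def)
  have mR: "m = w * R ^ DIM('a)"
    using powr_inverse_power[of "m / w" "DIM('a)"] m w by (simp add: R_def N_def)
  have meas: "measure lebesgue (ball (0::'a) R) = m"
    using R unfolding mR by (simp add: content_ball w_def N_def)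
  have "N / p \<le> N" using p N3 by (simp add: divide_le_eq mult_le_cancel_left1)
  then have \<gamma>N: "\<gamma> + 1 / 2 \<le> N" using N3 by (simp add: \<gamma>_def)
  \<comment> \<open>Small enough that the factor \<open>(\<kappa> + \<gamma>) / \<gamma>\<close> does not close the gap between \<open>C\<close> and \<open>c\<close>.\<close>
  define \<kappa> where "\<kappa> = min (min (\<gamma> / 2) (1 / 4)) (\<gamma> * (c - C) / (2 * C))"
  have "0 < \<gamma> * (c - C) / (2 * C)" using \<gamma> cC C by simp
  then have \<kappa>: "0 < \<kappa>" "\<kappa> < \<gamma>" "\<kappa> < b" "\<gamma> + \<kappa> \<le> N" "\<kappa> \<le> \<gamma> * (c - C) / (2 * C)"
    using \<gamma> N3 \<gamma>N by (auto simp: \<kappa>_def b_def)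
  have "c \<le> 2 * \<gamma>\<^sup>2 * (\<kappa> + \<gamma>) * w powr (2 - 2 / p) / (N * w * R powr (2 * \<gamma>))"
    unfolding \<gamma>_def w_def N_def
  proof (rule near_optimal_bound)
    show "hardy_lorentz_ineq p c (ball (0::'a) R) u h" if "H01_gradient (ball (0::'a) R) u h" for u h
      by (rule ineq[OF bounded_ball open_ball _ meas that]) (use R in simp)
  qed (use assms(1) p R \<kappa> cC C in \<open>auto simp: \<gamma>_def N_def b_def\<close>)
  also have "\<dots> = (\<kappa> + \<gamma>) / \<gamma> * C"
  proof -
    have "C * (w powr (1 / p) * p)\<^sup>2 = 2 * \<gamma> ^ 3 * (N * w) / ((N / p)\<^sup>2 * R powr (2 * \<gamma>))"
      unfolding C_def mR \<gamma>_def N_def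
      by (rule hardy_lorentz_const_scaling) (use p R w in \<open>auto simp: w_def N_def\<close>)
    moreover have "(w powr (1 / p))\<^sup>2 = w powr (2 / p)"
      by (simp add: power2_eq_square powr_add[symmetric])
    ultimately have "C * w powr (2 / p) * p\<^sup>2 = 2 * \<gamma> ^ 3 * w / (N * R powr (2 * \<gamma>)) * p\<^sup>2"
      using N3 by (simp add: power_mult_distrib power_divide field_simps power2_eq_square)
    then have CW: "C * w powr (2 / p) = 2 * \<gamma> ^ 3 * w / (N * R powr (2 * \<gamma>))"
      using p by (subst (asm) mult_right_cancel) auto
    define W where "W = w powr (2 / p)"
    define S where "S = R powr (2 * \<gamma>)"
    have WS: "W > 0" "S > 0" using w R by (simp_all add: W_def S_def)
    have "w powr (2 - 2 / p) = w * w / W"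
      using w by (simp add: powr_diff power2_eq_square W_def)
    moreover have "C = 2 * \<gamma> ^ 3 * w / (N * S) / W"
      using CW WS(1)
      unfolding W_def[symmetric] S_def[symmetric] by (metis less_irrefl nonzero_mult_div_cancel_right)
    ultimately show ?thesis
      using w \<gamma> N3 WS unfolding S_def[symmetric] by (simp add: power2_eq_square power3_eq_cube mult_ac)
  qed
  also have "\<dots> = C + C * \<kappa> / \<gamma>" using \<gamma> by (simp add: field_simps)
  also have "\<dots> \<le> C + (c - C) / 2"
  proof -
    have "C * \<kappa> \<le> C * (\<gamma> * (c - C) / (2 * C))" using \<kappa>(5) C by (intro mult_left_mono) auto
    also have "\<dots> = \<gamma> * ((c - C) / 2)" using C by simp
    finally show ?thesis using \<gamma> by (simp add: divide_le_eq mult.commute)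
  qed
  also have "\<dots> < C + (c - C)" using cC by (intro add_strict_left_mono) simp
  also have "\<dots> = c" by simp
  finally show False by simp
qed

theorem theorem2:
  fixes p :: real
  assumes "CARD('n::finite) > 2"
    and "1 \<le> p" and "p < 2 * real CARD('n) / (real CARD('n) - 2)"
  shows "(\<forall>\<Omega> :: (real ^ 'n) set. bounded \<Omega> \<and> open \<Omega> \<and> 0 \<in> \<Omega> \<longrightarrow>
            (\<forall>u g. H01_gradient \<Omega> u g \<longrightarrow>
               hardy_lorentz_ineq p (hardy_lorentz_const CARD('n) p (measure lebesgue \<Omega>)) \<Omega> u g))
       \<and> (\<forall>m>0. \<forall>c.
            (\<forall>\<Omega> :: (real ^ 'n) set. bounded \<Omega> \<and> open \<Omega> \<and> 0 \<in> \<Omega> \<and> measure lebesgue \<Omega> = m \<longrightarrow>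
               (\<forall>u g. H01_gradient \<Omega> u g \<longrightarrow> hardy_lorentz_ineq p c \<Omega> u g))
            \<longrightarrow> c \<le> hardy_lorentz_const CARD('n) p m)"
proof -
  have D: "DIM(real ^ 'n) = CARD('n)" by simp
  have N: "DIM(real ^ 'n) \<ge> 3" using assms(1) by simp
  have g: "real DIM(real ^ 'n) / p - real DIM(real ^ 'n) / 2 + 1 > 0"
  proof -
    have "p * (real CARD('n) - 2) < 2 * real CARD('n)"
      using assms by (simp add: pos_less_divide_eq)
    then have "0 < real CARD('n) / p - real CARD('n) / 2 + 1"
      using assms(2) by (simp add: field_simps)
    then show ?thesis by simp
  qed
  have p: "p > 0" using assms(2) by simp
  show ?thesis
  proof (intro conjI allI impI)
    fix \<Omega> :: "(real ^ 'n) set" and u g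
    assume "bounded \<Omega> \<and> open \<Omega> \<and> 0 \<in> \<Omega>" and "H01_gradient \<Omega> u g"
    then show "hardy_lorentz_ineq p (hardy_lorentz_const CARD('n) p (measure lebesgue \<Omega>)) \<Omega> u g"
      using improved_hardy_H01[of \<Omega> p u g] N p \<open>real DIM(real ^ 'n) / p - real DIM(real ^ 'n) / 2 + 1 > 0\<close>
      unfolding D by blast
  next
    fix m c :: real
    assume "m > 0" and ineq: "\<forall>\<Omega> :: (real ^ 'n) set. bounded \<Omega> \<and> open \<Omega> \<and> 0 \<in> \<Omega> \<and> measure lebesgue \<Omega> = m \<longrightarrow>
               (\<forall>u g. H01_gradient \<Omega> u g \<longrightarrow> hardy_lorentz_ineq p c \<Omega> u g)"
    have "c \<le> hardy_lorentz_const DIM(real ^ 'n) p m"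
      by (rule hardy_lorentz_const_optimal[OF N assms(2) g \<open>m > 0\<close>]) (use ineq in blast)
    then show "c \<le> hardy_lorentz_const CARD('n) p m" by simp
  qed
qed

end
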